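(* Let $d\ge 3$ and $\alpha\in(-1,1)$ be such that $2/(1-\alpha)$ is not an integer, and let $\kappa$ be the smallest integer greater than $2/(1-\alpha)$. Suppose $$\frac{v_x}{v_y}\le\left(\frac{2}{1-\alpha}\right)^2\frac{d+2}{d}\,\frac{1-\{\kappa-2/(1-\alpha)\}}{2\kappa(\kappa-1)}.$$ Then the Bayesian predictive density with respect to the harmonic prior, $$\hat p_H(y\mid x;\alpha)=\frac{m_H^{1/\beta}(\gamma x+(1-\gamma)y,\,v_x\gamma)}{E_{Z_1}\!\left[m_H^{1/\beta}(x+\xi Z_1,\,v_x\gamma)\right]}\,\phi(y-x,v_y/\gamma),$$ satisfies $R_\alpha(\mu;\hat p_H)\le R_\alpha(\mu;\hat p_U)$ for every $\mu\in\mathbb{R}^d$, where $\hat p_U(y\mid x;\alpha)=\phi(y-x,v_y/\gamma)$.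
   Context: $v_x,v_y>0$ known; $X\sim N_d(\mu,v_xI)$, $Y\sim N_d(\mu,v_yI)$ independent; $\phi(\cdot,\sigma^2)$ is the $N_d(0,\sigma^2I)$ density. $\beta=(1-\alpha)/2$, $\gamma=1/(1+\beta v_x/v_y)$, $\xi=(1-\gamma)(v_y/\gamma)^{1/2}$, $Z_1\sim N_d(0,I)$. $m_H(w,v)=\int\phi(w-\mu,v)\|\mu\|^{-(d-2)}d\mu$. The $\alpha$-divergence loss is $D_\alpha=\int f_\alpha\!\left(\hat p(y\mid x)/\phi(y-\mu,v_y)\right)\phi(y-\mu,v_y)\,dy$ with $f_\alpha(z)=\frac{4}{1-\alpha^2}(1-z^{(1+\alpha)/2})$, and the risk is $R_\alpha(\mu;\hat p)=\int D_\alpha\,\phi(x-\mu,v_x)\,dx$. *)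

theory Defs
  imports "HOL-Analysis.Analysis"
begin

definition gdens :: "real ^ 'n \<Rightarrow> real \<Rightarrow> real" where
  "gdens w s = (2 * pi * s) powr (- real CARD('n) / 2) * exp (- (norm w)\<^sup>2 / (2 * s))"

definition mH :: "real ^ 'n \<Rightarrow> real \<Rightarrow> real" where
  "mH w v = (\<integral>\<mu>. gdens (w - \<mu>) v * norm \<mu> powr (- (real CARD('n) - 2)) \<partial>lborel)"

definition f_alpha :: "real \<Rightarrow> real \<Rightarrow> real" where
  "f_alpha \<alpha> z = 4 / (1 - \<alpha>\<^sup>2) * (1 - z powr ((1 + \<alpha>) / 2))"

definition D_alpha :: "real \<Rightarrow> real \<Rightarrow> real ^ 'n \<Rightarrow> (real ^ 'n \<Rightarrow> real) \<Rightarrow> real" where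
  "D_alpha \<alpha> vy \<mu> q =
     (\<integral>y. f_alpha \<alpha> (q y / gdens (y - \<mu>) vy) * gdens (y - \<mu>) vy \<partial>lborel)"

definition risk :: "real \<Rightarrow> real \<Rightarrow> real \<Rightarrow> real ^ 'n \<Rightarrow> (real ^ 'n \<Rightarrow> real ^ 'n \<Rightarrow> real) \<Rightarrow> real" where
  "risk \<alpha> vx vy \<mu> p = (\<integral>x. D_alpha \<alpha> vy \<mu> (p x) * gdens (x - \<mu>) vx \<partial>lborel)"

definition beta_of :: "real \<Rightarrow> real" where "beta_of \<alpha> = (1 - \<alpha>) / 2"
definition gamma_of :: "real \<Rightarrow> real \<Rightarrow> real \<Rightarrow> real" where
  "gamma_of \<alpha> vx vy = 1 / (1 + beta_of \<alpha> * vx / vy)"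
definition xi_of :: "real \<Rightarrow> real \<Rightarrow> real \<Rightarrow> real" where
  "xi_of \<alpha> vx vy = (1 - gamma_of \<alpha> vx vy) * sqrt (vy / gamma_of \<alpha> vx vy)"

definition pU :: "real \<Rightarrow> real \<Rightarrow> real \<Rightarrow> real ^ 'n \<Rightarrow> real ^ 'n \<Rightarrow> real" where
  "pU \<alpha> vx vy x y = gdens (y - x) (vy / gamma_of \<alpha> vx vy)"

text \<open>Bayesian predictive density w.r.t. the harmonic prior; the expectation over Z_1 ~ N_d(0,I)
  is written as an integral against the standard normal density.\<close>
definition pH :: "real \<Rightarrow> real \<Rightarrow> real \<Rightarrow> real ^ 'n \<Rightarrow> real ^ 'n \<Rightarrow> real" where
  "pH \<alpha> vx vy x y =
     (let b = beta_of \<alpha>; g = gamma_of \<alpha> vx vy; \<xi> = xi_of \<alpha> vx vy in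
      mH (g *\<^sub>R x + (1 - g) *\<^sub>R y) (vx * g) powr (1 / b)
      / (\<integral>z. mH (x + \<xi> *\<^sub>R z) (vx * g) powr (1 / b) * gdens z 1 \<partial>lborel)
      * gdens (y - x) (vy / g))"

end

theory Submission
  imports Defs "HOL-Probability.Distributions"
begin

text \<open>
  Put \<open>p = 1 / \<beta>\<close>, \<open>v = vx \<gamma>\<close>, \<open>S = \<xi>^2 / v\<close> and \<open>\<delta> = d / 2 - 1\<close>. Up to a constant, \<open>mH w v\<close> is
  \<open>m(w) = \<integral>_0^1 t^(\<delta>-1) exp(- t |w|^2 / (2 v)) dt\<close>. Completing the square, the risk inequality
  follows, after rescaling \<open>w\<close> by \<open>sqrt v\<close>, from the pointwise inequality
  \<open>E_z[(E_z' m^p(w + sqrt S (z + z')))^(-(p-1)/p)] \<ge> m(w)^(-(p-1))\<close>.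

  Let \<open>M_s\<close> be the exponential of the sup-convolution of \<open>log m\<close> with parameter \<open>(p - 1/2) s\<close>, which
  solves a Hamilton-Jacobi equation by characteristics. If \<open>sqrt M_s\<close> is superharmonic for \<open>s \<le> S\<close>,
  then \<open>M_s^p\<close> is a supersolution of the heat equation, so \<open>E m^p(w + sqrt S z) \<le> M_S(w)^p\<close>; and
  \<open>E M_S(w + sqrt S z)^(-(p-1)) \<ge> m(w)^(-(p-1))\<close> follows from convexity, an exponential tilt and
  \<open>E sqrt M_S(u + sqrt S z) \<le> sqrt M_S(u)\<close>. Along characteristics superharmonicity is an
  elementary inequality between the mean and variance of a truncated gamma distribution, and it
  holds for \<open>(p - 1/2) S \<le> (3/8) (\<delta> + 2) / (\<delta> + 1)\<close>, which the assumption on \<open>vx / vy\<close> implies.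
\<close>

section \<open>Truncated gamma integrals\<close>

text \<open>The obstacle is the inner expectation: \<open>m\<close> is superharmonic, but for
  \<open>p > 1\<close> the power \<open>m^p\<close> is not (far out it behaves like
  \<open>|w|^(- 2 \<delta> p)\<close>, a subharmonic power). Smoothing can therefore raise it, and
  only the convexity of the outer negative power can pay for that. The sup-convolution makes loss
  and gain comparable: at \<open>(1 + \<sigma> x) w\<close>, with \<open>x\<close> the mean of the
  truncated gamma law at \<open>|w|^2 / 2\<close>, its supremum is attained at \<open>w\<close>, so
  its value there is \<open>m(w)\<close> times an explicit Gaussian penalty. The tilt moves the
  outer mean to this point and wins the same penalty back.

  The exponent 1/2 of \<open>sqrt M_s\<close> is where the two effects balance. With
  \<open>M_s^\<theta>\<close> instead, the parameter would grow at speed \<open>p - \<theta>\<close>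
  and that tilt would return the loss iff \<open>\<theta> \<ge> 1/2\<close>, while for a given
  \<open>M_s\<close> superharmonicity of \<open>M_s^\<theta>\<close> asks less the smaller
  \<open>\<theta>\<close> is.

  The constant 3/8 is the value at \<open>\<kappa> = 2\<close> of
  \<open>(\<kappa> - 1/2) / (2 \<kappa> (\<kappa> - 1))\<close>, which decreases in
  \<open>\<kappa>\<close>; since \<open>p > 1\<close>, the smallest possible \<open>\<kappa>\<close>
  is 2.\<close>

definition trunc_gamma :: "real \<Rightarrow> real \<Rightarrow> real" where
  "trunc_gamma a \<rho> = (LINT t:{0..1}|lborel. t powr (a - 1) * exp (- \<rho> * t))"

lemma trunc_gamma_integrable:
  fixes a \<rho> :: real
  assumes "a > 0"
  shows "set_integrable lborel {0..1} (\<lambda>t::real. t powr (a - 1) * exp (- \<rho> * t))"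
proof -
  have hi: "(\<lambda>t::real. t powr (a - 1)) integrable_on {0..1}"
    using has_integral_powr_from_0[of "a - 1" 1] assms by (auto simp: integrable_on_def)
  have "(\<lambda>t::real. t powr (a - 1)) absolutely_integrable_on {0..1}"
    using hi by (intro nonnegative_absolutely_integrable_1) auto
  then have "set_integrable lborel {0..1} (\<lambda>t::real. t powr (a - 1))"
    by (simp add: set_integrable_def integrable_completion)
  then have 1: "set_integrable lborel {0..1} (\<lambda>t::real. exp \<bar>\<rho>\<bar> * t powr (a - 1))"
    by simp
  show ?thesis
  proof (rule set_integrable_bound[OF 1])
    show "set_borel_measurable lborel {0..1} (\<lambda>t. t powr (a - 1) * exp (- \<rho> * t))"
      unfolding set_borel_measurable_def by measurable
    show "AE x in lborel. x \<in> {0..1} \<longrightarrow>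
       norm (x powr (a - 1) * exp (- \<rho> * x)) \<le> norm (exp \<bar>\<rho>\<bar> * x powr (a - 1))"
    proof (intro AE_I2 impI)
      fix x :: real assume x: "x \<in> {0..1}"
      have "- \<rho> * x \<le> \<bar>\<rho>\<bar> * x" using x by (intro mult_right_mono) auto
      also have "\<dots> \<le> \<bar>\<rho>\<bar>" using x by (simp add: mult_left_le)
      finally show "norm (x powr (a - 1) * exp (- \<rho> * x)) \<le> norm (exp \<bar>\<rho>\<bar> * x powr (a - 1))"
        by (simp add: norm_mult mult.commute mult_right_mono)
    qed
  qed
qed

lemma trunc_gamma_add1:
  "trunc_gamma (a + 1) \<rho> = (LINT t:{0..1}|lborel. t * (t powr (a - 1) * exp (- \<rho> * t)))"
  unfolding trunc_gamma_def
proof (intro set_lebesgue_integral_cong allI impI)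
  fix t :: real assume "t \<in> {0..1}"
  then show "t powr (a + 1 - 1) * exp (- \<rho> * t) = t * (t powr (a - 1) * exp (- \<rho> * t))"
    using powr_mult_base[of t "a - 1"] by simp
qed simp

lemma trunc_gamma_integrable1:
  fixes a \<rho> :: real
  assumes "a > 0"
  shows "set_integrable lborel {0..1} (\<lambda>t::real. t * (t powr (a - 1) * exp (- \<rho> * t)))"
proof -
  have "set_integrable lborel {0..1} (\<lambda>t::real. t powr (a + 1 - 1) * exp (- \<rho> * t))"
    using assms by (intro trunc_gamma_integrable) auto
  also have "?this \<longleftrightarrow> ?thesis"
    using powr_mult_base[of _ "a - 1"] by (intro set_integrable_cong) auto
  finally show ?thesis .
qed

lemma trunc_gamma_add2:
  "trunc_gamma (a + 2) \<rho> = (LINT t:{0..1}|lborel. t\<^sup>2 * (t powr (a - 1) * exp (- \<rho> * t)))"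
  unfolding trunc_gamma_def
proof (intro set_lebesgue_integral_cong allI impI)
  fix t :: real assume "t \<in> {0..1}"
  then show "t powr (a + 2 - 1) * exp (- \<rho> * t) = t\<^sup>2 * (t powr (a - 1) * exp (- \<rho> * t))"
    using powr_mult_base[of t "a - 1"] powr_mult_base[of t "a"]
    by (simp add: power2_eq_square algebra_simps)
qed simp

lemma trunc_gamma_integrable2:
  fixes a \<rho> :: real
  assumes "a > 0"
  shows "set_integrable lborel {0..1} (\<lambda>t::real. t\<^sup>2 * (t powr (a - 1) * exp (- \<rho> * t)))"
proof -
  have "set_integrable lborel {0..1} (\<lambda>t::real. t * (t powr ((a + 1) - 1) * exp (- \<rho> * t)))"
    using assms by (intro trunc_gamma_integrable1) auto
  also have "?this \<longleftrightarrow> ?thesis"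
    using powr_mult_base[of _ "a - 1"] by (intro set_integrable_cong) (auto simp: power2_eq_square)
  finally show ?thesis .
qed

lemma trunc_gamma_pos:
  assumes "a > 0"
  shows "trunc_gamma a \<rho> > 0"
proof -
  have int: "integrable lborel (\<lambda>t. indicator {0..1} t *\<^sub>R (t powr (a - 1) * exp (- \<rho> * t)))"
    using trunc_gamma_integrable[OF assms] by (simp add: set_integrable_def)
  have "0 \<le> trunc_gamma a \<rho>"
    unfolding trunc_gamma_def set_lebesgue_integral_def by (intro integral_nonneg_AE) auto
  moreover have "trunc_gamma a \<rho> \<noteq> 0"
  proof
    assume "trunc_gamma a \<rho> = 0"
    then have "AE t in lborel. indicator {0..1} t *\<^sub>R (t powr (a - 1) * exp (- \<rho> * t)) = 0"
      unfolding trunc_gamma_def set_lebesgue_integral_def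
      by (subst (asm) integral_nonneg_eq_0_iff_AE[OF int]) auto
    then have "AE t in lborel. t \<notin> {0<..<1::real}"
      by eventually_elim (auto simp: indicator_def)
    then have "{0<..<1::real} \<in> null_sets lborel"
      by (subst (asm) AE_iff_null_sets[symmetric]) auto
    then show False by (auto simp: null_sets_def)
  qed
  ultimately show ?thesis by simp
qed

lemma trunc_gamma_antimono_param:
  assumes "a > 0"
  shows "trunc_gamma (a + 1) \<rho> \<le> trunc_gamma a \<rho>"
  unfolding trunc_gamma_add1 unfolding trunc_gamma_def
  using trunc_gamma_integrable[OF assms, of \<rho>] trunc_gamma_integrable1[OF assms, of \<rho>]
  by (intro set_integral_mono) (auto simp: mult_left_le_one_le)

lemma trunc_gamma_Cauchy_Schwarz:
  assumes "a > 0"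
  shows "(trunc_gamma (a + 1) \<rho>)\<^sup>2 \<le> trunc_gamma a \<rho> * trunc_gamma (a + 2) \<rho>"
proof -
  \<comment> \<open>The mean minimises the quadratic below, so its nonnegativity there is the
    Cauchy-Schwarz inequality.\<close>
  define x where "x = trunc_gamma (a + 1) \<rho> / trunc_gamma a \<rho>"
  let ?k = "\<lambda>t::real. t powr (a - 1) * exp (- \<rho> * t)"
  note int = trunc_gamma_integrable[OF assms, of \<rho>] trunc_gamma_integrable1[OF assms, of \<rho>]
     trunc_gamma_integrable2[OF assms, of \<rho>]
  have pos: "trunc_gamma a \<rho> > 0" by (rule trunc_gamma_pos[OF assms])
  have "0 \<le> (LINT t:{0..1}|lborel. (t - x)\<^sup>2 * ?k t)"
    unfolding set_lebesgue_integral_def by (intro integral_nonneg_AE) auto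
  also have "(\<lambda>t. (t - x)\<^sup>2 * ?k t) = (\<lambda>t. t\<^sup>2 * ?k t - (2 * x) * (t * ?k t) + x\<^sup>2 * ?k t)"
    by (auto simp: power2_eq_square algebra_simps)
  also have "(LINT t:{0..1}|lborel. t\<^sup>2 * ?k t - (2 * x) * (t * ?k t) + x\<^sup>2 * ?k t)
     = (LINT t:{0..1}|lborel. t\<^sup>2 * ?k t) - (2 * x) * (LINT t:{0..1}|lborel. t * ?k t)
        + x\<^sup>2 * (LINT t:{0..1}|lborel. ?k t)"
    by (subst set_integral_add set_integral_diff set_integral_mult_right;
        (intro set_integral_diff set_integrable_mult_right int)?)+ 
       (simp only: set_integral_mult_right)
  also have "\<dots> = trunc_gamma (a + 2) \<rho> - 2 * x * trunc_gamma (a + 1) \<rho> + x\<^sup>2 * trunc_gamma a \<rho>"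
    unfolding trunc_gamma_add1 trunc_gamma_add2 unfolding trunc_gamma_def by simp
  also have "\<dots> = trunc_gamma (a + 2) \<rho> - (trunc_gamma (a + 1) \<rho>)\<^sup>2 / trunc_gamma a \<rho>"
    using pos by (simp add: x_def power2_eq_square field_simps)
  finally show ?thesis using pos by (simp add: field_simps)
qed

section \<open>Derivative in \<open>\<rho>\<close> and recursion in \<open>a\<close>\<close>

lemma abs_exp_remainder_le:
  fixes y :: real assumes "\<bar>y\<bar> \<le> 1"
  shows "\<bar>exp y - 1 - y\<bar> \<le> y\<^sup>2"
proof (cases "y \<ge> 0")
  case True
  moreover have "exp y \<le> 1 + y + y\<^sup>2" using exp_bound[of y] assms True by simp
  moreover have "1 + y \<le> exp y" by (rule exp_ge_add_one_self)
  moreover have "y\<^sup>2 \<ge> 0" by simp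
  ultimately show ?thesis by linarith
next
  case False
  define u where "u = - y"
  have u: "0 < u" "u \<le> 1" using False assms by (auto simp: u_def)
  have "(1 + u) * exp (- u) \<le> exp u * exp (- u)"
    by (intro mult_right_mono) (auto simp: exp_ge_add_one_self)
  also have "\<dots> = 1" by (simp add: exp_minus)
  \<comment> \<open>For negative \<open>y\<close> the bound amounts to
    \<open>1 + u ^ 3 \<ge> 1\<close> after multiplication by \<open>1 + u\<close>.\<close>
  also have "1 \<le> (1 + u) * (1 - u + u\<^sup>2)"
  proof -
    have "(1 + u) * (1 - u + u\<^sup>2) = 1 + u ^ 3" by (simp add: power2_eq_square power3_eq_cube algebra_simps)
    then show ?thesis using u by simp
  qed
  finally have "exp (- u) \<le> 1 - u + u\<^sup>2" using u by (simp add: mult_le_cancel_left)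
  moreover have "1 - u \<le> exp (- u)" using exp_ge_add_one_self[of "-u"] by simp
  moreover have "y = - u" "exp y = exp (- u)" "u\<^sup>2 = y\<^sup>2" "0 \<le> y\<^sup>2" by (auto simp: u_def)
  ultimately show ?thesis by linarith
qed

text \<open>With a quadratic bound on the remainder, differentiation under the integral in
  \<open>trunc_gamma_deriv\<close> reduces to one pointwise estimate of the exponential, with no
  limit taken under the integral sign.\<close>

lemma DERIV_of_quadratic_remainder:
  fixes f :: "real \<Rightarrow> real"
  assumes "\<And>h. \<bar>h\<bar> \<le> 1 \<Longrightarrow> \<bar>f (x + h) - f x - h * D\<bar> \<le> C * h\<^sup>2"
  shows "DERIV f x :> D"
  unfolding DERIV_def
proof (rule LIM_equal2[where R=1])
  show "(0::real) < 1" by simp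
  have "((\<lambda>h. (f (x + h) - f x) / h - D) \<longlongrightarrow> 0) (at 0)"
  proof (rule Lim_null_comparison)
    show "\<forall>\<^sub>F h in at 0. norm ((f (x + h) - f x) / h - D) \<le> \<bar>C\<bar> * \<bar>h\<bar>"
      unfolding eventually_at
    proof (intro exI[of _ 1] conjI ballI impI)
      fix h :: real assume h: "h \<noteq> 0 \<and> dist h 0 < 1"
      have "norm ((f (x + h) - f x) / h - D) = \<bar>f (x + h) - f x - h * D\<bar> / \<bar>h\<bar>"
        using h by (simp add: abs_divide[symmetric] diff_divide_distrib)
      also have "\<dots> \<le> (\<bar>C\<bar> * h\<^sup>2) / \<bar>h\<bar>"
      proof (intro divide_right_mono)
        have "\<bar>f (x + h) - f x - h * D\<bar> \<le> C * h\<^sup>2" using assms[of h] h by simp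
        also have "\<dots> \<le> \<bar>C\<bar> * h\<^sup>2" by (intro mult_right_mono) auto
        finally show "\<bar>f (x + h) - f x - h * D\<bar> \<le> \<bar>C\<bar> * h\<^sup>2" .
      qed simp
      also have "\<dots> = \<bar>C\<bar> * \<bar>h\<bar>" using h by (simp add: power2_eq_square field_simps)
      finally show "norm ((f (x + h) - f x) / h - D) \<le> \<bar>C\<bar> * \<bar>h\<bar>" .
    qed simp
    show "((\<lambda>h. \<bar>C\<bar> * \<bar>h\<bar>) \<longlongrightarrow> 0) (at 0)"
      by (auto intro!: tendsto_eq_intros)
  qed
  then show "((\<lambda>h. (f (x + h) - f x) / h) \<longlongrightarrow> D) (at 0)"
    by (simp add: LIM_zero_iff)
qed simp

lemma trunc_gamma_deriv:
  assumes "a > 0"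
  shows "(trunc_gamma a has_real_derivative - trunc_gamma (a + 1) \<rho>) (at \<rho>)"
proof (rule DERIV_of_quadratic_remainder)
  fix h :: real assume h: "\<bar>h\<bar> \<le> 1"
  let ?k = "\<lambda>t::real. t powr (a - 1) * exp (- \<rho> * t)"
  note int = trunc_gamma_integrable[OF assms, of \<rho>] trunc_gamma_integrable1[OF assms, of \<rho>]
    trunc_gamma_integrable[OF assms, of "\<rho> + h"]
  have split: "?k t * exp (- h * t) = t powr (a - 1) * exp (- (\<rho> + h) * t)" for t
    by (simp add: exp_add[symmetric] algebra_simps)
  have int': "set_integrable lborel {0..1} (\<lambda>t. ?k t * exp (- h * t))"
    unfolding split by (rule int)
  have eq: "trunc_gamma a (\<rho> + h) - trunc_gamma a \<rho> - h * - trunc_gamma (a + 1) \<rho>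
      = (LINT t:{0..1}|lborel. ?k t * exp (- h * t) - ?k t + h * (t * ?k t))"
  proof -
    have "(LINT t:{0..1}|lborel. ?k t * exp (- h * t) - ?k t + h * (t * ?k t))
      = (LINT t:{0..1}|lborel. ?k t * exp (- h * t)) - (LINT t:{0..1}|lborel. ?k t)
         + h * (LINT t:{0..1}|lborel. t * ?k t)"
      using int int' by simp
    also have "(LINT t:{0..1}|lborel. ?k t * exp (- h * t)) = trunc_gamma a (\<rho> + h)"
      unfolding split trunc_gamma_def ..
    finally show ?thesis unfolding trunc_gamma_add1 by (simp add: trunc_gamma_def)
  qed
  have "\<bar>LINT t:{0..1}|lborel. ?k t * exp (- h * t) - ?k t + h * (t * ?k t)\<bar>
      \<le> (LINT t:{0..1}|lborel. \<bar>?k t * exp (- h * t) - ?k t + h * (t * ?k t)\<bar>)"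
    unfolding set_lebesgue_integral_def
    by (rule order_trans[OF integral_abs_bound]) (simp add: abs_mult)
  also have "\<dots> \<le> (LINT t:{0..1}|lborel. h\<^sup>2 * ?k t)"
  proof (rule set_integral_mono)
    show "set_integrable lborel {0..1} (\<lambda>t. h\<^sup>2 * ?k t)" using int by simp
    show "set_integrable lborel {0..1} (\<lambda>t. \<bar>?k t * exp (- h * t) - ?k t + h * (t * ?k t)\<bar>)"
      using int int' by (intro set_integrable_abs) simp
    fix t :: real assume t: "t \<in> {0..1}"
    have ht: "\<bar>- h * t\<bar> \<le> \<bar>h\<bar>" using t by (simp add: abs_mult mult_left_le)
    have "?k t * exp (- h * t) - ?k t + h * (t * ?k t) = ?k t * (exp (- h * t) - 1 - (- h * t))"
      by (simp add: algebra_simps)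
    then have "\<bar>?k t * exp (- h * t) - ?k t + h * (t * ?k t)\<bar> = ?k t * \<bar>exp (- h * t) - 1 - (- h * t)\<bar>"
      by (simp only: abs_mult) simp
    also have "\<dots> \<le> ?k t * (- h * t)\<^sup>2"
      using ht h by (intro mult_left_mono abs_exp_remainder_le) auto
    also have "\<dots> \<le> ?k t * h\<^sup>2"
      using ht by (intro mult_left_mono abs_le_square_iff[THEN iffD1]) auto
    finally show "\<bar>?k t * exp (- h * t) - ?k t + h * (t * ?k t)\<bar> \<le> h\<^sup>2 * ?k t"
      by (simp only: mult.commute[of "h\<^sup>2"])
  qed
  also have "\<dots> = trunc_gamma a \<rho> * h\<^sup>2"
    by (simp add: trunc_gamma_def)
  finally show "\<bar>trunc_gamma a (\<rho> + h) - trunc_gamma a \<rho> - h * - trunc_gamma (a + 1) \<rho>\<bar>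
     \<le> trunc_gamma a \<rho> * h\<^sup>2" unfolding eq .
qed

text \<open>Integration by parts with the primitive \<open>t powr a * exp (- \<rho> * t)\<close>.
  The boundary value at 1, \<open>exp (- \<rho>)\<close>, is the same for every \<open>a\<close>;
  eliminating it between consecutive parameters yields the moment bounds below.\<close>

lemma trunc_gamma_rec:
  assumes "a > 0"
  shows "\<rho> * trunc_gamma (a + 1) \<rho> = a * trunc_gamma a \<rho> - exp (- \<rho>)"
proof -
  let ?k = "\<lambda>t::real. t powr (a - 1) * exp (- \<rho> * t)"
  note int = trunc_gamma_integrable[OF assms, of \<rho>] trunc_gamma_integrable1[OF assms, of \<rho>]
  let ?F = "\<lambda>t::real. t powr a * exp (- \<rho> * t)"
  have "((\<lambda>t. a * ?k t - \<rho> * (t * ?k t)) has_integral (?F 1 - ?F 0)) {0..1}"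
  proof (rule fundamental_theorem_of_calculus_interior)
    show "continuous_on {0..1} ?F"
      using assms by (intro continuous_intros continuous_on_powr') auto
    fix t :: real assume t: "t \<in> {0<..<1}"
    have "(?F has_real_derivative a * ?k t - \<rho> * (t * ?k t)) (at t)"
      using t powr_mult_base[of t "a - 1"]
      by (auto intro!: derivative_eq_intros simp: algebra_simps)
    then show "(?F has_vector_derivative a * ?k t - \<rho> * (t * ?k t)) (at t)"
      by (simp add: has_real_derivative_iff_has_vector_derivative)
  qed simp
  moreover have "set_integrable lborel {0..1} (\<lambda>t. a * ?k t - \<rho> * (t * ?k t))"
    using int by simp
  from set_borel_integral_eq_integral(2)[OF this]
  have "integral {0..1} (\<lambda>t. a * ?k t - \<rho> * (t * ?k t))
     = a * (LINT t:{0..1}|lborel. ?k t) - \<rho> * (LINT t:{0..1}|lborel. t * ?k t)"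
    using int by (simp)
  ultimately show ?thesis
    unfolding trunc_gamma_add1 unfolding trunc_gamma_def by (auto simp: integral_unique)
qed

section \<open>Mean and variance of the density proportional to
  \<open>t powr (\<delta> - 1) * exp (- \<rho> * t)\<close> on the unit interval\<close>

definition tg_mean :: "real \<Rightarrow> real \<Rightarrow> real" where
  "tg_mean \<delta> \<rho> = trunc_gamma (\<delta> + 1) \<rho> / trunc_gamma \<delta> \<rho>"

definition tg_var :: "real \<Rightarrow> real \<Rightarrow> real" where
  "tg_var \<delta> \<rho> = trunc_gamma (\<delta> + 2) \<rho> / trunc_gamma \<delta> \<rho> - (tg_mean \<delta> \<rho>)\<^sup>2"

lemma tg_mean_pos: "\<delta> > 0 \<Longrightarrow> tg_mean \<delta> \<rho> > 0"
  by (simp add: tg_mean_def trunc_gamma_pos)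

lemma tg_mean_le_1: "\<delta> > 0 \<Longrightarrow> tg_mean \<delta> \<rho> \<le> 1"
  using trunc_gamma_antimono_param[of \<delta> \<rho>] trunc_gamma_pos[of \<delta> \<rho>] by (simp add: tg_mean_def)

lemma tg_var_nonneg:
  assumes "\<delta> > 0" shows "tg_var \<delta> \<rho> \<ge> 0"
  using trunc_gamma_Cauchy_Schwarz[OF assms, of \<rho>] trunc_gamma_pos[OF assms, of \<rho>]
  by (simp add: tg_var_def tg_mean_def power2_eq_square field_simps)

text \<open>These laws form an exponential family with parameter \<open>- \<rho>\<close>, so the
  derivative of the mean is minus the variance.\<close>

lemma tg_mean_deriv:
  assumes "\<delta> > 0"
  shows "(tg_mean \<delta> has_real_derivative - tg_var \<delta> \<rho>) (at \<rho>)"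
proof -
  have pos: "trunc_gamma \<delta> \<rho> > 0" by (rule trunc_gamma_pos[OF assms])
  have d1: "(trunc_gamma (\<delta> + 1) has_real_derivative - trunc_gamma (\<delta> + 2) \<rho>) (at \<rho>)"
    using trunc_gamma_deriv[of "\<delta> + 1" \<rho>] assms by (simp add: add_ac)
  have "((\<lambda>\<rho>. trunc_gamma (\<delta> + 1) \<rho> / trunc_gamma \<delta> \<rho>) has_real_derivative - tg_var \<delta> \<rho>) (at \<rho>)"
    using pos
    by (intro DERIV_cong[OF DERIV_divide[OF d1 trunc_gamma_deriv[OF assms]]])
       (auto simp: tg_var_def tg_mean_def power2_eq_square field_simps)
  then show ?thesis by (simp add: tg_mean_def[abs_def])
qed

lemma ln_trunc_gamma_deriv:
  assumes "\<delta> > 0"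
  shows "((\<lambda>\<rho>. ln (trunc_gamma \<delta> \<rho>)) has_real_derivative - tg_mean \<delta> \<rho>) (at \<rho>)"
  using trunc_gamma_pos[OF assms, of \<rho>]
  by (auto intro!: derivative_eq_intros trunc_gamma_deriv[OF assms] simp: tg_mean_def field_simps)

lemma continuous_on_trunc_gamma:
  "a > 0 \<Longrightarrow> continuous_on A (trunc_gamma a)"
  using trunc_gamma_deriv by (meson DERIV_isCont continuous_at_imp_continuous_on)

lemma continuous_on_tg_mean: "\<delta> > 0 \<Longrightarrow> continuous_on A (tg_mean \<delta>)"
  using tg_mean_deriv by (meson DERIV_isCont continuous_at_imp_continuous_on)

lemma continuous_on_tg_var:
  assumes "\<delta> > 0" shows "continuous_on A (tg_var \<delta>)"
proof -
  have "trunc_gamma \<delta> \<rho> \<noteq> 0" for \<rho> using trunc_gamma_pos[OF assms, of \<rho>] by simp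
  then have "continuous_on A (\<lambda>\<rho>. trunc_gamma (\<delta> + 2) \<rho> / trunc_gamma \<delta> \<rho> - (tg_mean \<delta> \<rho>)\<^sup>2)"
    using assms by (intro continuous_intros continuous_on_trunc_gamma continuous_on_tg_mean) auto
  then show ?thesis by (simp add: tg_var_def[abs_def])
qed

text \<open>The recursion at three consecutive parameters, combined with the monotonicity of moments
  of a law on the unit interval. The first and last bounds become sharp as \<open>\<rho>\<close>
  tends to infinity, where the law approaches a gamma law; the second and third are equalities at
  \<open>\<rho> = 0\<close>.\<close>

lemma tg_mean_bounds:
  assumes "\<delta> > 0" "\<rho> \<ge> 0"
  shows "\<rho> * tg_mean \<delta> \<rho> \<le> \<delta>"
    and "(\<delta> + 1) * tg_mean \<delta> \<rho> \<le> \<delta>"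
    and "((\<delta> + 1) * (\<delta> + 2) + \<rho>) * tg_mean \<delta> \<rho> \<le> \<delta> * (\<delta> + 2)"
    and "\<delta> * (\<rho> * tg_var \<delta> \<rho>) \<le> \<rho> * (tg_mean \<delta> \<rho>)\<^sup>2"
proof -
  define A B C D E where "A = trunc_gamma \<delta> \<rho>" and "B = trunc_gamma (\<delta> + 1) \<rho>"
    and "C = trunc_gamma (\<delta> + 2) \<rho>" and "D = trunc_gamma (\<delta> + 3) \<rho>" and "E = exp (- \<rho>)"
  have pos: "A > 0" "B > 0" "E > 0"
    using assms by (auto simp: A_def B_def E_def intro!: trunc_gamma_pos)
  have le: "C \<le> B" "D \<le> C"
    using trunc_gamma_antimono_param[of "\<delta> + 1" \<rho>] trunc_gamma_antimono_param[of "\<delta> + 2" \<rho>] assms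
    by (simp_all add: A_def B_def C_def D_def add_ac)
  have r1: "\<rho> * B = \<delta> * A - E" using trunc_gamma_rec[of \<delta> \<rho>] assms by (simp add: A_def B_def E_def)
  have r2: "\<rho> * C = (\<delta> + 1) * B - E"
    using trunc_gamma_rec[of "\<delta> + 1" \<rho>] assms by (simp add: B_def C_def E_def add_ac)
  have r3: "\<rho> * D = (\<delta> + 2) * C - E"
    using trunc_gamma_rec[of "\<delta> + 2" \<rho>] assms by (simp add: D_def C_def E_def add_ac)
  have x: "tg_mean \<delta> \<rho> = B / A" by (simp add: tg_mean_def A_def B_def)
  have v: "tg_var \<delta> \<rho> = C / A - (B / A)\<^sup>2" by (simp add: tg_var_def x A_def C_def)
  show "\<rho> * tg_mean \<delta> \<rho> \<le> \<delta>" using r1 pos by (simp add: x field_simps)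
  have "\<delta> * A - (\<delta> + 1) * B = \<rho> * (B - C)" using r1 r2 by (simp add: algebra_simps)
  moreover have "\<rho> * (B - C) \<ge> 0" using le assms by simp
  ultimately have m: "(\<delta> + 1) * B \<le> \<delta> * A" by simp
  then show "(\<delta> + 1) * tg_mean \<delta> \<rho> \<le> \<delta>" using pos by (simp add: x field_simps)
  \<comment> \<open>Eliminating \<open>E\<close> from \<open>r2\<close> and \<open>r3\<close>
    expresses \<open>\<rho> * (C - D)\<close> by \<open>B\<close> and \<open>C\<close>; one more
    factor \<open>\<rho>\<close> lets \<open>r1\<close> and \<open>r2\<close> reduce it to
    \<open>A\<close> and \<open>B\<close>.\<close>
  have "\<delta> * (\<delta> + 2) * A - ((\<delta> + 1) * (\<delta> + 2) + \<rho>) * B = \<rho> * (\<rho> * (C - D))"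
  proof -
    have "\<rho> * (C - D) = (\<delta> + 1) * B - (\<delta> + 2) * C"
      using r2 r3 by (simp add: algebra_simps)
    then have "\<rho> * (\<rho> * (C - D)) = \<rho> * ((\<delta> + 1) * B - (\<delta> + 2) * C)"
      by simp
    also have "\<dots> = (\<delta> + 1) * (\<rho> * B) - (\<delta> + 2) * (\<rho> * C)" by (simp add: algebra_simps)
    also have "\<dots> = (\<delta> + 1) * (\<delta> * A - E) - (\<delta> + 2) * ((\<delta> + 1) * B - E)"
      unfolding r1 r2 ..
    also have "\<dots> = \<delta> * (\<delta> + 2) * A - ((\<delta> + 1) * (\<delta> + 2)) * B - (\<delta> * A - E)"
      by (simp add: algebra_simps)
    also have "\<dots> = \<delta> * (\<delta> + 2) * A - ((\<delta> + 1) * (\<delta> + 2)) * B - \<rho> * B"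
      unfolding r1 ..
    finally show ?thesis by (simp add: algebra_simps)
  qed
  moreover have "\<rho> * (\<rho> * (C - D)) \<ge> 0" using le assms by simp
  ultimately show "((\<delta> + 1) * (\<delta> + 2) + \<rho>) * tg_mean \<delta> \<rho> \<le> \<delta> * (\<delta> + 2)"
    using pos by (simp add: x field_simps)
  have "\<delta> * ((\<rho> * C) * A) \<le> (1 + \<delta>) * ((\<rho> * B) * B)"
  proof -
    \<comment> \<open>The difference is \<open>E\<close> times the gap of the second bound.\<close>
    have "(1 + \<delta>) * ((\<rho> * B) * B) - \<delta> * ((\<rho> * C) * A) = E * (\<delta> * A - (\<delta> + 1) * B)"
      unfolding r1 r2 by (simp add: algebra_simps)
    then show ?thesis using m pos by (smt (verit) mult_nonneg_nonneg)
  qed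
  then have "\<delta> * (\<rho> * (C * A - B * B)) \<le> \<rho> * (B * B)" by (simp add: algebra_simps)
  then have "\<delta> * (\<rho> * (C * A - B * B)) / (A * A) \<le> \<rho> * (B * B) / (A * A)"
    by (rule divide_right_mono) (use pos in auto)
  moreover have "tg_var \<delta> \<rho> = (C * A - B * B) / (A * A)"
    using pos by (simp add: v power2_eq_square diff_divide_distrib)
  ultimately show "\<delta> * (\<rho> * tg_var \<delta> \<rho>) \<le> \<rho> * (tg_mean \<delta> \<rho>)\<^sup>2"
    by (simp add: x power2_eq_square)
qed

section \<open>The sup-convolution\<close>

text \<open>With \<open>N(\<rho>) = ln (trunc_gamma \<delta> \<rho>)\<close> at \<open>\<rho> = |u|^2 / 2\<close>, the function \<open>hl_log \<delta> \<sigma>\<close> is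
  the sup-convolution \<open>sup_u (N(|u|^2 / 2) - |w - u|^2 / (2 \<sigma>))\<close> in the variable \<open>R = |w|^2 / 2\<close>.
  The supremum is attained at the \<open>u\<close> with \<open>w = (1 + \<sigma> tg_mean) u\<close>, so that \<open>R = hl_map \<delta> \<sigma> \<rho>\<close>;
  \<open>hl_slope\<close> is minus the first and \<open>hl_curv\<close> the second \<open>R\<close>-derivative of \<open>hl_log\<close>.\<close>

definition hl_map :: "real \<Rightarrow> real \<Rightarrow> real \<Rightarrow> real" where
  "hl_map \<delta> \<sigma> \<rho> = \<rho> * (1 + \<sigma> * tg_mean \<delta> \<rho>)\<^sup>2"

text \<open>The radial derivative \<open>d|w| / d|u|\<close> of the characteristic map. Passing from
  norms to half squared norms adds the factor \<open>1 + \<sigma> * tg_mean \<delta> \<rho>\<close>,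
  see \<open>hl_map_deriv\<close>.\<close>

definition hl_jac :: "real \<Rightarrow> real \<Rightarrow> real \<Rightarrow> real" where
  "hl_jac \<delta> \<sigma> \<rho> = 1 + \<sigma> * tg_mean \<delta> \<rho> - 2 * \<sigma> * (\<rho> * tg_var \<delta> \<rho>)"

text \<open>The equation is solved over all reals, not only for \<open>\<rho> \<ge> 0\<close>, which
  makes \<open>R = 0\<close> an interior point with two-sided derivatives.\<close>

definition hl_inv :: "real \<Rightarrow> real \<Rightarrow> real \<Rightarrow> real" where
  "hl_inv \<delta> \<sigma> R = (THE \<rho>. hl_map \<delta> \<sigma> \<rho> = R)"

definition hl_log :: "real \<Rightarrow> real \<Rightarrow> real \<Rightarrow> real" where
  "hl_log \<delta> \<sigma> R = ln (trunc_gamma \<delta> (hl_inv \<delta> \<sigma> R)) - \<sigma> * (hl_inv \<delta> \<sigma> R * (tg_mean \<delta> (hl_inv \<delta> \<sigma> R))\<^sup>2)"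

definition hl_slope :: "real \<Rightarrow> real \<Rightarrow> real \<Rightarrow> real" where
  "hl_slope \<delta> \<sigma> R = tg_mean \<delta> (hl_inv \<delta> \<sigma> R) / (1 + \<sigma> * tg_mean \<delta> (hl_inv \<delta> \<sigma> R))"

definition hl_curv :: "real \<Rightarrow> real \<Rightarrow> real \<Rightarrow> real" where
  "hl_curv \<delta> \<sigma> R = tg_var \<delta> (hl_inv \<delta> \<sigma> R)
     / ((1 + \<sigma> * tg_mean \<delta> (hl_inv \<delta> \<sigma> R)) ^ 3 * hl_jac \<delta> \<sigma> (hl_inv \<delta> \<sigma> R))"

text \<open>For \<open>\<rho> \<ge> 0\<close> the moment bounds give
  \<open>\<rho> * tg_var \<le> tg_mean\<close>, hence a Jacobian of at least
  \<open>1 - \<sigma> * tg_mean\<close>, and the condition on \<open>\<sigma>\<close> makes the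
  subtracted term at most 1/2. Thus characteristics do not cross in this range of
  \<open>\<sigma>\<close>.\<close>

lemma hl_jac_ge_half:
  assumes "\<delta> > 0" "\<sigma> \<ge> 0" "2 * \<sigma> * \<delta> \<le> \<delta> + 1"
  shows "hl_jac \<delta> \<sigma> \<rho> \<ge> 1/2"
proof (cases "\<rho> \<ge> 0")
  case False
  have "\<rho> * tg_var \<delta> \<rho> \<le> 0"
    using False tg_var_nonneg[OF assms(1), of \<rho>] by (simp add: mult_nonpos_nonneg)
  then have "2 * \<sigma> * (\<rho> * tg_var \<delta> \<rho>) \<le> 0"
    using assms by (simp add: mult_nonneg_nonpos)
  moreover have "\<sigma> * tg_mean \<delta> \<rho> \<ge> 0"
    using tg_mean_pos[OF assms(1), of \<rho>] assms by simp
  ultimately show ?thesis by (simp add: hl_jac_def)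
next
  case True
  define x where "x = tg_mean \<delta> \<rho>"
  note b = tg_mean_bounds[OF assms(1) True, folded x_def]
  have x: "x > 0" by (simp add: x_def tg_mean_pos assms)
  have "\<rho> * x\<^sup>2 \<le> \<delta> * x"
    using mult_right_mono[OF b(1) less_imp_le[OF x]] by (simp add: power2_eq_square mult.assoc)
  with b(4) have "\<delta> * (\<rho> * tg_var \<delta> \<rho>) \<le> \<delta> * x"
    by (rule order_trans)
  then have v: "\<rho> * tg_var \<delta> \<rho> \<le> x" using assms by simp
  have "(\<delta> + 1) * (2 * (\<sigma> * x)) = 2 * \<sigma> * ((\<delta> + 1) * x)" by simp
  also have "\<dots> \<le> 2 * \<sigma> * \<delta>" using b(2) assms by (intro mult_left_mono) auto
  also have "\<dots> \<le> (\<delta> + 1) * 1" using assms by simp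
  finally have "2 * (\<sigma> * x) \<le> 1" using assms by (subst (asm) mult_le_cancel_left_pos) auto
  moreover have "\<sigma> * (\<rho> * tg_var \<delta> \<rho>) \<le> \<sigma> * x" using v assms by (intro mult_left_mono)
  ultimately show ?thesis by (simp add: hl_jac_def x_def[symmetric])
qed

lemma hl_map_deriv:
  assumes "\<delta> > 0"
  shows "(hl_map \<delta> \<sigma> has_real_derivative (1 + \<sigma> * tg_mean \<delta> \<rho>) * hl_jac \<delta> \<sigma> \<rho>) (at \<rho>)"
  unfolding hl_map_def[abs_def]
  by (auto intro!: derivative_eq_intros tg_mean_deriv[OF assms]
      simp: hl_jac_def power2_eq_square algebra_simps)

text \<open>One inequality that serves three ends: injectivity of the characteristic map, the
  brackets for its surjectivity, and the Lipschitz constant 2 of its inverse.\<close>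

lemma hl_map_expanding:
  assumes "\<delta> > 0" "\<sigma> \<ge> 0" "2 * \<sigma> * \<delta> \<le> \<delta> + 1" "r \<le> s"
  shows "(s - r) / 2 \<le> hl_map \<delta> \<sigma> s - hl_map \<delta> \<sigma> r"
proof -
  have "hl_map \<delta> \<sigma> r - r / 2 \<le> hl_map \<delta> \<sigma> s - s / 2"
  proof (rule DERIV_nonneg_imp_nondecreasing[OF assms(4)])
    fix x assume "r \<le> x" "x \<le> s"
    have j: "hl_jac \<delta> \<sigma> x \<ge> 1/2" by (rule hl_jac_ge_half[OF assms(1-3)])
    have "(1 + \<sigma> * tg_mean \<delta> x) \<ge> 1" using tg_mean_pos[OF assms(1), of x] assms by simp
    then have "(1 + \<sigma> * tg_mean \<delta> x) * hl_jac \<delta> \<sigma> x \<ge> 1 * (1/2)"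
      using j by (intro mult_mono) auto
    moreover have "((\<lambda>r. hl_map \<delta> \<sigma> r - r / 2) has_real_derivative
       (1 + \<sigma> * tg_mean \<delta> x) * hl_jac \<delta> \<sigma> x - 1/2) (at x)"
      by (auto intro!: derivative_eq_intros hl_map_deriv assms)
    ultimately show "\<exists>y. ((\<lambda>r. hl_map \<delta> \<sigma> r - r / 2) has_real_derivative y) (at x) \<and> 0 \<le> y"
      by (intro exI conjI) auto
  qed
  then show ?thesis by (simp add: field_simps)
qed

lemma hl_inv_ex1:
  assumes "\<delta> > 0" "\<sigma> \<ge> 0" "2 * \<sigma> * \<delta> \<le> \<delta> + 1"
  shows "\<exists>!\<rho>. hl_map \<delta> \<sigma> \<rho> = R"
proof (rule ex_ex1I)
  have 0: "hl_map \<delta> \<sigma> 0 = 0" by (simp add: hl_map_def)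
  have "hl_map \<delta> \<sigma> (- (2 * \<bar>R\<bar>)) \<le> R"
    using hl_map_expanding[OF assms, of "- (2 * \<bar>R\<bar>)" 0] 0 by simp
  moreover have "R \<le> hl_map \<delta> \<sigma> (2 * \<bar>R\<bar>)"
    using hl_map_expanding[OF assms, of 0 "2 * \<bar>R\<bar>"] 0 by simp
  moreover have "continuous_on {- (2 * \<bar>R\<bar>)..2 * \<bar>R\<bar>} (hl_map \<delta> \<sigma>)"
    using hl_map_deriv[OF assms(1)] by (meson DERIV_isCont continuous_at_imp_continuous_on)
  ultimately show "\<exists>\<rho>. hl_map \<delta> \<sigma> \<rho> = R"
    using IVT'[of "hl_map \<delta> \<sigma>" "- (2 * \<bar>R\<bar>)" R "2 * \<bar>R\<bar>"] by auto
next
  fix r s assume *: "hl_map \<delta> \<sigma> r = R" "hl_map \<delta> \<sigma> s = R"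
  show "r = s"
    using hl_map_expanding[OF assms, of r s] hl_map_expanding[OF assms, of s r] *
    by (cases "r \<le> s") auto
qed

lemma hl_map_inv:
  assumes "\<delta> > 0" "\<sigma> \<ge> 0" "2 * \<sigma> * \<delta> \<le> \<delta> + 1"
  shows "hl_map \<delta> \<sigma> (hl_inv \<delta> \<sigma> R) = R"
  unfolding hl_inv_def by (rule theI'[OF hl_inv_ex1[OF assms]])

lemma hl_inv_map:
  assumes "\<delta> > 0" "\<sigma> \<ge> 0" "2 * \<sigma> * \<delta> \<le> \<delta> + 1"
  shows "hl_inv \<delta> \<sigma> (hl_map \<delta> \<sigma> \<rho>) = \<rho>"
  using hl_inv_ex1[OF assms] hl_map_inv[OF assms] by metis

lemma hl_inv_0: "\<delta> > 0 \<Longrightarrow> hl_inv \<delta> 0 R = R"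
  using hl_inv_map[of \<delta> 0 R] by (simp add: hl_map_def)

text \<open>A residual bound: how badly a trial \<open>\<rho>\<close> solves the equation controls
  its distance from the solution. Freezing \<open>\<rho>\<close> at the solution for one pair
  \<open>(\<sigma>, R)\<close> and letting the pair vary gives joint continuity.\<close>

lemma hl_inv_dist:
  assumes "\<delta> > 0" "\<sigma> \<ge> 0" "2 * \<sigma> * \<delta> \<le> \<delta> + 1"
  shows "\<bar>hl_inv \<delta> \<sigma> R - \<rho>\<bar> \<le> 2 * \<bar>R - hl_map \<delta> \<sigma> \<rho>\<bar>"
  using hl_map_expanding[OF assms, of "hl_inv \<delta> \<sigma> R" \<rho>] hl_map_expanding[OF assms, of \<rho> "hl_inv \<delta> \<sigma> R"]
    hl_map_inv[OF assms, of R]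
  by (cases "hl_inv \<delta> \<sigma> R \<le> \<rho>") auto

lemma hl_inv_nonneg:
  assumes "\<delta> > 0" "\<sigma> \<ge> 0" "2 * \<sigma> * \<delta> \<le> \<delta> + 1" "R \<ge> 0"
  shows "hl_inv \<delta> \<sigma> R \<ge> 0"
proof (rule ccontr)
  assume neg: "\<not> hl_inv \<delta> \<sigma> R \<ge> 0"
  then have "(0 - hl_inv \<delta> \<sigma> R) / 2 \<le> hl_map \<delta> \<sigma> 0 - R"
    using hl_map_expanding[OF assms(1-3), of "hl_inv \<delta> \<sigma> R" 0] hl_map_inv[OF assms(1-3), of R] by simp
  then show False using neg assms(4) by (simp add: hl_map_def)
qed

lemma continuous_on_hl_inv:
  assumes "\<delta> > 0"
  shows "continuous_on ({\<sigma>. 0 \<le> \<sigma> \<and> 2 * \<sigma> * \<delta> \<le> \<delta> + 1} \<times> UNIV) (\<lambda>p. hl_inv \<delta> (fst p) (snd p))"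
  (is "continuous_on ?A _")
  unfolding continuous_on_def
proof (intro ballI)
  fix p assume p: "p \<in> ?A"
  define \<rho> where "\<rho> = hl_inv \<delta> (fst p) (snd p)"
  have "((\<lambda>q. 2 * \<bar>snd q - hl_map \<delta> (fst q) \<rho>\<bar>) \<longlongrightarrow> 2 * \<bar>snd p - hl_map \<delta> (fst p) \<rho>\<bar>) (at p within ?A)"
    unfolding hl_map_def by (intro tendsto_intros)
  also have "2 * \<bar>snd p - hl_map \<delta> (fst p) \<rho>\<bar> = 0"
    using p hl_map_inv[OF assms, of "fst p" "snd p"] by (auto simp: \<rho>_def)
  finally have lim: "((\<lambda>q. 2 * \<bar>snd q - hl_map \<delta> (fst q) \<rho>\<bar>) \<longlongrightarrow> 0) (at p within ?A)" .
  have "((\<lambda>q. hl_inv \<delta> (fst q) (snd q) - \<rho>) \<longlongrightarrow> 0) (at p within ?A)"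
    by (rule Lim_null_comparison[OF _ lim])
       (auto simp: eventually_at_filter hl_inv_dist[OF assms] intro!: always_eventually)
  then show "((\<lambda>q. hl_inv \<delta> (fst q) (snd q)) \<longlongrightarrow> hl_inv \<delta> (fst p) (snd p)) (at p within ?A)"
    unfolding \<rho>_def[symmetric] by (simp add: LIM_zero_iff)
qed

section \<open>Differentiability of the sup-convolution and its Hamilton-Jacobi equation\<close>

lemma hl_one_add_pos:
  assumes "\<delta> > 0" "\<sigma> \<ge> 0"
  shows "1 + \<sigma> * tg_mean \<delta> \<rho> \<ge> 1"
  using tg_mean_pos[OF assms(1), of \<rho>] assms by simp

lemma has_derivative_tg_mean_snd:
  assumes "\<delta> > 0"
  shows "((\<lambda>p. tg_mean \<delta> (snd p)) has_derivative (\<lambda>h. snd h * - tg_var \<delta> (snd p))) (at p)"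
  by (rule DERIV_compose_FDERIV[OF tg_mean_deriv[OF assms]]) (auto intro!: derivative_eq_intros)

text \<open>The inverse function rule for the planar map \<open>(\<sigma>, \<rho>)\<close> to
  \<open>(\<sigma>, hl_map \<delta> \<sigma> \<rho>)\<close>. Carrying \<open>\<sigma>\<close> along
  as a coordinate yields the derivatives in both variables at once.\<close>

lemma has_derivative_hl_inv:
  fixes R :: real
  assumes "\<delta> > 0" "\<sigma> > 0" "2 * \<sigma> * \<delta> < \<delta> + 1"
  defines "\<rho> \<equiv> hl_inv \<delta> \<sigma> R"
  defines "x \<equiv> tg_mean \<delta> \<rho>"
  shows "((\<lambda>p. (fst p, hl_inv \<delta> (fst p) (snd p))) has_derivative
     (\<lambda>h. (fst h, (snd h - 2 * \<rho> * x * (1 + \<sigma> * x) * fst h) / ((1 + \<sigma> * x) * hl_jac \<delta> \<sigma> \<rho>))))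
     (at (\<sigma>, R))"
proof -
  have ok: "\<sigma> \<ge> 0" "2 * \<sigma> * \<delta> \<le> \<delta> + 1" using assms by auto
  have a: "1 + \<sigma> * x \<ge> 1" unfolding x_def by (rule hl_one_add_pos) (use assms in auto)
  have j: "hl_jac \<delta> \<sigma> \<rho> \<ge> 1/2" by (rule hl_jac_ge_half[OF assms(1) ok])
  define T where "T = {\<sigma>. 0 < \<sigma> \<and> 2 * \<sigma> * \<delta> < \<delta> + 1} \<times> (UNIV :: real set)"
  have T: "open T" unfolding T_def
    by (intro open_Times open_Collect_conj open_Collect_less continuous_intros) auto
  show ?thesis
  proof (rule has_derivative_inverse_basic[where f = "\<lambda>p. (fst p, hl_map \<delta> (fst p) (snd p))"
        and T = T and f' = "\<lambda>h. (fst h, 2 * \<rho> * x * (1 + \<sigma> * x) * fst h + ((1 + \<sigma> * x) * hl_jac \<delta> \<sigma> \<rho>) * snd h)"])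
    show "((\<lambda>p. (fst p, hl_map \<delta> (fst p) (snd p))) has_derivative
      (\<lambda>h. (fst h, 2 * \<rho> * x * (1 + \<sigma> * x) * fst h + ((1 + \<sigma> * x) * hl_jac \<delta> \<sigma> \<rho>) * snd h)))
      (at (fst (\<sigma>, R), hl_inv \<delta> (fst (\<sigma>, R)) (snd (\<sigma>, R))))"
      unfolding hl_map_def
      by (rule derivative_eq_intros has_derivative_tg_mean_snd[OF assms(1)] refl)+
         (auto simp: x_def \<rho>_def hl_jac_def power2_eq_square algebra_simps)
    show "bounded_linear (\<lambda>h. (fst h, (snd h - 2 * \<rho> * x * (1 + \<sigma> * x) * fst h) / ((1 + \<sigma> * x) * hl_jac \<delta> \<sigma> \<rho>)))"
      unfolding linear_conv_bounded_linear[symmetric]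
      by (auto simp: linear_iff algebra_simps add_divide_distrib diff_divide_distrib)
    show "(\<lambda>h. (fst h, (snd h - 2 * \<rho> * x * (1 + \<sigma> * x) * fst h) / ((1 + \<sigma> * x) * hl_jac \<delta> \<sigma> \<rho>))) \<circ>
      (\<lambda>h. (fst h, 2 * \<rho> * x * (1 + \<sigma> * x) * fst h + ((1 + \<sigma> * x) * hl_jac \<delta> \<sigma> \<rho>) * snd h)) = id"
      using a j by (auto simp: fun_eq_iff)
    show "(\<sigma>, R) \<in> T" using assms by (simp add: T_def)
    have "continuous_on T (\<lambda>p. (fst p, hl_inv \<delta> (fst p) (snd p)))"
      by (intro continuous_intros continuous_on_subset[OF continuous_on_hl_inv[OF assms(1)]])
         (auto simp: T_def)
    then show "continuous (at (\<sigma>, R)) (\<lambda>p. (fst p, hl_inv \<delta> (fst p) (snd p)))"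
      using T \<open>(\<sigma>, R) \<in> T\<close> by (simp add: continuous_on_eq_continuous_at)
    fix z assume "z \<in> T"
    then show "(fst (fst z, hl_inv \<delta> (fst z) (snd z)),
          hl_map \<delta> (fst (fst z, hl_inv \<delta> (fst z) (snd z))) (snd (fst z, hl_inv \<delta> (fst z) (snd z)))) = z"
      using hl_map_inv[OF assms(1), of "fst z" "snd z"] by (auto simp: T_def)
  qed (rule T)
qed

text \<open>The gradient is constant along a characteristic: the gradient of the sup-convolution at
  \<open>w\<close> equals that of the initial function at \<open>u\<close>. Both sides are half its
  squared norm.\<close>

lemma hl_slope_sq:
  assumes "\<delta> > 0" "\<sigma> \<ge> 0" "2 * \<sigma> * \<delta> \<le> \<delta> + 1"
  shows "R * (hl_slope \<delta> \<sigma> R)\<^sup>2 = hl_inv \<delta> \<sigma> R * (tg_mean \<delta> (hl_inv \<delta> \<sigma> R))\<^sup>2"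
proof -
  define \<rho> where "\<rho> = hl_inv \<delta> \<sigma> R"
  define c where "c = 1 + \<sigma> * tg_mean \<delta> \<rho>"
  have R: "R = \<rho> * c\<^sup>2"
    using hl_map_inv[OF assms, of R] by (simp add: hl_map_def c_def \<rho>_def)
  have c: "c \<noteq> 0"
    using hl_one_add_pos[OF assms(1,2), of "\<rho>"] unfolding c_def by linarith
  have "R * (hl_slope \<delta> \<sigma> R)\<^sup>2 = R * (tg_mean \<delta> \<rho> / c)\<^sup>2"
    by (simp add: hl_slope_def c_def \<rho>_def)
  also have "\<dots> = \<rho> * (tg_mean \<delta> \<rho>)\<^sup>2"
    unfolding R using c by (simp add: power_divide)
  finally show ?thesis by (simp add: \<rho>_def)
qed

text \<open>The coefficient of \<open>fst h\<close> is the Hamilton-Jacobi equation: with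
  \<open>L\<close> for the sup-convolution, \<open>dL/d\<sigma> = |grad L|^2 / 2\<close>, and in the
  variable \<open>R\<close> the right side is \<open>R * (dL/dR)^2\<close>.\<close>

lemma has_derivative_hl_log:
  assumes "\<delta> > 0" "\<sigma> > 0" "2 * \<sigma> * \<delta> < \<delta> + 1"
  shows "((\<lambda>p. hl_log \<delta> (fst p) (snd p)) has_derivative
     (\<lambda>h. R * (hl_slope \<delta> \<sigma> R)\<^sup>2 * fst h - hl_slope \<delta> \<sigma> R * snd h)) (at (\<sigma>, R))"
proof -
  have ok: "\<sigma> \<ge> 0" "2 * \<sigma> * \<delta> \<le> \<delta> + 1" using assms by auto
  define \<rho> where "\<rho> = hl_inv \<delta> \<sigma> R"
  define x where "x = tg_mean \<delta> \<rho>"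
  define j where "j = hl_jac \<delta> \<sigma> \<rho>"
  have a: "1 + \<sigma> * x \<ge> 1" unfolding x_def by (rule hl_one_add_pos) (use assms in auto)
  have jpos: "j \<ge> 1/2" unfolding j_def by (rule hl_jac_ge_half[OF assms(1) ok])
  let ?H = "\<lambda>p. ln (trunc_gamma \<delta> (snd p)) - fst p * (snd p * (tg_mean \<delta> (snd p))\<^sup>2)"
  have lnd: "((\<lambda>p::real\<times>real. ln (trunc_gamma \<delta> (snd p))) has_derivative (\<lambda>h. snd h * - tg_mean \<delta> (snd p))) (at p)" for p
    by (rule DERIV_compose_FDERIV[OF ln_trunc_gamma_deriv[OF assms(1)]]) (auto intro!: derivative_eq_intros)
  have H: "(?H has_derivative (\<lambda>h. - x * j * snd h - \<rho> * x\<^sup>2 * fst h)) (at (\<sigma>, \<rho>))"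
    by (rule derivative_eq_intros lnd has_derivative_tg_mean_snd[OF assms(1)] refl)+
       (auto simp: x_def j_def hl_jac_def power2_eq_square algebra_simps)
  have "((\<lambda>p. ?H (fst p, hl_inv \<delta> (fst p) (snd p))) has_derivative
      (\<lambda>h. - x * j * ((snd h - 2 * \<rho> * x * (1 + \<sigma> * x) * fst h) / ((1 + \<sigma> * x) * j)) - \<rho> * x\<^sup>2 * fst h)) (at (\<sigma>, R))"
    using has_derivative_compose[OF has_derivative_hl_inv[OF assms, of R], of ?H "\<lambda>h. - x * j * snd h - \<rho> * x\<^sup>2 * fst h"] H
    by (simp add: \<rho>_def x_def j_def)
  also have "(\<lambda>h. - x * j * ((snd h - 2 * \<rho> * x * (1 + \<sigma> * x) * fst h) / ((1 + \<sigma> * x) * j)) - \<rho> * x\<^sup>2 * fst h)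
     = (\<lambda>h. R * (hl_slope \<delta> \<sigma> R)\<^sup>2 * fst h - hl_slope \<delta> \<sigma> R * snd h)"
  proof
    fix h :: "real \<times> real"
    have "- x * j * ((snd h - 2 * \<rho> * x * (1 + \<sigma> * x) * fst h) / ((1 + \<sigma> * x) * j)) - \<rho> * x\<^sup>2 * fst h
      = \<rho> * x\<^sup>2 * fst h - x / (1 + \<sigma> * x) * snd h"
    proof -
      have nz: "j \<noteq> 0" "1 + \<sigma> * x \<noteq> 0" using a jpos by auto
      have "- x * j * ((snd h - 2 * \<rho> * x * (1 + \<sigma> * x) * fst h) / ((1 + \<sigma> * x) * j))
        = - x * ((snd h - 2 * \<rho> * x * (1 + \<sigma> * x) * fst h) / (1 + \<sigma> * x))"
        using nz by simp
      also have "\<dots> = - x * (snd h / (1 + \<sigma> * x) - 2 * \<rho> * x * fst h)"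
        using nz by (simp add: diff_divide_distrib)
      finally show ?thesis by (simp add: power2_eq_square algebra_simps)
    qed
    then show "- x * j * ((snd h - 2 * \<rho> * x * (1 + \<sigma> * x) * fst h) / ((1 + \<sigma> * x) * j)) - \<rho> * x\<^sup>2 * fst h
      = R * (hl_slope \<delta> \<sigma> R)\<^sup>2 * fst h - hl_slope \<delta> \<sigma> R * snd h"
      unfolding hl_slope_sq[OF assms(1) ok] by (simp add: hl_slope_def x_def \<rho>_def)
  qed
  finally show ?thesis by (simp add: hl_log_def)
qed

lemma hl_inv_deriv:
  fixes R :: real
  assumes "\<delta> > 0" "\<sigma> > 0" "2 * \<sigma> * \<delta> < \<delta> + 1"
  defines "\<rho> \<equiv> hl_inv \<delta> \<sigma> R"
  shows "(hl_inv \<delta> \<sigma> has_real_derivative 1 / ((1 + \<sigma> * tg_mean \<delta> \<rho>) * hl_jac \<delta> \<sigma> \<rho>)) (at R)"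
proof -
  have pr: "((\<lambda>R. (\<sigma>, R)) has_derivative (\<lambda>h. (0, h))) (at R)"
    by (auto intro!: derivative_eq_intros)
  from has_derivative_snd[OF has_derivative_compose[OF pr has_derivative_hl_inv[OF assms(1-3), of R]]]
  have "((\<lambda>R. hl_inv \<delta> \<sigma> R) has_derivative (\<lambda>h. h / ((1 + \<sigma> * tg_mean \<delta> \<rho>) * hl_jac \<delta> \<sigma> \<rho>))) (at R)"
    by (simp add: \<rho>_def)
  then show ?thesis
    unfolding has_field_derivative_def by (rule has_derivative_eq_rhs) (simp add: fun_eq_iff)
qed

lemma hl_slope_deriv:
  fixes R :: real
  assumes "\<delta> > 0" "\<sigma> > 0" "2 * \<sigma> * \<delta> < \<delta> + 1"
  shows "(hl_slope \<delta> \<sigma> has_real_derivative - hl_curv \<delta> \<sigma> R) (at R)"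
proof -
  define \<rho> where "\<rho> = hl_inv \<delta> \<sigma> R"
  define c where "c = 1 + \<sigma> * tg_mean \<delta> \<rho>"
  have c: "c \<ge> 1" unfolding c_def by (rule hl_one_add_pos) (use assms in auto)
  have j: "hl_jac \<delta> \<sigma> \<rho> \<ge> 1/2" by (rule hl_jac_ge_half) (use assms in auto)
  have m: "((\<lambda>R. tg_mean \<delta> (hl_inv \<delta> \<sigma> R)) has_real_derivative
     - tg_var \<delta> \<rho> * (1 / (c * hl_jac \<delta> \<sigma> \<rho>))) (at R)"
    unfolding \<rho>_def c_def
    by (rule DERIV_chain2[OF tg_mean_deriv[OF assms(1)] hl_inv_deriv[OF assms]])
  define D where "D = - tg_var \<delta> \<rho> * (1 / (c * hl_jac \<delta> \<sigma> \<rho>))"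
  have c': "1 + \<sigma> * tg_mean \<delta> (hl_inv \<delta> \<sigma> R) = c" by (simp add: c_def \<rho>_def)
  have "((\<lambda>R. tg_mean \<delta> (hl_inv \<delta> \<sigma> R) / (1 + \<sigma> * tg_mean \<delta> (hl_inv \<delta> \<sigma> R))) has_real_derivative
     (D * c - tg_mean \<delta> \<rho> * (\<sigma> * D)) / (c * c)) (at R)"
    using c by (auto intro!: derivative_eq_intros m[folded D_def] simp: c' \<rho>_def)
  \<comment> \<open>The two terms of the quotient rule collapse because
    \<open>c - \<sigma> * tg_mean \<delta> \<rho> = 1\<close>.\<close>
  moreover have "(D * c - tg_mean \<delta> \<rho> * (\<sigma> * D)) / (c * c) = D / c\<^sup>2"
    by (simp add: c_def power2_eq_square algebra_simps)
  moreover have "D / c\<^sup>2 = - hl_curv \<delta> \<sigma> R"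
    using c j by (simp add: D_def hl_curv_def power2_eq_square power3_eq_cube \<rho>_def[symmetric] c_def[symmetric])
  ultimately show ?thesis by (simp add: hl_slope_def[abs_def])
qed

lemma hl_log_map:
  assumes "\<delta> > 0" "\<sigma> \<ge> 0" "2 * \<sigma> * \<delta> \<le> \<delta> + 1"
  shows "hl_log \<delta> \<sigma> (hl_map \<delta> \<sigma> \<rho>) = ln (trunc_gamma \<delta> \<rho>) - \<sigma> * (\<rho> * (tg_mean \<delta> \<rho>)\<^sup>2)"
  by (simp add: hl_log_def hl_inv_map[OF assms])

lemma hl_log_0: "\<delta> > 0 \<Longrightarrow> hl_log \<delta> 0 R = ln (trunc_gamma \<delta> R)"
  by (simp add: hl_log_def hl_inv_0)

lemma trunc_gamma_antimono:
  assumes "a > 0" "r \<le> s" shows "trunc_gamma a s \<le> trunc_gamma a r"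
  using trunc_gamma_deriv[OF assms(1)] trunc_gamma_pos[of "a + 1"] assms
  by (intro DERIV_nonpos_imp_nonincreasing[OF assms(2)]) (metis add_pos_pos less_imp_le neg_le_0_iff_le zero_less_one)

text \<open>Uniform bounds in \<open>R\<close>. They supply the domination hypotheses of
  \<open>radial_supersolution\<close>, where the derivatives carry the weights \<open>R\<close> and
  \<open>sqrt R\<close>.\<close>

lemma hl_bounds:
  assumes "\<delta> > 0" "\<sigma> \<ge> 0" "2 * \<sigma> * \<delta> \<le> \<delta> + 1" "R \<ge> 0"
  shows "hl_log \<delta> \<sigma> R \<le> ln (trunc_gamma \<delta> 0)"
    and "0 \<le> hl_slope \<delta> \<sigma> R" "hl_slope \<delta> \<sigma> R \<le> 1"
    and "R * (hl_slope \<delta> \<sigma> R)\<^sup>2 \<le> \<delta>"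
    and "0 \<le> hl_curv \<delta> \<sigma> R" "R * hl_curv \<delta> \<sigma> R \<le> 2"
proof -
  define \<rho> where "\<rho> = hl_inv \<delta> \<sigma> R"
  define x where "x = tg_mean \<delta> \<rho>"
  define c where "c = 1 + \<sigma> * x"
  have \<rho>: "\<rho> \<ge> 0" unfolding \<rho>_def by (rule hl_inv_nonneg[OF assms])
  note b = tg_mean_bounds[OF assms(1) \<rho>, folded x_def]
  have x: "x > 0" "x \<le> 1" using assms by (auto simp: x_def tg_mean_pos tg_mean_le_1)
  have c: "c \<ge> 1" unfolding c_def x_def by (rule hl_one_add_pos[OF assms(1,2)])
  have j: "hl_jac \<delta> \<sigma> \<rho> \<ge> 1/2" by (rule hl_jac_ge_half[OF assms(1-3)])
  have xx: "\<rho> * x\<^sup>2 \<le> \<delta> * x" "\<delta> * x \<le> \<delta>"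
    using mult_right_mono[OF b(1) less_imp_le[OF x(1)]] x assms by (simp_all add: power2_eq_square mult.assoc)
  have "ln (trunc_gamma \<delta> \<rho>) \<le> ln (trunc_gamma \<delta> 0)"
    using trunc_gamma_antimono[OF assms(1) \<rho>] trunc_gamma_pos[OF assms(1)] by simp
  moreover have "\<sigma> * (\<rho> * x\<^sup>2) \<ge> 0" using \<rho> assms by simp
  ultimately show "hl_log \<delta> \<sigma> R \<le> ln (trunc_gamma \<delta> 0)"
    by (simp add: hl_log_def \<rho>_def[symmetric] x_def[symmetric])
  have sl: "hl_slope \<delta> \<sigma> R = x / c" by (simp add: hl_slope_def x_def c_def \<rho>_def)
  show "0 \<le> hl_slope \<delta> \<sigma> R" "hl_slope \<delta> \<sigma> R \<le> 1" using x c by (auto simp: sl)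
  show "R * (hl_slope \<delta> \<sigma> R)\<^sup>2 \<le> \<delta>"
    unfolding hl_slope_sq[OF assms(1-3)] using xx by (simp add: x_def \<rho>_def)
  have v: "tg_var \<delta> \<rho> \<ge> 0" by (rule tg_var_nonneg[OF assms(1)])
  have cu: "hl_curv \<delta> \<sigma> R = tg_var \<delta> \<rho> / (c ^ 3 * hl_jac \<delta> \<sigma> \<rho>)"
    by (simp add: hl_curv_def x_def c_def \<rho>_def)
  show "0 \<le> hl_curv \<delta> \<sigma> R" using v c j by (simp add: cu)
  have R: "R = \<rho> * c\<^sup>2"
    using hl_map_inv[OF assms(1-3), of R] by (simp add: hl_map_def c_def \<rho>_def x_def)
  have "R * hl_curv \<delta> \<sigma> R = \<rho> * tg_var \<delta> \<rho> / (c * hl_jac \<delta> \<sigma> \<rho>)"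
    using c by (subst R) (simp add: cu power2_eq_square power3_eq_cube)
  also have "\<dots> \<le> 1 / (1/2)"
  proof (rule frac_le)
    have "\<delta> * (\<rho> * tg_var \<delta> \<rho>) \<le> \<delta> * 1" using b(4) xx by linarith
    then show "\<rho> * tg_var \<delta> \<rho> \<le> 1" using assms by (subst (asm) mult_le_cancel_left_pos) auto
    show "1 / 2 \<le> c * hl_jac \<delta> \<sigma> \<rho>" using mult_mono[OF c j] c by simp
  qed auto
  finally show "R * hl_curv \<delta> \<sigma> R \<le> 2" by simp
qed

text \<open>In the variable \<open>R\<close> the Laplacian is \<open>2 (R d^2/dR^2 + (\<delta> + 1) d/dR)\<close>, so this is the
  superharmonicity of \<open>exp (hl_log / 2)\<close>. The constant 3/8 enters through \<open>k\<close>: both terms are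
  largest at \<open>g = 1\<close>, where the claim is \<open>2 k \<le> \<delta> (1 - k)^2\<close>.\<close>
lemma hl_sqrt_superharmonic:
  assumes "\<delta> > 0" "\<sigma> \<ge> 0" "8 * \<sigma> * (\<delta> + 1) \<le> 3 * (\<delta> + 2)" "2 * \<sigma> * \<delta> \<le> \<delta> + 1" "R \<ge> 0"
  shows "R * hl_curv \<delta> \<sigma> R + R * (hl_slope \<delta> \<sigma> R)\<^sup>2 / 2 \<le> (\<delta> + 1) * hl_slope \<delta> \<sigma> R"
proof -
  note ok = assms(1,2,4)
  define \<rho> where "\<rho> = hl_inv \<delta> \<sigma> R"
  define x where "x = tg_mean \<delta> \<rho>"
  define h where "h = \<sigma> * x"
  \<comment> \<open>\<open>g\<close> runs from 0 at \<open>\<rho> = 0\<close> towards 1 for large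
    \<open>\<rho>\<close>; it replaces \<open>\<rho>\<close> as the parameter of the
    estimates.\<close>
  define g where "g = \<rho> * x / \<delta>"
  \<comment> \<open>The largest \<open>h\<close> allowed by the third moment bound at
    \<open>g = 1\<close> and the maximal \<open>\<sigma>\<close>.\<close>
  define k where "k = 3 * \<delta> / (8 * (\<delta> + 1))"
  define V where "V = tg_var \<delta> \<rho>"
  have \<rho>: "\<rho> \<ge> 0" unfolding \<rho>_def by (rule hl_inv_nonneg[OF ok assms(5)])
  note b = tg_mean_bounds[OF assms(1) \<rho>, folded x_def V_def]
  have x: "x > 0" using assms by (auto simp: x_def tg_mean_pos)
  have h: "h \<ge> 0" using x assms by (simp add: h_def)
  have g: "g \<ge> 0" "g \<le> 1" using b(1) \<rho> x assms by (auto simp: g_def)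
  have \<rho>x: "\<rho> * x = g * \<delta>" using assms by (simp add: g_def)
  have k: "k > 0" "k < 3/8" using assms by (auto simp: k_def field_simps)
  have hk: "h \<le> k * (2 - g)"
  proof -
    have 1: "(\<delta> + 1) * (\<delta> + 2) * x \<le> \<delta> * (\<delta> + 2 - g)"
      using b(3) \<rho>x by (simp add: algebra_simps)
    have "8 * (\<delta> + 1) * ((\<delta> + 1) * (\<delta> + 2)) * h = (8 * \<sigma> * (\<delta> + 1)) * ((\<delta> + 1) * (\<delta> + 2) * x)"
      by (simp add: h_def algebra_simps)
    also have "\<dots> \<le> (3 * (\<delta> + 2)) * (\<delta> * (\<delta> + 2 - g))"
      by (rule mult_mono[OF assms(3) 1]) (use assms x in auto)
    also have "\<dots> \<le> (3 * (\<delta> + 2)) * (\<delta> * ((\<delta> + 1) * (2 - g)))"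
    proof -
      have "(\<delta> + 1) * (2 - g) - (\<delta> + 2 - g) = \<delta> * (1 - g)" by (simp add: algebra_simps)
      moreover have "\<delta> * (1 - g) \<ge> 0" using g assms by simp
      ultimately have "\<delta> + 2 - g \<le> (\<delta> + 1) * (2 - g)" by linarith
      then show ?thesis using assms by (intro mult_left_mono) auto
    qed
    also have "\<dots> = 8 * (\<delta> + 1) * ((\<delta> + 1) * (\<delta> + 2)) * (k * (2 - g))"
      using assms by (simp add: k_def field_simps)
    finally show ?thesis using assms by (subst (asm) mult_le_cancel_left_pos) auto
  qed
  \<comment> \<open>The middle expression bounds the Jacobian from below, see \<open>j\<close>. On
    the unit interval \<open>(2 - g) * (2 * g - 1)\<close> has its maximum 1 at
    \<open>g = 1\<close>.\<close>
  have e1: "1 - k \<le> 1 + h - 2 * h * g"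
  proof (cases "2 * g \<le> 1")
    case True
    then have "h * (1 - 2 * g) \<ge> 0" using h by simp
    then show ?thesis using k by (simp add: algebra_simps)
  next
    case False
    then have "h * (2 * g - 1) \<le> k * (2 - g) * (2 * g - 1)" using hk by (intro mult_right_mono) auto
    also have "\<dots> \<le> k * 1"
    proof -
      have "1 - (2 - g) * (2 * g - 1) = (1 - g) * (3 - 2 * g)" by (simp add: algebra_simps)
      moreover have "(1 - g) * (3 - 2 * g) \<ge> 0" using g by simp
      ultimately have "(2 - g) * (2 * g - 1) \<le> 1" by linarith
      then show ?thesis using k by (simp only: mult.assoc) (intro mult_left_mono, auto)
    qed
    finally show ?thesis by (simp add: algebra_simps)
  qed
  have e2: "g * (1 + h) \<le> 1 + k"
  proof -
    have "g * h \<le> g * (k * (2 - g))" using hk g by (intro mult_left_mono) auto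
    also have "\<dots> = k - k * (1 - g)\<^sup>2" by (simp add: power2_eq_square algebra_simps)
    also have "\<dots> \<le> k" using k by simp
    finally show ?thesis using g by (simp add: algebra_simps)
  qed
  \<comment> \<open>What remains of the claim after division by the slope \<open>x / c\<close>: the
    first summand is the curvature term, the second the squared gradient term.\<close>
  have final: "1 / (1 - k) + \<delta> * (1 + k) / 2 \<le> \<delta> + 1"
  proof -
    have kk: "k * (8 * (\<delta> + 1)) = 3 * \<delta>" using assms by (simp add: k_def)
    have "2 * k \<le> \<delta> * (1 - k)\<^sup>2"
    proof -
      have "64 * (\<delta> + 1)\<^sup>2 * (\<delta> * (1 - k)\<^sup>2) = \<delta> * (8 * (\<delta> + 1) - k * (8 * (\<delta> + 1)))\<^sup>2"
        by (simp add: power2_eq_square algebra_simps)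
      also have "\<dots> = \<delta> * (5 * \<delta> + 8)\<^sup>2" unfolding kk by (simp add: algebra_simps)
      also have "\<dots> \<ge> \<delta> * (48 * (\<delta> + 1))"
        using assms by (intro mult_left_mono) (auto simp: power2_eq_square algebra_simps)
      also have "\<delta> * (48 * (\<delta> + 1)) = 64 * (\<delta> + 1)\<^sup>2 * (2 * k)"
      proof -
        have "64 * (\<delta> + 1)\<^sup>2 * (2 * k) = 16 * (\<delta> + 1) * (k * (8 * (\<delta> + 1)))"
          by (simp add: power2_eq_square algebra_simps)
        then show ?thesis unfolding kk by (simp add: algebra_simps)
      qed
      finally show ?thesis using assms by (subst (asm) mult_le_cancel_left_pos) auto
    qed
    then show ?thesis using k by (simp add: field_simps power2_eq_square)
  qed
  have Vg: "\<rho> * V \<le> g * x"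
  proof -
    have "\<rho> * x\<^sup>2 = (\<rho> * x) * x" by (simp add: power2_eq_square)
    also have "\<dots> = \<delta> * (g * x)" unfolding \<rho>x by simp
    finally have "\<delta> * (\<rho> * V) \<le> \<delta> * (g * x)" using b(4) by simp
    then show ?thesis using assms by simp
  qed
  have V: "V \<ge> 0" unfolding V_def by (rule tg_var_nonneg[OF assms(1)])
  have j: "1 + h - 2 * h * g \<le> hl_jac \<delta> \<sigma> \<rho>"
  proof -
    have "\<sigma> * (\<rho> * V) \<le> \<sigma> * (g * x)" using Vg assms by (intro mult_left_mono)
    then show ?thesis by (simp add: hl_jac_def h_def x_def[symmetric] V_def[symmetric] mult_ac)
  qed
  have jpos: "hl_jac \<delta> \<sigma> \<rho> > 0" using e1 j k by linarith
  define c where "c = 1 + h"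
  have c: "c \<ge> 1" using h by (simp add: c_def)
  have R: "R = \<rho> * c\<^sup>2"
    using hl_map_inv[OF ok, of R] by (simp add: hl_map_def c_def h_def \<rho>_def x_def)
  have sl: "hl_slope \<delta> \<sigma> R = x / c" by (simp add: hl_slope_def x_def c_def h_def \<rho>_def)
  have cu: "hl_curv \<delta> \<sigma> R = V / (c ^ 3 * hl_jac \<delta> \<sigma> \<rho>)"
    by (simp add: hl_curv_def x_def c_def h_def \<rho>_def V_def)
  have "R * hl_curv \<delta> \<sigma> R = (\<rho> * V / hl_jac \<delta> \<sigma> \<rho>) / c"
    using c by (subst R) (simp add: cu power2_eq_square power3_eq_cube)
  also have "\<dots> \<le> (x * (1 / (1 - k))) / c"
  proof (intro divide_right_mono)
    have "\<rho> * V / hl_jac \<delta> \<sigma> \<rho> \<le> (g * x) / (1 - k)"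
      using Vg e1 j k V \<rho> g x by (intro frac_le) auto
    also have "\<dots> \<le> (1 * x) / (1 - k)" using g x k by (intro divide_right_mono mult_right_mono) auto
    finally show "\<rho> * V / hl_jac \<delta> \<sigma> \<rho> \<le> x * (1 / (1 - k))" by simp
  qed (use c in auto)
  moreover have "R * (hl_slope \<delta> \<sigma> R)\<^sup>2 / 2 \<le> (x * (\<delta> * (1 + k) / 2)) / c"
  proof -
    have "R * (hl_slope \<delta> \<sigma> R)\<^sup>2 / 2 = \<rho> * x * x / 2"
      unfolding hl_slope_sq[OF ok] by (simp add: x_def \<rho>_def power2_eq_square)
    also have "\<dots> = (x * (\<delta> * (g * c) / 2)) / c" using c \<rho>x by (simp add: field_simps)
    also have "\<dots> \<le> (x * (\<delta> * (1 + k) / 2)) / c"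
      using e2 x assms c by (intro divide_right_mono mult_left_mono) (auto simp: c_def)
    finally show ?thesis .
  qed
  ultimately have "R * hl_curv \<delta> \<sigma> R + R * (hl_slope \<delta> \<sigma> R)\<^sup>2 / 2
      \<le> x * (1 / (1 - k) + \<delta> * (1 + k) / 2) / c"
    by (simp add: algebra_simps add_divide_distrib)
  also have "\<dots> \<le> x * (\<delta> + 1) / c"
    using final x c by (intro divide_right_mono mult_left_mono) auto
  finally show ?thesis by (simp add: sl algebra_simps)
qed

lemma continuous_on_hl:
  assumes "\<delta> > 0"
  defines "A \<equiv> {\<sigma>. 0 \<le> \<sigma> \<and> 2 * \<sigma> * \<delta> \<le> \<delta> + 1} \<times> (UNIV :: real set)"
  shows "continuous_on A (\<lambda>p. hl_log \<delta> (fst p) (snd p))"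
    and "continuous_on A (\<lambda>p. hl_slope \<delta> (fst p) (snd p))"
    and "continuous_on A (\<lambda>p. hl_curv \<delta> (fst p) (snd p))"
proof -
  have inv: "continuous_on A (\<lambda>p. hl_inv \<delta> (fst p) (snd p))"
    unfolding A_def by (rule continuous_on_hl_inv[OF assms(1)])
  have tg: "continuous_on A (\<lambda>p. trunc_gamma \<delta> (hl_inv \<delta> (fst p) (snd p)))"
    by (rule continuous_on_compose2[OF continuous_on_trunc_gamma[OF assms(1), of UNIV] inv]) auto
  have m: "continuous_on A (\<lambda>p. tg_mean \<delta> (hl_inv \<delta> (fst p) (snd p)))"
    by (rule continuous_on_compose2[OF continuous_on_tg_mean[OF assms(1), of UNIV] inv]) auto
  have v: "continuous_on A (\<lambda>p. tg_var \<delta> (hl_inv \<delta> (fst p) (snd p)))"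
    by (rule continuous_on_compose2[OF continuous_on_tg_var[OF assms(1), of UNIV] inv]) auto
  have nz: "trunc_gamma \<delta> \<rho> \<noteq> 0" for \<rho> using trunc_gamma_pos[OF assms(1), of \<rho>] by simp
  have nz1: "1 + fst p * tg_mean \<delta> \<rho> \<noteq> 0" if "p \<in> A" for p :: "real \<times> real" and \<rho>
    using hl_one_add_pos[OF assms(1), of "fst p" \<rho>] that by (auto simp: A_def)
  have nz2: "hl_jac \<delta> (fst p) \<rho> \<noteq> 0" if "p \<in> A" for p :: "real \<times> real" and \<rho>
    using hl_jac_ge_half[OF assms(1), of "fst p" \<rho>] that by (auto simp: A_def)
  show "continuous_on A (\<lambda>p. hl_log \<delta> (fst p) (snd p))"
    unfolding hl_log_def by (intro continuous_intros tg m inv) (auto simp: nz)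
  show "continuous_on A (\<lambda>p. hl_slope \<delta> (fst p) (snd p))"
    unfolding hl_slope_def by (intro continuous_intros m) (auto simp: nz1)
  have "continuous_on A (\<lambda>p. hl_jac \<delta> (fst p) (hl_inv \<delta> (fst p) (snd p)))"
    unfolding hl_jac_def by (intro continuous_intros m v inv)
  then show "continuous_on A (\<lambda>p. hl_curv \<delta> (fst p) (snd p))"
    unfolding hl_curv_def by (intro continuous_intros m v) (auto simp: nz1 nz2)
qed

section \<open>Gaussian integrals\<close>

lemma lborel_nn_integral_translate:
  fixes f :: "'a::euclidean_space \<Rightarrow> ennreal"
  assumes [measurable]: "f \<in> borel_measurable borel"
  shows "(\<integral>\<^sup>+z. f (c + z) \<partial>lborel) = (\<integral>\<^sup>+z. f z \<partial>lborel)"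
  by (subst (2) lborel_distr_plus[of c, symmetric]) (simp add: nn_integral_distr)

lemma lborel_integral_translate:
  fixes f :: "'a::euclidean_space \<Rightarrow> real"
  assumes [measurable]: "f \<in> borel_measurable borel"
  shows "(\<integral>z. f (c + z) \<partial>lborel) = (\<integral>z. f z \<partial>lborel)"
  by (subst (2) lborel_distr_plus[of c, symmetric]) (simp add: integral_distr)

lemma lborel_integrable_translate:
  fixes f :: "'a::euclidean_space \<Rightarrow> real"
  assumes "integrable lborel f"
  shows "integrable lborel (\<lambda>z. f (c + z))"
proof -
  have [measurable]: "f \<in> borel_measurable borel"
    using borel_measurable_integrable[OF assms] by simp
  have "integrable (distr lborel borel ((+) c)) f" using assms by (simp add: lborel_distr_plus)
  then show ?thesis by (simp add: integrable_distr_eq)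
qed

lemma nn_integral_exp_square:
  assumes "c > 0"
  shows "(\<integral>\<^sup>+(x::real). ennreal (exp (- c * x\<^sup>2)) \<partial>lborel) = ennreal (sqrt (pi / c))"
proof -
  define s where "s = sqrt (1 / (2 * c))"
  have s: "s > 0" "s\<^sup>2 = 1 / (2 * c)" using assms by (auto simp: s_def)
  have eq: "exp (- c * x\<^sup>2) = sqrt (pi / c) * normal_density 0 s x" for x
  proof -
    have "sqrt (2 * pi * s\<^sup>2) = sqrt (pi / c)" using assms by (simp add: s(2))
    moreover have "x\<^sup>2 / (2 * s\<^sup>2) = c * x\<^sup>2" using assms by (simp add: s(2))
    moreover have "sqrt (pi / c) > 0" using assms by simp
    ultimately show ?thesis using assms by (simp add: normal_density_def)
  qed
  have "(\<integral>\<^sup>+x. ennreal (normal_density 0 s x) \<partial>lborel) = 1"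
    using integral_normal_density[OF s(1), of 0] integrable_normal_density[OF s(1), of 0]
    by (subst nn_integral_eq_integral) auto
  then show ?thesis
    unfolding eq using assms by (simp add: ennreal_mult' nn_integral_cmult)
qed

lemma nn_integral_exp_norm_square:
  assumes "c > 0"
  shows "(\<integral>\<^sup>+(x::real^'n). ennreal (exp (- c * (norm x)\<^sup>2)) \<partial>lborel) = ennreal ((pi / c) powr (real CARD('n) / 2))"
proof -
  have "ennreal (exp (- c * (norm x)\<^sup>2)) = (\<Prod>b\<in>Basis. ennreal (exp (- c * (x \<bullet> b)\<^sup>2)))" for x :: "real^'n"
  proof -
    have "(norm x)\<^sup>2 = (\<Sum>b\<in>Basis. (x \<bullet> b)\<^sup>2)"
      unfolding power2_norm_eq_inner by (subst euclidean_inner) (simp add: power2_eq_square)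
    then show ?thesis by (simp add: sum_distrib_left exp_sum prod_ennreal flip: sum_negf)
  qed
  then have "(\<integral>\<^sup>+(x::real^'n). ennreal (exp (- c * (norm x)\<^sup>2)) \<partial>lborel)
     = (\<integral>\<^sup>+(x::real^'n). (\<Prod>b\<in>Basis. ennreal (exp (- c * (x \<bullet> b)\<^sup>2))) \<partial>lborel)"
    by simp
  also have "\<dots> = (\<Prod>b\<in>(Basis :: (real^'n) set). (\<integral>\<^sup>+(x::real). ennreal (exp (- c * x\<^sup>2)) \<partial>lborel))"
    by (rule nn_integral_lborel_prod) auto
  also have "\<dots> = ennreal (sqrt (pi / c)) ^ CARD('n)"
    unfolding nn_integral_exp_square[OF assms] by simp
  also have "\<dots> = ennreal (sqrt (pi / c) ^ CARD('n))"
    using assms by (intro ennreal_power) auto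
  also have "sqrt (pi / c) ^ CARD('n) = (pi / c) powr (real CARD('n) / 2)"
    using assms by (simp add: powr_half_sqrt[symmetric] powr_realpow[symmetric] powr_powr)
  finally show ?thesis .
qed

lemma gdens_pos [simp]: "s > 0 \<Longrightarrow> gdens z s > 0"
  by (simp add: gdens_def)

lemma gdens_nonneg [simp]: "gdens z s \<ge> 0"
  by (simp add: gdens_def)

lemma continuous_on_gdens: "s > 0 \<Longrightarrow> continuous_on A (\<lambda>z. gdens z s)"
  unfolding gdens_def by (intro continuous_intros) auto

lemma borel_measurable_gdens [measurable]: "(\<lambda>z. gdens z s) \<in> borel_measurable borel"
  unfolding gdens_def by measurable

lemma nn_integral_gdens:
  assumes "s > 0"
  shows "(\<integral>\<^sup>+(z::real^'n). ennreal (gdens z s) \<partial>lborel) = 1"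
proof -
  have eq: "gdens z s = (2 * pi * s) powr (- real CARD('n) / 2) * exp (- (1 / (2 * s)) * (norm z)\<^sup>2)" for z :: "real^'n"
    by (simp add: gdens_def)
  have "(2 * pi * s) powr (- real CARD('n) / 2) * (2 * pi * s) powr (real CARD('n) / 2) = 1"
    using assms by (simp add: powr_add[symmetric])
  then have 1: "ennreal ((2 * pi * s) powr (- real CARD('n) / 2)) * ennreal ((2 * pi * s) powr (real CARD('n) / 2)) = 1"
    by (simp only: ennreal_mult'[symmetric] powr_ge_zero ennreal_1)
  have "(\<integral>\<^sup>+(z::real^'n). ennreal (gdens z s) \<partial>lborel)
    = ennreal ((2 * pi * s) powr (- real CARD('n) / 2))
      * (\<integral>\<^sup>+(z::real^'n). ennreal (exp (- (1 / (2 * s)) * (norm z)\<^sup>2)) \<partial>lborel)"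
    unfolding eq by (subst ennreal_mult') (auto intro!: nn_integral_cmult)
  also have "\<dots> = 1"
    using assms 1 by (subst nn_integral_exp_norm_square) (auto simp: mult_ac)
  finally show ?thesis .
qed

lemma integrable_gdens:
  assumes "s > 0" shows "integrable lborel (\<lambda>z::real^'n. gdens z s)"
  using nn_integral_gdens[OF assms, where 'n='n] by (intro integrableI_nonneg) auto

lemma integral_gdens:
  assumes "s > 0" shows "(\<integral>(z::real^'n). gdens z s \<partial>lborel) = 1"
  using nn_integral_gdens[OF assms, where 'n='n] by (subst integral_eq_nn_integral) auto

lemma integrable_norm_gdens:
  "integrable lborel (\<lambda>z::real^'n. norm z * gdens z 1)"
proof -
  have "integrable lborel (\<lambda>z::real^'n. exp (- (1/4) * (norm z)\<^sup>2))"
    using nn_integral_exp_norm_square[of "1/4", where 'n='n] by (intro integrableI_nonneg) auto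
  then have i: "integrable lborel (\<lambda>z::real^'n. (2 * pi) powr (- real CARD('n) / 2) * exp (- (1/4) * (norm z)\<^sup>2))"
    by simp
  show ?thesis
  proof (rule Bochner_Integration.integrable_bound[OF i])
    show "AE z::real^'n in lborel. norm (norm z * gdens z 1) \<le> norm ((2 * pi) powr (- real CARD('n) / 2) * exp (- (1/4) * (norm z)\<^sup>2))"
    proof (rule AE_I2)
      fix z :: "real^'n"
      define t where "t = norm z"
      \<comment> \<open>A square that gives \<open>t \<le> exp (t^2 / 4)\<close>: the factor
        \<open>norm z\<close> costs half of the Gaussian decay.\<close>
      have "0 \<le> (t / 2 - 1)\<^sup>2" by simp
      then have "t \<le> 1 + t\<^sup>2 / 4" by (simp add: power2_eq_square algebra_simps)
      also have "\<dots> \<le> exp (t\<^sup>2 / 4)" by (rule exp_ge_add_one_self)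
      finally have "t * exp (- t\<^sup>2 / 2) \<le> exp (t\<^sup>2 / 4) * exp (- t\<^sup>2 / 2)" by (intro mult_right_mono) auto
      also have "\<dots> = exp (- (1/4) * t\<^sup>2)" by (simp add: exp_add[symmetric])
      finally show "norm (norm z * gdens z 1) \<le> norm ((2 * pi) powr (- real CARD('n) / 2) * exp (- (1/4) * (norm z)\<^sup>2))"
        by (simp add: gdens_def t_def mult.left_commute mult_left_mono)
    qed
  qed measurable
qed

lemma integrable_gdens_bounded:
  fixes g :: "real^'n \<Rightarrow> real"
  assumes [measurable]: "g \<in> borel_measurable borel"
    and "\<And>z. \<bar>g z\<bar> \<le> A + B * norm z"
  shows "integrable lborel (\<lambda>z. gdens z 1 * g z)"
proof (rule Bochner_Integration.integrable_bound)
  show "integrable lborel (\<lambda>z::real^'n. A * gdens z 1 + B * (norm z * gdens z 1))"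
    using integrable_gdens[of 1, where 'n='n] integrable_norm_gdens[where 'n='n] by simp
  show "AE z in lborel. norm (gdens z 1 * g z) \<le> norm (A * gdens z 1 + B * (norm z * gdens z 1))"
  proof (rule AE_I2)
    fix z :: "real^'n"
    have "norm (gdens z 1 * g z) = gdens z 1 * \<bar>g z\<bar>" by (simp add: abs_mult)
    also have "\<dots> \<le> gdens z 1 * (A + B * norm z)" by (intro mult_left_mono assms) auto
    also have "\<dots> = A * gdens z 1 + B * (norm z * gdens z 1)" by (simp add: algebra_simps)
    finally show "norm (gdens z 1 * g z) \<le> norm (A * gdens z 1 + B * (norm z * gdens z 1))" by simp
  qed
qed measurable

text \<open>Write \<open>g (e + z) - g z\<close> as the integral of \<open>g'\<close> along the
  segment and integrate over \<open>z\<close>. The left side vanishes by translation invariance, and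
  by Fubini the right side is the integral of \<open>g'\<close>. Integrability of both functions
  takes the place of decay at infinity.\<close>

lemma integral_directional_derivative_eq_0:
  fixes g g' :: "'a::euclidean_space \<Rightarrow> real"
  assumes g: "integrable lborel g" and g': "integrable lborel g'" and cont: "continuous_on UNIV g'"
    and der: "\<And>z. ((\<lambda>t. g (z + t *\<^sub>R e)) has_real_derivative g' z) (at 0)"
  shows "(\<integral>z. g' z \<partial>lborel) = 0"
proof -
  have [measurable]: "g \<in> borel_measurable borel" "g' \<in> borel_measurable borel"
    using borel_measurable_integrable[OF g] borel_measurable_integrable[OF g'] by auto
  have der': "((\<lambda>t. g (z + t *\<^sub>R e)) has_real_derivative g' (z + s *\<^sub>R e)) (at s)" for z s
  proof -
    have "((\<lambda>t. g ((z + s *\<^sub>R e) + t *\<^sub>R e)) has_real_derivative g' (z + s *\<^sub>R e)) (at (s + - s))"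
      using der[of "z + s *\<^sub>R e"] by simp
    then have "((\<lambda>x. g (z + s *\<^sub>R e + (x + - s) *\<^sub>R e)) has_real_derivative g' (z + s *\<^sub>R e)) (at s)"
      by (subst (asm) DERIV_shift)
    then show ?thesis by (simp add: algebra_simps)
  qed
  let ?f = "\<lambda>z (t::real). indicator {0..1} t * g' (t *\<^sub>R e + z)"
  have inner1: "(\<integral>t. ?f z t \<partial>lborel) = g (e + z) - g z" for z
  proof -
    have "(\<integral>t. indicator {0..1} t *\<^sub>R g' (z + t *\<^sub>R e) \<partial>lborel) = g (z + 1 *\<^sub>R e) - g (z + 0 *\<^sub>R e)"
    proof (rule integral_FTC_atLeastAtMost)
      fix x :: real
      show "((\<lambda>t. g (z + t *\<^sub>R e)) has_vector_derivative g' (z + x *\<^sub>R e)) (at x within {0..1})"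
        using der'[of z x] has_vector_derivative_at_within
        by (auto simp: has_real_derivative_iff_has_vector_derivative)
      show "continuous_on {0..1::real} (\<lambda>t. g' (z + t *\<^sub>R e))"
        by (intro continuous_on_compose2[OF cont] continuous_intros) auto
    qed simp
    then show ?thesis by (simp add: add.commute)
  qed
  have inner2: "(\<integral>z. ?f z t \<partial>lborel) = indicator {0..1} t * (\<integral>z. g' z \<partial>lborel)" for t
    using lborel_integral_translate[of g' "t *\<^sub>R e"] by simp
  have "integrable (lborel \<Otimes>\<^sub>M lborel) (\<lambda>(t, z). ?f z t)"
  proof (rule lborel_pair.Fubini_integrable)
    show "(\<lambda>(t, z). ?f z t) \<in> borel_measurable (lborel \<Otimes>\<^sub>M lborel)"
      by measurable
    have "(\<integral>z. norm (?f z t) \<partial>lborel) = indicator {0..1} t * (\<integral>z. \<bar>g' z\<bar> \<partial>lborel)" for t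
      using lborel_integral_translate[of "\<lambda>z. \<bar>g' z\<bar>" "t *\<^sub>R e"] by (simp add: abs_mult)
    then show "integrable lborel (\<lambda>t. \<integral>z. norm (case (t, z) of (t, z) \<Rightarrow> ?f z t) \<partial>lborel)"
      by simp
    show "AE t in lborel. integrable lborel (\<lambda>z. case (t, z) of (t, z) \<Rightarrow> ?f z t)"
      using lborel_integrable_translate[OF g'] by auto
  qed
  from lborel_pair.Fubini_integral[OF this]
  have "(\<integral>z. (\<integral>t. ?f z t \<partial>lborel) \<partial>lborel) = (\<integral>t. (\<integral>z. ?f z t \<partial>lborel) \<partial>lborel)" by simp
  then have "(\<integral>z. g (e + z) - g z \<partial>lborel) = (\<integral>t. indicator {0..1::real} t * (\<integral>z. g' z \<partial>lborel) \<partial>lborel)"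
    unfolding inner1 inner2 .
  moreover have "(\<integral>z. g (e + z) - g z \<partial>lborel) = 0"
    using g lborel_integrable_translate[OF g, of e] lborel_integral_translate[of g e] by simp
  ultimately show ?thesis by simp
qed

section \<open>Supersolutions of the heat equation\<close>

text \<open>A bounded radial supersolution \<open>f(r, |u|^2 / 2)\<close> of the heat equation. The Gaussian mean of
  \<open>f(r, |w + sqrt (T - r) z|^2 / 2)\<close> is nondecreasing in \<open>r\<close>, since by Gaussian integration by
  parts its derivative is the mean of \<open>f_r - (Laplacian f) / 2\<close>.\<close>
locale radial_supersolution =
  fixes w :: "real^'n" and T C :: real and f fr fR fRR :: "real \<Rightarrow> real \<Rightarrow> real"
  assumes T: "T > 0"
    and cont_f: "continuous_on ({0..T} \<times> {0..}) (\<lambda>p. f (fst p) (snd p))"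
    and bound_f: "\<And>r R. 0 \<le> r \<Longrightarrow> r \<le> T \<Longrightarrow> 0 \<le> R \<Longrightarrow> \<bar>f r R\<bar> \<le> C"
    and deriv_f: "\<And>r R. 0 < r \<Longrightarrow> r < T \<Longrightarrow> 0 \<le> R \<Longrightarrow>
      ((\<lambda>p. f (fst p) (snd p)) has_derivative (\<lambda>h. fr r R * fst h + fR r R * snd h)) (at (r, R))"
    and deriv_fR: "\<And>r R. 0 < r \<Longrightarrow> r < T \<Longrightarrow> 0 \<le> R \<Longrightarrow> (fR r has_real_derivative fRR r R) (at R)"
    and cont_fr: "continuous_on ({0<..<T} \<times> {0..}) (\<lambda>p. fr (fst p) (snd p))"
    and cont_fR: "continuous_on ({0<..<T} \<times> {0..}) (\<lambda>p. fR (fst p) (snd p))"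
    and cont_fRR: "continuous_on ({0<..<T} \<times> {0..}) (\<lambda>p. fRR (fst p) (snd p))"
    and bound_fr: "\<And>r R. 0 < r \<Longrightarrow> r < T \<Longrightarrow> 0 \<le> R \<Longrightarrow> \<bar>fr r R\<bar> \<le> C"
    and bound_fR: "\<And>r R. 0 < r \<Longrightarrow> r < T \<Longrightarrow> 0 \<le> R \<Longrightarrow> \<bar>fR r R\<bar> \<le> C"
    and bound_fR': "\<And>r R. 0 < r \<Longrightarrow> r < T \<Longrightarrow> 0 \<le> R \<Longrightarrow> sqrt (2 * R) * \<bar>fR r R\<bar> \<le> C"
    and bound_fRR: "\<And>r R. 0 < r \<Longrightarrow> r < T \<Longrightarrow> 0 \<le> R \<Longrightarrow> 2 * R * \<bar>fRR r R\<bar> \<le> C"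
    and supersolution: "\<And>r R. 0 < r \<Longrightarrow> r < T \<Longrightarrow> 0 \<le> R \<Longrightarrow>
      R * fRR r R + real CARD('n) / 2 * fR r R \<le> fr r R"
begin

text \<open>The remaining variance is \<open>T - r\<close>: the path starts at
  \<open>w + sqrt T *\<^sub>R z\<close> and ends at \<open>w\<close>, so the mean at
  \<open>T\<close> is a plain value of \<open>f\<close>.\<close>

definition pos :: "real \<Rightarrow> real^'n \<Rightarrow> real^'n" where
  "pos r z = w + sqrt (T - r) *\<^sub>R z"

definition rad :: "real \<Rightarrow> real^'n \<Rightarrow> real" where
  "rad r z = (norm (pos r z))\<^sup>2 / 2"

definition mean :: "real \<Rightarrow> real" where
  "mean r = (\<integral>z. gdens z 1 * f r (rad r z) \<partial>lborel)"

text \<open>The \<open>r\<close>-derivative of \<open>f r (rad r z)\<close> for fixed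
  \<open>z\<close>. Its second term may be singular at \<open>r = T\<close>, the reason why
  monotonicity is first proved on the open interval.\<close>

definition mean_deriv :: "real \<Rightarrow> real^'n \<Rightarrow> real" where
  "mean_deriv r z = fr r (rad r z) - fR r (rad r z) * (pos r z \<bullet> z) / (2 * sqrt (T - r))"

lemma rad_nonneg [simp]: "0 \<le> rad r z"
  by (simp add: rad_def)

lemma norm_pos: "norm (pos r z) = sqrt (2 * rad r z)"
  by (simp add: rad_def)

lemma C_nonneg: "C \<ge> 0"
  using bound_f[of 0 0] T by simp

lemma continuous_pos: "continuous_on A (\<lambda>p. pos (fst p) (snd p))"
  unfolding pos_def by (intro continuous_intros)

lemma continuous_rad: "continuous_on A (\<lambda>p. rad (fst p) (snd p))"
  unfolding rad_def by (intro continuous_intros continuous_pos) auto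

lemma continuous_comp_rad:
  assumes "continuous_on ({0<..<T} \<times> {0..}) (\<lambda>p. h (fst p) (snd p) :: real)"
  shows "continuous_on ({0<..<T} \<times> UNIV) (\<lambda>p. h (fst p) (rad (fst p) (snd p)))"
proof -
  have A: "continuous_on ({0<..<T} \<times> UNIV) (\<lambda>p. (fst p, rad (fst p) (snd p)))"
    by (intro continuous_intros continuous_rad)
  have B: "(\<lambda>p. (fst p, rad (fst p) (snd p))) ` ({0<..<T} \<times> UNIV) \<subseteq> {0<..<T} \<times> {0..}"
    by auto
  show ?thesis using continuous_on_compose2[OF assms A B] by simp
qed

lemma continuous_slice:
  assumes "continuous_on ({0<..<T} \<times> UNIV) (\<lambda>p. h (fst p) (snd p) :: real)" "0 < r" "r < T"
  shows "continuous_on UNIV (h r :: real^'n \<Rightarrow> real)"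
proof -
  have A: "continuous_on UNIV (\<lambda>z :: real^'n. (r, z))" by (intro continuous_intros)
  have B: "range (\<lambda>z :: real^'n. (r, z)) \<subseteq> {0<..<T} \<times> UNIV" using assms by auto
  show ?thesis using continuous_on_compose2[OF assms(1) A B] by simp
qed

lemma inner_pos_bound:
  assumes "0 < r" "r < T"
  shows "\<bar>fR r (rad r z) * (pos r z \<bullet> y)\<bar> \<le> C * norm y"
proof -
  have "\<bar>fR r (rad r z) * (pos r z \<bullet> y)\<bar> \<le> \<bar>fR r (rad r z)\<bar> * (norm (pos r z) * norm y)"
    unfolding abs_mult by (intro mult_left_mono Cauchy_Schwarz_ineq2) auto
  also have "\<dots> = (sqrt (2 * rad r z) * \<bar>fR r (rad r z)\<bar>) * norm y" by (simp add: norm_pos)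
  also have "\<dots> \<le> C * norm y" using assms by (intro mult_right_mono bound_fR') auto
  finally show ?thesis .
qed

lemma deriv_rad_space:
  "((\<lambda>t. rad r (z + t *\<^sub>R b)) has_real_derivative sqrt (T - r) * (pos r z \<bullet> b)) (at 0)"
proof -
  have eq: "rad r (z + t *\<^sub>R b) = ((pos r z \<bullet> pos r z) + 2 * t * sqrt (T - r) * (pos r z \<bullet> b)
      + t\<^sup>2 * (sqrt (T - r))\<^sup>2 * (b \<bullet> b)) / 2" for t
    unfolding rad_def power2_norm_eq_inner pos_def
    by (simp add: inner_add_left inner_add_right inner_commute power2_eq_square algebra_simps)
  show ?thesis unfolding eq by (auto intro!: derivative_eq_intros)
qed

lemma deriv_gdens:
  "((\<lambda>t. gdens (z + t *\<^sub>R b) 1) has_real_derivative - (z \<bullet> b) * gdens (z :: real^'n) 1) (at 0)"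
proof -
  have eq: "gdens (z + t *\<^sub>R b) 1 = (2 * pi) powr (- real CARD('n) / 2) *
     exp (- ((z \<bullet> z) + 2 * t * (z \<bullet> b) + t\<^sup>2 * (b \<bullet> b)) / 2)" for t
    unfolding gdens_def power2_norm_eq_inner
    by (simp add: inner_add_left inner_add_right inner_commute power2_eq_square algebra_simps)
  show ?thesis unfolding eq
    by (auto intro!: derivative_eq_intros simp: gdens_def power2_norm_eq_inner)
qed

text \<open>\<open>fR r (rad r z) *\<^sub>R pos r z\<close> is the gradient of
  \<open>f r (|u|^2 / 2)\<close> at \<open>u = pos r z\<close>. For a field \<open>F\<close> the
  Gaussian mean of \<open>F . z\<close> is that of the divergence of \<open>F\<close>, here
  \<open>sqrt (T - r)\<close> times the Laplacian of that function.\<close>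

lemma Gaussian_integration_by_parts:
  assumes r: "0 < r" "r < T"
  shows "(\<integral>z. gdens z 1 * (fR r (rad r z) * (pos r z \<bullet> z)) \<partial>lborel)
    = (\<integral>z. gdens z 1 * (sqrt (T - r) * (2 * rad r z * fRR r (rad r z) + real CARD('n) * fR r (rad r z))) \<partial>lborel)"
proof -
  let ?\<tau> = "sqrt (T - r)"
  have c1: "continuous_on UNIV (\<lambda>z. fR r (rad r z))"
    using continuous_slice[OF continuous_comp_rad[OF cont_fR] r] .
  have c2: "continuous_on UNIV (\<lambda>z. fRR r (rad r z))"
    using continuous_slice[OF continuous_comp_rad[OF cont_fRR] r] .
  have c3: "continuous_on UNIV (pos r)"
    unfolding pos_def by (intro continuous_intros)
  note [measurable] = borel_measurable_continuous_onI[OF c1] borel_measurable_continuous_onI[OF c2]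
    borel_measurable_continuous_onI[OF c3]
  have [measurable]: "rad r \<in> borel_measurable borel" unfolding rad_def by measurable
  \<comment> \<open>\<open>A b\<close> is a component of the gradient field and \<open>B b\<close>
    its derivative in direction \<open>b\<close> with respect to \<open>z\<close>; the density
    contributes \<open>- (z \<bullet> b)\<close>.\<close>
  define A where "A b z = fR r (rad r z) * (pos r z \<bullet> b)" for b z
  define B where "B b z = ?\<tau> * (fRR r (rad r z) * (pos r z \<bullet> b)\<^sup>2 + fR r (rad r z))" for b z
  have bA: "\<bar>A b z\<bar> \<le> C" if "b \<in> Basis" for b z
    using inner_pos_bound[OF r, of z b] that by (simp add: A_def)
  have bB: "\<bar>B b z\<bar> \<le> ?\<tau> * (C + C)" if "b \<in> Basis" for b z
  proof -
    have "(pos r z \<bullet> b)\<^sup>2 \<le> (norm (pos r z))\<^sup>2"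
      using Basis_le_norm[OF that, of "pos r z"] by (metis abs_le_square_iff abs_norm_cancel)
    then have "\<bar>fRR r (rad r z)\<bar> * (pos r z \<bullet> b)\<^sup>2 \<le> \<bar>fRR r (rad r z)\<bar> * (2 * rad r z)"
      by (intro mult_left_mono) (auto simp: rad_def)
    also have "\<dots> \<le> C" using bound_fRR[OF r, of "rad r z"] by (simp add: mult.commute)
    finally have 1: "\<bar>fRR r (rad r z) * (pos r z \<bullet> b)\<^sup>2\<bar> \<le> C" by (simp add: abs_mult)
    have "\<bar>fRR r (rad r z) * (pos r z \<bullet> b)\<^sup>2 + fR r (rad r z)\<bar> \<le> C + C"
      using 1 bound_fR[OF r rad_nonneg[of r z]] by linarith
    then show ?thesis unfolding B_def abs_mult using r by (intro mult_mono) auto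
  qed
  have iA: "integrable lborel (\<lambda>z. gdens z 1 * A b z)" if "b \<in> Basis" for b
    by (rule integrable_gdens_bounded[of _ C 0]) (use bA[OF that] in \<open>auto simp: A_def\<close>)
  have iAz: "integrable lborel (\<lambda>z. gdens z 1 * (A b z * (z \<bullet> b)))" if "b \<in> Basis" for b
  proof (rule integrable_gdens_bounded[of _ 0 C])
    fix z :: "real^'n"
    have "\<bar>A b z * (z \<bullet> b)\<bar> \<le> C * norm z"
      unfolding abs_mult using bA[OF that, of z] Basis_le_norm[OF that, of z] C_nonneg by (intro mult_mono) auto
    then show "\<bar>A b z * (z \<bullet> b)\<bar> \<le> 0 + C * norm z" by simp
  qed (auto simp: A_def)
  have iB: "integrable lborel (\<lambda>z. gdens z 1 * B b z)" if "b \<in> Basis" for b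
    by (rule integrable_gdens_bounded[of _ "?\<tau> * (C + C)" 0]) (use bB[OF that] in \<open>auto simp: B_def\<close>)
  have eq: "(\<integral>z. gdens z 1 * (A b z * (z \<bullet> b)) \<partial>lborel) = (\<integral>z. gdens z 1 * B b z \<partial>lborel)" if b: "b \<in> Basis" for b
  proof -
    have "(\<integral>z. gdens z 1 * B b z - gdens z 1 * (A b z * (z \<bullet> b)) \<partial>lborel) = 0"
    proof (rule integral_directional_derivative_eq_0[where e = b])
      show "integrable lborel (\<lambda>z. gdens z 1 * A b z)" using iA[OF b] .
      show "integrable lborel (\<lambda>z. gdens z 1 * B b z - gdens z 1 * (A b z * (z \<bullet> b)))"
        using iB[OF b] iAz[OF b] by simp
      show "continuous_on UNIV (\<lambda>z. gdens z 1 * B b z - gdens z 1 * (A b z * (z \<bullet> b)))"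
        unfolding A_def B_def by (intro continuous_intros continuous_on_gdens c1 c2 c3) auto
      fix z :: "real^'n"
      have d1: "((\<lambda>t. fR r (rad r (z + t *\<^sub>R b))) has_real_derivative fRR r (rad r z) * (?\<tau> * (pos r z \<bullet> b))) (at 0)"
      proof -
        have "(fR r has_real_derivative fRR r (rad r z)) (at ((\<lambda>t. rad r (z + t *\<^sub>R b)) 0))"
          using deriv_fR[OF r, of "rad r z"] by simp
        from DERIV_chain2[OF this deriv_rad_space] show ?thesis .
      qed
      have d2: "((\<lambda>t. pos r (z + t *\<^sub>R b) \<bullet> b) has_real_derivative ?\<tau>) (at 0)"
      proof -
        have "pos r (z + t *\<^sub>R b) \<bullet> b = pos r z \<bullet> b + t * ?\<tau>" for t
          using b by (simp add: pos_def inner_add_left inner_add_right algebra_simps)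
        then show ?thesis by (auto intro!: derivative_eq_intros)
      qed
      have "((\<lambda>t. gdens (z + t *\<^sub>R b) 1 * A b (z + t *\<^sub>R b)) has_real_derivative
         (- (z \<bullet> b) * gdens z 1) * (fR r (rad r z) * (pos r z \<bullet> b)) +
         (fRR r (rad r z) * (?\<tau> * (pos r z \<bullet> b)) * (pos r z \<bullet> b) + ?\<tau> * fR r (rad r z)) * gdens z 1) (at 0)"
        unfolding A_def
        using DERIV_mult[OF deriv_gdens[of z b] DERIV_mult[OF d1 d2]] by simp
      moreover have "(- (z \<bullet> b) * gdens z 1) * (fR r (rad r z) * (pos r z \<bullet> b)) +
         (fRR r (rad r z) * (?\<tau> * (pos r z \<bullet> b)) * (pos r z \<bullet> b) + ?\<tau> * fR r (rad r z)) * gdens z 1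
        = gdens z 1 * B b z - gdens z 1 * (A b z * (z \<bullet> b))"
        by (simp add: A_def B_def power2_eq_square algebra_simps)
      ultimately show "((\<lambda>t. gdens (z + t *\<^sub>R b) 1 * A b (z + t *\<^sub>R b)) has_real_derivative
         gdens z 1 * B b z - gdens z 1 * (A b z * (z \<bullet> b))) (at 0)" by simp
    qed
    then show ?thesis using iB[OF b] iAz[OF b] by simp
  qed
  have "(\<integral>z. gdens z 1 * (fR r (rad r z) * (pos r z \<bullet> z)) \<partial>lborel)
      = (\<integral>z. (\<Sum>b\<in>Basis. gdens z 1 * (A b z * (z \<bullet> b))) \<partial>lborel)"
  proof (rule Bochner_Integration.integral_cong[OF refl])
    fix z :: "real^'n"
    have "pos r z \<bullet> z = (\<Sum>b\<in>Basis. (pos r z \<bullet> b) * (z \<bullet> b))" by (rule euclidean_inner)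
    then show "gdens z 1 * (fR r (rad r z) * (pos r z \<bullet> z)) = (\<Sum>b\<in>Basis. gdens z 1 * (A b z * (z \<bullet> b)))"
      by (simp add: A_def sum_distrib_left mult.assoc)
  qed
  also have "\<dots> = (\<Sum>b\<in>Basis. \<integral>z. gdens z 1 * (A b z * (z \<bullet> b)) \<partial>lborel)"
    by (rule Bochner_Integration.integral_sum) (rule iAz)
  also have "\<dots> = (\<Sum>b\<in>Basis. \<integral>z. gdens z 1 * B b z \<partial>lborel)"
    by (rule sum.cong[OF refl eq])
  also have "\<dots> = (\<integral>z. (\<Sum>b\<in>Basis. gdens z 1 * B b z) \<partial>lborel)"
    by (rule Bochner_Integration.integral_sum[symmetric]) (rule iB)
  also have "\<dots> = (\<integral>z. gdens z 1 * (?\<tau> * (2 * rad r z * fRR r (rad r z) + real CARD('n) * fR r (rad r z))) \<partial>lborel)"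
  proof (rule Bochner_Integration.integral_cong[OF refl])
    fix z :: "real^'n"
    have "(\<Sum>b\<in>Basis. (pos r z \<bullet> b)\<^sup>2) = 2 * rad r z"
      using euclidean_inner[of "pos r z" "pos r z"] unfolding rad_def power2_norm_eq_inner by (simp add: power2_eq_square)
    then have "(\<Sum>b\<in>Basis. fRR r (rad r z) * (pos r z \<bullet> b)\<^sup>2 + fR r (rad r z))
      = fRR r (rad r z) * (2 * rad r z) + real CARD('n) * fR r (rad r z)"
      by (simp add: sum.distrib sum_distrib_left[symmetric])
    then show "(\<Sum>b\<in>Basis. gdens z 1 * B b z) = gdens z 1 * (?\<tau> * (2 * rad r z * fRR r (rad r z) + real CARD('n) * fR r (rad r z)))"
      unfolding B_def sum_distrib_left[symmetric] by (simp add: mult_ac)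
  qed
  finally show ?thesis .
qed

lemma deriv_rad_time:
  assumes "r < T"
  shows "((\<lambda>r. rad r z) has_real_derivative - (pos r z \<bullet> z) / (2 * sqrt (T - r))) (at r)"
proof -
  have eq: "rad s z = ((w \<bullet> w) + 2 * sqrt (T - s) * (w \<bullet> z) + (sqrt (T - s))\<^sup>2 * (z \<bullet> z)) / 2" for s
    unfolding rad_def power2_norm_eq_inner pos_def
    by (simp add: inner_add_left inner_add_right inner_commute power2_eq_square algebra_simps)
  define \<tau> where "\<tau> s = sqrt (T - s)" for s
  define D where "D = - (1 / (2 * sqrt (T - r)))"
  have d: "(\<tau> has_real_derivative D) (at r)"
    unfolding \<tau>_def D_def using assms by (auto intro!: derivative_eq_intros simp: field_simps)
  have "((\<lambda>s. ((w \<bullet> w) + 2 * \<tau> s * (w \<bullet> z) + (\<tau> s)\<^sup>2 * (z \<bullet> z)) / 2) has_real_derivative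
      D * (w \<bullet> z + \<tau> r * (z \<bullet> z))) (at r)"
    by (auto intro!: derivative_eq_intros d simp: algebra_simps)
  moreover have "D * (w \<bullet> z + \<tau> r * (z \<bullet> z)) = - (pos r z \<bullet> z) / (2 * sqrt (T - r))"
  proof -
    have X: "pos r z \<bullet> z = w \<bullet> z + \<tau> r * (z \<bullet> z)" by (simp add: \<tau>_def pos_def inner_add_left)
    show ?thesis unfolding X[symmetric] D_def by simp
  qed
  ultimately show ?thesis unfolding eq \<tau>_def by simp
qed

lemma deriv_path:
  assumes r: "0 < r" "r < T"
  shows "((\<lambda>r. f r (rad r z)) has_real_derivative mean_deriv r z) (at r)"
proof -
  have "((\<lambda>r. (r, rad r z)) has_derivative (\<lambda>h. (h, - (pos r z \<bullet> z) / (2 * sqrt (T - r)) * h))) (at r)"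
    using deriv_rad_time[OF r(2), of z] unfolding has_field_derivative_def
    by (intro has_derivative_Pair has_derivative_ident)
  from has_derivative_compose[OF this deriv_f[OF r rad_nonneg]]
  have "((\<lambda>r. f r (rad r z)) has_derivative
      (\<lambda>h. fr r (rad r z) * h + fR r (rad r z) * (- (pos r z \<bullet> z) / (2 * sqrt (T - r)) * h))) (at r)"
    by simp
  then show ?thesis
    unfolding has_field_derivative_def
    by (rule has_derivative_eq_rhs) (auto simp: fun_eq_iff mean_deriv_def algebra_simps)
qed

lemma continuous_mean_deriv:
  "continuous_on ({0<..<T} \<times> UNIV) (\<lambda>p. mean_deriv (fst p) (snd p))"
  unfolding mean_deriv_def
  by (intro continuous_intros continuous_comp_rad[OF cont_fr] continuous_comp_rad[OF cont_fR] continuous_pos) auto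

text \<open>For \<open>r \<le> b < T\<close> the singular factor stays bounded, which makes the
  double integral over \<open>{a..b}\<close> and space absolutely convergent.\<close>

lemma mean_deriv_bound:
  assumes "0 < r" "r \<le> b" "b < T"
  shows "\<bar>mean_deriv r z\<bar> \<le> C + C / (2 * sqrt (T - b)) * norm z"
proof -
  have r: "0 < r" "r < T" using assms by auto
  have "\<bar>fR r (rad r z) * (pos r z \<bullet> z) / (2 * sqrt (T - r))\<bar> \<le> C * norm z / (2 * sqrt (T - b))"
    unfolding abs_divide using inner_pos_bound[OF r, of z z] assms C_nonneg by (intro frac_le) auto
  moreover have "C / (2 * sqrt (T - b)) * norm z = C * norm z / (2 * sqrt (T - b))" by simp
  ultimately show ?thesis unfolding mean_deriv_def using bound_fr[OF r rad_nonneg[of r z]] by linarith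
qed

lemma integral_mean_deriv_nonneg:
  assumes r: "0 < r" "r < T"
  shows "0 \<le> (\<integral>z. gdens z 1 * mean_deriv r z \<partial>lborel)"
proof -
  let ?\<tau> = "sqrt (T - r)"
  have c0: "continuous_on UNIV (\<lambda>z. fr r (rad r z))"
    using continuous_slice[OF continuous_comp_rad[OF cont_fr] r] .
  have c1: "continuous_on UNIV (\<lambda>z. fR r (rad r z))"
    using continuous_slice[OF continuous_comp_rad[OF cont_fR] r] .
  have c2: "continuous_on UNIV (\<lambda>z. fRR r (rad r z))"
    using continuous_slice[OF continuous_comp_rad[OF cont_fRR] r] .
  have c3: "continuous_on UNIV (pos r)"
    unfolding pos_def by (intro continuous_intros)
  note [measurable] = borel_measurable_continuous_onI[OF c1] borel_measurable_continuous_onI[OF c2]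
    borel_measurable_continuous_onI[OF c3] borel_measurable_continuous_onI[OF c0]
  have [measurable]: "rad r \<in> borel_measurable borel" unfolding rad_def by measurable
  define L where "L z = 2 * rad r z * fRR r (rad r z) + real CARD('n) * fR r (rad r z)" for z
  have [measurable]: "L \<in> borel_measurable borel" unfolding L_def by measurable
  have i1: "integrable lborel (\<lambda>z. gdens z 1 * fr r (rad r z))"
    by (rule integrable_gdens_bounded[of _ C 0]) (auto simp: bound_fr r)
  have i2: "integrable lborel (\<lambda>z. gdens z 1 * (fR r (rad r z) * (pos r z \<bullet> z)))"
    by (rule integrable_gdens_bounded[of _ 0 C]) (auto simp: inner_pos_bound r)
  have i3: "integrable lborel (\<lambda>z. gdens z 1 * L z)"
  proof (rule integrable_gdens_bounded[of _ "C + real CARD('n) * C" 0])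
    fix z
    have "\<bar>2 * rad r z * fRR r (rad r z)\<bar> \<le> C"
      using bound_fRR[OF r rad_nonneg[of r z]] by (simp add: abs_mult)
    moreover have "\<bar>real CARD('n) * fR r (rad r z)\<bar> \<le> real CARD('n) * C"
      using bound_fR[OF r rad_nonneg[of r z]] by (simp add: abs_mult)
    ultimately show "\<bar>L z\<bar> \<le> C + real CARD('n) * C + 0 * norm z" unfolding L_def by linarith
  qed simp
  have \<tau>: "?\<tau> > 0" using r by simp
  have "(\<integral>z. gdens z 1 * mean_deriv r z \<partial>lborel)
     = (\<integral>z. gdens z 1 * fr r (rad r z) - 1 / (2 * ?\<tau>) * (gdens z 1 * (fR r (rad r z) * (pos r z \<bullet> z))) \<partial>lborel)"
    by (rule Bochner_Integration.integral_cong[OF refl]) (simp add: mean_deriv_def algebra_simps)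
  also have "\<dots> = (\<integral>z. gdens z 1 * fr r (rad r z) \<partial>lborel)
      - 1 / (2 * ?\<tau>) * (\<integral>z. gdens z 1 * (fR r (rad r z) * (pos r z \<bullet> z)) \<partial>lborel)"
    using i1 i2 by simp
  \<comment> \<open>Integration by parts produces the factor \<open>sqrt (T - r)\<close>, which
    cancels the singular denominator and leaves half the Laplacian.\<close>
  also have "\<dots> = (\<integral>z. gdens z 1 * fr r (rad r z) \<partial>lborel)
      - 1 / (2 * ?\<tau>) * (?\<tau> * (\<integral>z. gdens z 1 * L z \<partial>lborel))"
    unfolding Gaussian_integration_by_parts[OF r] L_def[symmetric]
    by (simp add: mult.left_commute[of _ ?\<tau>])
  also have "\<dots> = (\<integral>z. gdens z 1 * (fr r (rad r z) - L z / 2) \<partial>lborel)"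
    using \<tau> i1 i3 by (simp add: right_diff_distrib)
  also have "\<dots> \<ge> 0"
  proof (rule integral_nonneg_AE, rule AE_I2)
    fix z
    have "L z / 2 \<le> fr r (rad r z)"
      using supersolution[OF r rad_nonneg[of r z]] by (simp add: L_def)
    then show "0 \<le> gdens z 1 * (fr r (rad r z) - L z / 2)" by simp
  qed
  finally show ?thesis .
qed

lemma borel_measurable_path [measurable]:
  assumes "0 \<le> r" "r \<le> T"
  shows "(\<lambda>z. f r (rad r z)) \<in> borel_measurable borel"
proof (rule borel_measurable_continuous_onI)
  have A: "continuous_on UNIV (\<lambda>z. (r, rad r z))"
    unfolding rad_def pos_def by (intro continuous_intros) auto
  have B: "range (\<lambda>z. (r, rad r z)) \<subseteq> {0..T} \<times> {0..}" using assms by auto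
  show "continuous_on UNIV (\<lambda>z. f r (rad r z))" using continuous_on_compose2[OF cont_f A B] by simp
qed

lemma integrable_path:
  assumes "0 \<le> r" "r \<le> T"
  shows "integrable lborel (\<lambda>z. gdens z 1 * f r (rad r z))"
  by (rule integrable_gdens_bounded[of _ C 0]) (use assms bound_f in auto)

text \<open>Instead of differentiating the mean, its increment is written as a double integral of
  \<open>mean_deriv\<close>; after Fubini the inner integral over space is nonnegative for each
  \<open>r\<close>.\<close>

lemma mean_mono_interior:
  assumes ab: "0 < a" "a \<le> b" "b < T"
  shows "mean a \<le> mean b"
proof -
  let ?h = "\<lambda>r z. indicator {a..b} r * (gdens z 1 * mean_deriv r z)"
  have sub: "{a..b} \<times> UNIV \<subseteq> {0<..<T} \<times> (UNIV :: (real^'n) set)" using ab by auto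
  have cont: "continuous_on ({a..b} \<times> UNIV) (\<lambda>p. gdens (snd p :: real^'n) 1 * mean_deriv (fst p) (snd p))"
    by (intro continuous_intros continuous_on_subset[OF continuous_mean_deriv sub]
        continuous_on_compose2[OF continuous_on_gdens[of 1 UNIV]]) auto
  have "(\<lambda>p. indicator ({a..b} \<times> UNIV) p *\<^sub>R (gdens (snd p :: real^'n) 1 * mean_deriv (fst p) (snd p))) \<in> borel_measurable borel"
    by (rule borel_measurable_continuous_on_indicator[OF _ cont]) (auto intro!: borel_closed closed_Times)
  moreover have "(\<lambda>p. indicator ({a..b} \<times> UNIV) p *\<^sub>R (gdens (snd p :: real^'n) 1 * mean_deriv (fst p) (snd p)))
     = (\<lambda>(r, z). ?h r z)" by (auto simp: fun_eq_iff indicator_def)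
  ultimately have meas: "(\<lambda>(r, z). ?h r z) \<in> borel_measurable (lborel \<Otimes>\<^sub>M lborel)"
    by (simp add: lborel_prod)
  have slice: "(\<lambda>z. mean_deriv r z) \<in> borel_measurable borel" if "r \<in> {a..b}" for r
    using continuous_slice[OF continuous_mean_deriv, of r] that ab by (intro borel_measurable_continuous_onI) auto
  define K where "K = C / (2 * sqrt (T - b))"
  have bd: "\<bar>mean_deriv r z\<bar> \<le> C + K * norm z" if "r \<in> {a..b}" for r z
    unfolding K_def using that ab by (intro mean_deriv_bound) auto
  have int_r: "integrable lborel (\<lambda>z. ?h r z)" for r
    by (cases "r \<in> {a..b}") (use integrable_gdens_bounded[OF slice bd] in auto)
  have int_K: "integrable lborel (\<lambda>z::real^'n. gdens z 1 * (C + K * norm z))"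
    using C_nonneg ab by (intro integrable_gdens_bounded[of _ C K]) (auto simp: K_def)
  have int2: "integrable (lborel \<Otimes>\<^sub>M lborel) (\<lambda>(r, z). ?h r z)"
  proof (rule lborel_pair.Fubini_integrable[OF meas])
    show "AE r in lborel. integrable lborel (\<lambda>z. case (r, z) of (r, z) \<Rightarrow> ?h r z)"
      using int_r by simp
    have m: "(\<lambda>r. \<integral>z. norm (case (r, z) of (r, z) \<Rightarrow> ?h r z) \<partial>lborel) \<in> borel_measurable lborel"
      using meas by (intro lborel.borel_measurable_lebesgue_integral) (auto intro!: borel_measurable_norm simp: case_prod_beta')
    show "integrable lborel (\<lambda>r. \<integral>z. norm (case (r, z) of (r, z) \<Rightarrow> ?h r z) \<partial>lborel)"
    proof (rule Bochner_Integration.integrable_bound[OF _ m])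
      show "integrable lborel (\<lambda>r. indicator {a..b} r * (\<integral>(z::real^'n). gdens z 1 * (C + K * norm z) \<partial>lborel))"
        by (intro integrable_mult_left integrable_real_indicator) (auto simp: emeasure_lborel_Icc_eq)
      show "AE r in lborel. norm (\<integral>z. norm (case (r, z) of (r, z) \<Rightarrow> ?h r z) \<partial>lborel)
         \<le> norm (indicator {a..b} r * (\<integral>(z::real^'n). gdens z 1 * (C + K * norm z) \<partial>lborel))"
      proof (rule AE_I2)
        fix r
        show "norm (\<integral>z. norm (case (r, z) of (r, z) \<Rightarrow> ?h r z) \<partial>lborel)
           \<le> norm (indicator {a..b} r * (\<integral>(z::real^'n). gdens z 1 * (C + K * norm z) \<partial>lborel))"
        proof (cases "r \<in> {a..b}")
          case True
          have "(\<integral>z. norm (?h r z) \<partial>lborel) \<le> (\<integral>(z::real^'n). gdens z 1 * (C + K * norm z) \<partial>lborel)"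
          proof (rule integral_mono)
            show "integrable lborel (\<lambda>z. norm (?h r z))" using int_r[of r] by (rule integrable_norm)
            show "norm (?h r z) \<le> gdens z 1 * (C + K * norm z)" for z
              using True bd[OF True, of z] by (auto simp: abs_mult intro!: mult_left_mono)
          qed (rule int_K)
          then show ?thesis using True by (simp add: abs_le_iff order_trans[OF _ abs_ge_self])
        qed simp
      qed
    qed
  qed
  have inner: "(\<integral>r. ?h r z \<partial>lborel) = gdens z 1 * f b (rad b z) - gdens z 1 * f a (rad a z)" for z
  proof -
    have "(\<integral>r. indicator {a..b} r *\<^sub>R (gdens z 1 * mean_deriv r z) \<partial>lborel) = gdens z 1 * f b (rad b z) - gdens z 1 * f a (rad a z)"
    proof (rule integral_FTC_atLeastAtMost[OF ab(2)])
      fix r assume "a \<le> r" "r \<le> b"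
      then have "((\<lambda>r. gdens z 1 * f r (rad r z)) has_real_derivative gdens z 1 * mean_deriv r z) (at r)"
        using ab by (intro DERIV_cmult deriv_path) auto
      then show "((\<lambda>r. gdens z 1 * f r (rad r z)) has_vector_derivative gdens z 1 * mean_deriv r z) (at r within {a..b})"
        by (simp add: has_real_derivative_iff_has_vector_derivative has_vector_derivative_at_within)
    next
      have A: "continuous_on {a..b} (\<lambda>r. (r, z))" by (intro continuous_intros)
      have B: "(\<lambda>r. (r, z)) ` {a..b} \<subseteq> {a..b} \<times> UNIV" by auto
      show "continuous_on {a..b} (\<lambda>r. gdens z 1 * mean_deriv r z)"
        using continuous_on_compose2[OF cont A B] by simp
    qed
    then show ?thesis by simp
  qed
  have "mean b - mean a = (\<integral>z. gdens z 1 * f b (rad b z) - gdens z 1 * f a (rad a z) \<partial>lborel)"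
    using integrable_path[of a] integrable_path[of b] ab by (simp add: mean_def)
  also have "\<dots> = (\<integral>z. (\<integral>r. ?h r z \<partial>lborel) \<partial>lborel)" unfolding inner ..
  also have "\<dots> = (\<integral>r. (\<integral>z. ?h r z \<partial>lborel) \<partial>lborel)"
    using lborel_pair.Fubini_integral[OF int2] .
  also have "\<dots> \<ge> 0"
  proof (rule integral_nonneg_AE, rule AE_I2)
    fix r
    show "0 \<le> (\<integral>z. ?h r z \<partial>lborel)"
      using integral_mean_deriv_nonneg[of r] ab by (cases "r \<in> {a..b}") auto
  qed
  finally show ?thesis by simp
qed

text \<open>Boundedness and continuity of \<open>f\<close> carry the monotonicity to the endpoints 0
  and \<open>T\<close>, where no derivatives are assumed.\<close>

lemma mean_tendsto:
  assumes "s \<longlonglongrightarrow> l" "\<And>n. s n \<in> {0..T}" "l \<in> {0..T}"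
  shows "(\<lambda>n. mean (s n)) \<longlonglongrightarrow> mean l"
  unfolding mean_def
proof (rule integral_dominated_convergence)
  show "integrable lborel (\<lambda>z::real^'n. gdens z 1 * C)"
    using integrable_gdens[of 1, where 'n='n] by simp
  show "AE z in lborel. (\<lambda>n. gdens z 1 * f (s n) (rad (s n) z)) \<longlonglongrightarrow> gdens z 1 * f l (rad l z)"
  proof (rule AE_I2)
    fix z
    have "(\<lambda>n. (s n, rad (s n) z)) \<longlonglongrightarrow> (l, rad l z)"
      unfolding rad_def pos_def by (intro tendsto_intros assms) auto
    from continuous_on_tendsto_compose[OF cont_f this]
    have "(\<lambda>n. f (s n) (rad (s n) z)) \<longlonglongrightarrow> f l (rad l z)"
      using assms by auto
    then show "(\<lambda>n. gdens z 1 * f (s n) (rad (s n) z)) \<longlonglongrightarrow> gdens z 1 * f l (rad l z)"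
      by (intro tendsto_intros)
  qed
  show "AE z in lborel. norm (gdens z 1 * f (s n) (rad (s n) z)) \<le> gdens z 1 * C" for n
    using assms(2)[of n] by (auto simp: abs_mult intro!: mult_left_mono bound_f)
qed (use integrable_path assms in \<open>auto dest: borel_measurable_integrable\<close>)

lemma Gaussian_mean_le:
  "(\<integral>z. gdens z 1 * f 0 ((norm (w + sqrt T *\<^sub>R z))\<^sup>2 / 2) \<partial>lborel) \<le> f T ((norm w)\<^sup>2 / 2)"
proof -
  \<comment> \<open>The shift by 3 gives \<open>s n \<le> T - s n < T\<close> already for
    \<open>n = 0\<close>.\<close>
  define s where "s n = T / real (n + 3)" for n :: nat
  have s: "0 < s n" "s n \<le> T - s n" "T - s n < T" "s n \<le> T" for n
    using T by (auto simp: s_def field_simps)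
  have lim: "s \<longlonglongrightarrow> 0"
    unfolding s_def using LIMSEQ_ignore_initial_segment[OF lim_const_over_n[of T], of 3] by simp
  have "(\<lambda>n. mean (s n)) \<longlonglongrightarrow> mean 0"
    using s T by (intro mean_tendsto lim) (auto intro: less_imp_le)
  moreover have "(\<lambda>n. mean (T - s n)) \<longlonglongrightarrow> mean (T - 0)"
    using s T by (intro mean_tendsto tendsto_intros lim) (auto intro: less_imp_le)
  moreover have "mean (s n) \<le> mean (T - s n)" for n
    using s by (intro mean_mono_interior) auto
  ultimately have "mean 0 \<le> mean (T - 0)" by (intro LIMSEQ_le) auto
  moreover have "mean T = f T ((norm w)\<^sup>2 / 2)"
    using integral_gdens[of 1, where 'n='n] by (simp add: mean_def rad_def pos_def)
  moreover have "mean 0 = (\<integral>z. gdens z 1 * f 0 ((norm (w + sqrt T *\<^sub>R z))\<^sup>2 / 2) \<partial>lborel)"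
    by (simp add: mean_def rad_def pos_def)
  ultimately show ?thesis by simp
qed

end

section \<open>The pointwise inequality\<close>

text \<open>The range of \<open>\<sigma>\<close> for superharmonicity lies strictly inside the range
  where the Jacobian is bounded below.\<close>

lemma hl_admissible:
  fixes \<delta> \<sigma> :: real
  assumes "\<delta> > 0" "\<sigma> \<ge> 0" "8 * \<sigma> * (\<delta> + 1) \<le> 3 * (\<delta> + 2)"
  shows "2 * \<sigma> * \<delta> < \<delta> + 1"
proof -
  have "(\<delta> + 1) * (8 * (\<sigma> * \<delta>)) = \<delta> * (8 * \<sigma> * (\<delta> + 1))" by (simp add: algebra_simps)
  also have "\<dots> \<le> \<delta> * (3 * (\<delta> + 2))" using assms by (intro mult_left_mono) auto
  also have "\<dots> < (\<delta> + 1) * (4 * (\<delta> + 1))"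
  proof -
    have "(\<delta> + 1) * (4 * (\<delta> + 1)) - \<delta> * (3 * (\<delta> + 2)) = \<delta> * \<delta> + 2 * \<delta> + 4" by (simp add: algebra_simps)
    moreover have "\<delta> * \<delta> + 2 * \<delta> + 4 > 0" using assms by (simp add: add_pos_pos)
    ultimately show ?thesis by linarith
  qed
  finally show ?thesis using assms by (subst (asm) mult_less_cancel_left_pos) auto
qed

text \<open>Used twice: with \<open>\<eta> = p\<close> and \<open>\<sigma>0 = 0\<close>, to compare
  the inner mean with the sup-convolution, and with \<open>\<eta> = 1/2\<close>, where the parameter
  stands still and the claim is the mean value inequality for the superharmonic square root. The
  speed \<open>\<eta> - 1/2\<close> is chosen so that, by the Hamilton-Jacobi equation, the residue
  of the heat operator is a positive multiple of minus the Laplacian of that square root. The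
  alternative \<open>nz\<close> keeps the parameter positive for \<open>r > 0\<close>, where the
  derivatives of \<open>hl_log\<close> are available.\<close>

lemma Gaussian_mean_hl_le:
  fixes w :: "real^'n"
  assumes \<delta>: "\<delta> > 0" "real CARD('n) = 2 * (\<delta> + 1)"
    and \<eta>: "\<eta> \<ge> 1/2" and \<sigma>0: "\<sigma>0 \<ge> 0" and nz: "\<sigma>0 > 0 \<or> \<eta> > 1/2" and T: "T > 0"
    and \<sigma>1: "\<sigma>1 = \<sigma>0 + (\<eta> - 1/2) * T" "8 * \<sigma>1 * (\<delta> + 1) \<le> 3 * (\<delta> + 2)"
  shows "(\<integral>z. gdens z 1 * exp (\<eta> * hl_log \<delta> \<sigma>0 ((norm (w + sqrt T *\<^sub>R z))\<^sup>2 / 2)) \<partial>lborel)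
     \<le> exp (\<eta> * hl_log \<delta> \<sigma>1 ((norm w)\<^sup>2 / 2))"
proof -
  \<comment> \<open>A common bound for the coefficients that multiply \<open>f\<close> in the
    derivatives; \<open>M\<close> bounds \<open>f\<close> itself.\<close>
  let ?L = "1 + 5 * \<eta> + 2 * \<eta>\<^sup>2 * \<delta> + \<eta> * sqrt (2 * \<delta>)"
  define s where "s r = \<sigma>0 + (\<eta> - 1/2) * r" for r
  define M where "M = exp (\<eta> * ln (trunc_gamma \<delta> 0))"
  define C where "C = ?L * M"
  define f where "f r R = exp (\<eta> * hl_log \<delta> (s r) R)" for r R
  define X where "X r R = hl_slope \<delta> (s r) R" for r R
  define W where "W r R = hl_curv \<delta> (s r) R" for r R
  have s0: "0 \<le> s r" if "0 \<le> r" for r using \<sigma>0 \<eta> that by (simp add: s_def)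
  have spos: "0 < s r" if "0 < r" for r
    using \<sigma>0 \<eta> nz that by (cases "\<sigma>0 > 0") (auto simp: s_def add_pos_nonneg)
  have sle: "8 * s r * (\<delta> + 1) \<le> 3 * (\<delta> + 2)" if "r \<le> T" for r
  proof -
    have "s r \<le> \<sigma>1" using that \<eta> by (simp add: s_def \<sigma>1 mult_left_mono)
    then have "8 * s r * (\<delta> + 1) \<le> 8 * \<sigma>1 * (\<delta> + 1)" using \<delta> by (intro mult_right_mono) auto
    then show ?thesis using \<sigma>1 by simp
  qed
  have adm: "2 * s r * \<delta> < \<delta> + 1" if "0 \<le> r" "r \<le> T" for r
    using hl_admissible[OF \<delta>(1) s0[OF that(1)] sle[OF that(2)]] .
  have f: "0 < f r R" for r R by (simp add: f_def)
  have fM: "f r R \<le> M" if "0 \<le> r" "r \<le> T" "0 \<le> R" for r R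
    unfolding f_def M_def using \<eta> that hl_bounds(1)[OF \<delta>(1) s0 less_imp_le[OF adm]]
    by (simp add: mult_left_mono)
  have M: "M > 0" by (simp add: M_def)
  have cs: "continuous_on A (\<lambda>p. (s (fst p), snd p))" for A :: "(real \<times> real) set"
    unfolding s_def by (intro continuous_intros)
  let ?A = "{\<sigma>. 0 \<le> \<sigma> \<and> 2 * \<sigma> * \<delta> \<le> \<delta> + 1} \<times> (UNIV :: real set)"
  have sub: "(\<lambda>p. (s (fst p), snd p)) ` ({0..T} \<times> {0..}) \<subseteq> ?A"
    using s0 adm by (auto intro: less_imp_le)
  have sub': "(\<lambda>p. (s (fst p), snd p)) ` ({0<..<T} \<times> {0..}) \<subseteq> ?A"
    using s0 adm by (auto intro: less_imp_le)
  have c_f: "continuous_on ({0..T} \<times> {0..}) (\<lambda>p. f (fst p) (snd p))"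
    unfolding f_def using continuous_on_compose2[OF continuous_on_hl(1)[OF \<delta>(1)] cs sub]
    by (intro continuous_intros) simp
  have c_f': "continuous_on ({0<..<T} \<times> {0..}) (\<lambda>p. f (fst p) (snd p))"
    by (rule continuous_on_subset[OF c_f]) auto
  have c_X: "continuous_on ({0<..<T} \<times> {0..}) (\<lambda>p. X (fst p) (snd p))"
    unfolding X_def using continuous_on_compose2[OF continuous_on_hl(2)[OF \<delta>(1)] cs sub'] by simp
  have c_W: "continuous_on ({0<..<T} \<times> {0..}) (\<lambda>p. W (fst p) (snd p))"
    unfolding W_def using continuous_on_compose2[OF continuous_on_hl(3)[OF \<delta>(1)] cs sub'] by simp
  have bX: "0 \<le> X r R" "X r R \<le> 1" "R * (X r R)\<^sup>2 \<le> \<delta>" "0 \<le> W r R" "R * W r R \<le> 2"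
    if "0 < r" "r < T" "0 \<le> R" for r R
  proof -
    have r: "0 \<le> r" "r \<le> T" using that by auto
    show "0 \<le> X r R" "X r R \<le> 1" "R * (X r R)\<^sup>2 \<le> \<delta>" "0 \<le> W r R" "R * W r R \<le> 2"
      unfolding X_def W_def using hl_bounds[OF \<delta>(1) s0[OF r(1)] less_imp_le[OF adm[OF r]] that(3)] by auto
  qed
  have C: "c * f r R \<le> C" if "0 \<le> r" "r \<le> T" "0 \<le> R" "0 \<le> c" "c \<le> ?L" for c r R
    unfolding C_def using that fM[of r R] f[of r R] by (intro mult_mono) (auto intro: order_trans)
  have pos: "0 \<le> \<eta>" "0 \<le> \<eta>\<^sup>2 * \<delta>" "0 \<le> \<eta> * sqrt (2 * \<delta>)" using \<eta> \<delta> by auto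
  have dlog: "((\<lambda>p. hl_log \<delta> (s (fst p)) (snd p)) has_derivative
     (\<lambda>h. R * (X r R)\<^sup>2 * ((\<eta> - 1/2) * fst h) - X r R * snd h)) (at (r, R))"
    if "0 < r" "r < T" for r R
  proof -
    have ds: "((\<lambda>p. (s (fst p), snd p)) has_derivative (\<lambda>h. ((\<eta> - 1/2) * fst h, snd h))) (at (r, R))"
      unfolding s_def by (auto intro!: derivative_eq_intros)
    have "((\<lambda>p. hl_log \<delta> (fst p) (snd p)) has_derivative
       (\<lambda>h. R * (X r R)\<^sup>2 * fst h - X r R * snd h)) (at (s r, R))"
      unfolding X_def using that by (intro has_derivative_hl_log \<delta> spos adm) auto
    then have "((\<lambda>p. hl_log \<delta> (fst p) (snd p)) has_derivative
       (\<lambda>h. R * (X r R)\<^sup>2 * fst h - X r R * snd h)) (at (s (fst (r, R)), snd (r, R)))" by simp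
    from has_derivative_compose[OF ds this] show ?thesis by simp
  qed
  have "radial_supersolution TYPE('n) T C f (\<lambda>r R. \<eta> * (\<eta> - 1/2) * (R * (X r R)\<^sup>2) * f r R)
     (\<lambda>r R. - \<eta> * X r R * f r R) (\<lambda>r R. (\<eta>\<^sup>2 * (X r R)\<^sup>2 + \<eta> * W r R) * f r R)"
  proof
    show "0 < T" by (rule T)
    show "continuous_on ({0..T} \<times> {0..}) (\<lambda>p. f (fst p) (snd p))" by (rule c_f)
    show "continuous_on ({0<..<T} \<times> {0..}) (\<lambda>p. \<eta> * (\<eta> - 1/2) * (snd p * (X (fst p) (snd p))\<^sup>2) * f (fst p) (snd p))"
      by (intro continuous_intros c_f' c_X)
    show "continuous_on ({0<..<T} \<times> {0..}) (\<lambda>p. - \<eta> * X (fst p) (snd p) * f (fst p) (snd p))"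
      by (intro continuous_intros c_f' c_X)
    show "continuous_on ({0<..<T} \<times> {0..}) (\<lambda>p. (\<eta>\<^sup>2 * (X (fst p) (snd p))\<^sup>2 + \<eta> * W (fst p) (snd p)) * f (fst p) (snd p))"
      by (intro continuous_intros c_f' c_X c_W)
    show "\<bar>f r R\<bar> \<le> C" if "0 \<le> r" "r \<le> T" "0 \<le> R" for r R
      using C[OF that, of 1] f[of r R] pos by simp
    fix r R :: real assume r: "0 < r" "r < T" "0 \<le> R"
    have r': "0 \<le> r" "r \<le> T" "0 \<le> R" using r by auto
    note b = bX[OF r]
    show "((\<lambda>p. f (fst p) (snd p)) has_derivative
       (\<lambda>h. \<eta> * (\<eta> - 1/2) * (R * (X r R)\<^sup>2) * f r R * fst h + - \<eta> * X r R * f r R * snd h)) (at (r, R))"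
      unfolding f_def
      by (rule derivative_eq_intros dlog[OF r(1,2)] refl)+ (auto simp: fun_eq_iff algebra_simps)
    show "((\<lambda>R. - \<eta> * X r R * f r R) has_real_derivative (\<eta>\<^sup>2 * (X r R)\<^sup>2 + \<eta> * W r R) * f r R) (at R)"
    proof -
      have pr: "((\<lambda>R. (r, R)) has_derivative (\<lambda>h. (0, h))) (at R)"
        by (auto intro!: derivative_eq_intros)
      have "((\<lambda>R. hl_log \<delta> (s r) R) has_derivative (\<lambda>h. - X r R * h)) (at R)"
        using has_derivative_compose[OF pr dlog[OF r(1,2)]] by simp
      then have d: "((\<lambda>R. hl_log \<delta> (s r) R) has_real_derivative - X r R) (at R)"
        unfolding has_field_derivative_def by (rule has_derivative_eq_rhs) (simp add: fun_eq_iff)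
      have dX: "((\<lambda>R. X r R) has_real_derivative - W r R) (at R)"
        unfolding X_def W_def using r by (intro hl_slope_deriv \<delta> spos adm) auto
      show ?thesis unfolding f_def
        by (rule derivative_eq_intros d dX refl)+ (simp add: power2_eq_square algebra_simps)
    qed
    have 1: "\<eta> * (\<eta> - 1/2) * (R * (X r R)\<^sup>2) \<le> 2 * \<eta>\<^sup>2 * \<delta>"
    proof -
      have "\<eta> * (\<eta> - 1/2) * (R * (X r R)\<^sup>2) \<le> (2 * \<eta>\<^sup>2) * \<delta>"
      proof (rule mult_mono)
        have "\<eta> * (\<eta> - 1/2) \<le> \<eta> * (2 * \<eta>)" using \<eta> by (intro mult_left_mono) auto
        then show "\<eta> * (\<eta> - 1/2) \<le> 2 * \<eta>\<^sup>2" by (simp add: power2_eq_square)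
      qed (use b r in auto)
      then show ?thesis by simp
    qed
    have "\<bar>\<eta> * (\<eta> - 1/2) * (R * (X r R)\<^sup>2) * f r R\<bar> = (\<eta> * (\<eta> - 1/2) * (R * (X r R)\<^sup>2)) * f r R"
      using \<eta> r f[of r R] by (intro abs_of_nonneg mult_nonneg_nonneg) auto
    also have "\<dots> \<le> C"
      using 1 pos \<eta> r' by (intro C mult_nonneg_nonneg) auto
    finally show "\<bar>\<eta> * (\<eta> - 1/2) * (R * (X r R)\<^sup>2) * f r R\<bar> \<le> C" .
    have a: "\<bar>- \<eta> * X r R * f r R\<bar> = (\<eta> * X r R) * f r R"
      using \<eta> b f[of r R] by (simp add: abs_mult)
    have e: "\<eta> * X r R \<le> \<eta>" using b \<eta> by (simp add: mult_left_le)
    have "\<eta> * X r R \<le> ?L" using e pos by linarith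
    then show "\<bar>- \<eta> * X r R * f r R\<bar> \<le> C"
      unfolding a using pos r' b by (intro C mult_nonneg_nonneg) auto
    have q: "sqrt (2 * R) * X r R \<le> sqrt (2 * \<delta>)"
    proof -
      have "sqrt (2 * R) * X r R = sqrt (2 * (R * (X r R)\<^sup>2))"
        using b r by (simp add: real_sqrt_mult)
      then show ?thesis using b by simp
    qed
    have "sqrt (2 * R) * \<bar>- \<eta> * X r R * f r R\<bar> = (\<eta> * (sqrt (2 * R) * X r R)) * f r R"
      unfolding a by simp
    also have "\<dots> \<le> C"
    proof (rule C[OF r'])
      have "\<eta> * (sqrt (2 * R) * X r R) \<le> \<eta> * sqrt (2 * \<delta>)" using q \<eta> by (intro mult_left_mono) auto
      then show "\<eta> * (sqrt (2 * R) * X r R) \<le> ?L"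
        using pos by linarith
    qed (use \<eta> b r in auto)
    finally show "sqrt (2 * R) * \<bar>- \<eta> * X r R * f r R\<bar> \<le> C" .
    have "2 * R * \<bar>(\<eta>\<^sup>2 * (X r R)\<^sup>2 + \<eta> * W r R) * f r R\<bar>
        = (2 * \<eta>\<^sup>2 * (R * (X r R)\<^sup>2) + 2 * \<eta> * (R * W r R)) * f r R"
      using \<eta> b f[of r R] by (simp add: abs_mult algebra_simps)
    also have "\<dots> \<le> C"
    proof (rule C[OF r'])
      have "2 * \<eta>\<^sup>2 * (R * (X r R)\<^sup>2) \<le> 2 * \<eta>\<^sup>2 * \<delta>" using b by (intro mult_left_mono) auto
      moreover have "2 * \<eta> * (R * W r R) \<le> 2 * \<eta> * 2" using b \<eta> by (intro mult_left_mono) auto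
      ultimately show "2 * \<eta>\<^sup>2 * (R * (X r R)\<^sup>2) + 2 * \<eta> * (R * W r R) \<le> ?L"
        using pos by linarith
    qed (use \<eta> b r in auto)
    finally show "2 * R * \<bar>(\<eta>\<^sup>2 * (X r R)\<^sup>2 + \<eta> * W r R) * f r R\<bar> \<le> C" .
    have main: "R * W r R + R * (X r R)\<^sup>2 / 2 \<le> (\<delta> + 1) * X r R"
      unfolding W_def X_def
      by (rule hl_sqrt_superharmonic) (use \<delta> s0[of r] sle[of r] adm[of r] r in auto)
    \<comment> \<open>The term with \<open>\<eta>^2\<close> from the second derivative meets
      \<open>\<eta> * (\<eta> - 1/2)\<close> from the motion of the parameter, leaving exactly the
      1/2 of \<open>hl_sqrt_superharmonic\<close>.\<close>
    have "R * ((\<eta>\<^sup>2 * (X r R)\<^sup>2 + \<eta> * W r R) * f r R) + real CARD('n) / 2 * (- \<eta> * X r R * f r R)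
       - \<eta> * (\<eta> - 1/2) * (R * (X r R)\<^sup>2) * f r R
       = (\<eta> * f r R) * (R * W r R + R * (X r R)\<^sup>2 / 2 - (\<delta> + 1) * X r R)"
    proof -
      have half: "real CARD('n) / 2 = \<delta> + 1" by (simp add: \<delta>(2))
      show ?thesis unfolding half by (simp add: power2_eq_square algebra_simps)
    qed
    also have "\<dots> \<le> 0"
      using main \<eta> f[of r R] by (intro mult_nonneg_nonpos) auto
    finally show "R * ((\<eta>\<^sup>2 * (X r R)\<^sup>2 + \<eta> * W r R) * f r R) + real CARD('n) / 2 * (- \<eta> * X r R * f r R)
       \<le> \<eta> * (\<eta> - 1/2) * (R * (X r R)\<^sup>2) * f r R" by simp
  qed
  from radial_supersolution.Gaussian_mean_le[OF this, of w]
  show ?thesis by (simp add: f_def s_def \<sigma>1)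
qed

section \<open>Exponential tilts and the tangent bound\<close>

lemma gdens_tilt:
  fixes b z :: "real^'n"
  shows "gdens z 1 * exp (- (b \<bullet> z)) = exp ((norm b)\<^sup>2 / 2) * gdens (b + z) 1"
proof -
  have "- (norm z)\<^sup>2 / 2 + - (b \<bullet> z) = (norm b)\<^sup>2 / 2 + - (norm (b + z))\<^sup>2 / 2"
    unfolding power2_norm_eq_inner
    by (simp add: inner_add_left inner_add_right inner_commute field_simps)
  then have "exp (- (norm z)\<^sup>2 / 2) * exp (- (b \<bullet> z)) = exp ((norm b)\<^sup>2 / 2) * exp (- (norm (b + z))\<^sup>2 / 2)"
    by (simp only: exp_add[symmetric])
  then show ?thesis by (simp add: gdens_def mult_ac)
qed

lemma Gaussian_tilt:
  fixes b :: "real^'n" and g :: "real^'n \<Rightarrow> real"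
  assumes [measurable]: "g \<in> borel_measurable borel"
  shows "(\<integral>z. gdens z 1 * (exp (- (b \<bullet> z)) * g z) \<partial>lborel)
     = exp ((norm b)\<^sup>2 / 2) * (\<integral>z. gdens z 1 * g (z - b) \<partial>lborel)"
proof -
  have "(\<integral>z. gdens z 1 * (exp (- (b \<bullet> z)) * g z) \<partial>lborel)
      = (\<integral>z. exp ((norm b)\<^sup>2 / 2) * (gdens (b + z) 1 * g ((b + z) - b)) \<partial>lborel)"
    by (rule Bochner_Integration.integral_cong[OF refl]) (simp add: mult.assoc[symmetric] gdens_tilt)
  also have "\<dots> = exp ((norm b)\<^sup>2 / 2) * (\<integral>z. gdens (b + z) 1 * g ((b + z) - b) \<partial>lborel)"
    by simp
  also have "(\<integral>z. gdens (b + z) 1 * g ((b + z) - b) \<partial>lborel) = (\<integral>z. gdens z 1 * g (z - b) \<partial>lborel)"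
    by (rule lborel_integral_translate[of "\<lambda>z. gdens z 1 * g (z - b)"]) measurable
  finally show ?thesis .
qed

lemma integrable_Gaussian_tilt:
  fixes b :: "real^'n" and g :: "real^'n \<Rightarrow> real"
  assumes [measurable]: "g \<in> borel_measurable borel" and "\<And>z. \<bar>g z\<bar> \<le> K"
  shows "integrable lborel (\<lambda>z. gdens z 1 * (exp (- (b \<bullet> z)) * g z))"
proof -
  have "integrable lborel (\<lambda>z. gdens z 1 * g (z - b))"
    by (rule integrable_gdens_bounded[of _ K 0]) (use assms(2) in auto)
  from lborel_integrable_translate[OF this, of b]
  have "integrable lborel (\<lambda>z. exp ((norm b)\<^sup>2 / 2) * (gdens (b + z) 1 * g z))" by simp
  then show ?thesis unfolding mult.assoc[symmetric] gdens_tilt .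
qed

text \<open>The tangent at \<open>t0\<close> of the convex function \<open>t powr (- k)\<close>,
  obtained from \<open>ln y \<le> y - 1\<close> and \<open>1 + u \<le> exp u\<close>.\<close>

lemma powr_minus_ge_tangent:
  fixes k t t0 :: real
  assumes "k \<ge> 0" "t > 0" "t0 > 0"
  shows "t0 powr (- k) * (1 + k - k * (t / t0)) \<le> t powr (- k)"
proof -
  define y where "y = t / t0"
  have y: "y > 0" "t = t0 * y" using assms by (auto simp: y_def)
  have "1 + k - k * y \<le> 1 - k * ln y"
    using mult_left_mono[OF ln_le_minus_one[OF y(1)] assms(1)] by (simp add: algebra_simps)
  also have "\<dots> \<le> exp (- k * ln y)" using exp_ge_add_one_self[of "- k * ln y"] by simp
  also have "\<dots> = y powr (- k)" using y by (simp add: powr_def)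
  finally have "t0 powr (- k) * (1 + k - k * y) \<le> t0 powr (- k) * y powr (- k)"
    by (intro mult_left_mono) auto
  also have "\<dots> = t powr (- k)" unfolding y(2) using assms y by (simp add: powr_mult)
  finally show ?thesis by (simp add: y_def)
qed

text \<open>Meant for a lower bound \<open>g\<close> that changes sign and an \<open>h\<close> whose
  integral may be infinite; the positive part of \<open>g\<close> mediates.\<close>

lemma ennreal_integral_le_nn_integral:
  fixes g h :: "'a \<Rightarrow> real"
  assumes "integrable M g" "\<And>x. g x \<le> h x"
  shows "ennreal (\<integral>x. g x \<partial>M) \<le> (\<integral>\<^sup>+x. ennreal (h x) \<partial>M)"
proof -
  have i: "integrable M (\<lambda>x. max 0 (g x))" using assms by simp
  have "ennreal (\<integral>x. g x \<partial>M) \<le> ennreal (\<integral>x. max 0 (g x) \<partial>M)"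
    using assms i by (intro ennreal_leI integral_mono) auto
  also have "\<dots> = (\<integral>\<^sup>+x. ennreal (max 0 (g x)) \<partial>M)"
    using i by (intro nn_integral_eq_integral[symmetric]) auto
  also have "\<dots> \<le> (\<integral>\<^sup>+x. ennreal (h x) \<partial>M)"
    using assms(2) by (intro nn_integral_mono) (auto simp: max_def ennreal_leI)
  finally show ?thesis .
qed

lemma borel_measurable_trunc_gamma [measurable]:
  "a > 0 \<Longrightarrow> trunc_gamma a \<in> borel_measurable borel"
  by (intro borel_measurable_continuous_onI continuous_on_trunc_gamma)

text \<open>Up to a constant factor, the normalising denominator of \<open>pH\<close> in the
  rescaled variable.\<close>

definition smoothed_power :: "real \<Rightarrow> real \<Rightarrow> real \<Rightarrow> real^'n \<Rightarrow> real" where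
  "smoothed_power \<delta> p S y = (\<integral>z. gdens z 1 * trunc_gamma \<delta> ((norm (y + sqrt S *\<^sub>R z))\<^sup>2 / 2) powr p \<partial>lborel)"

lemma integrable_smoothed_power:
  fixes y :: "real^'n"
  assumes "\<delta> > 0" "p > 0"
  shows "integrable lborel (\<lambda>z. gdens z 1 * trunc_gamma \<delta> ((norm (y + sqrt S *\<^sub>R z))\<^sup>2 / 2) powr p)"
proof (rule integrable_gdens_bounded[of _ "trunc_gamma \<delta> 0 powr p" 0])
  show "(\<lambda>z. trunc_gamma \<delta> ((norm (y + sqrt S *\<^sub>R z))\<^sup>2 / 2) powr p) \<in> borel_measurable borel"
    using assms by measurable
  show "\<bar>trunc_gamma \<delta> ((norm (y + sqrt S *\<^sub>R z))\<^sup>2 / 2) powr p\<bar> \<le> trunc_gamma \<delta> 0 powr p + 0 * norm z" for z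
    using assms trunc_gamma_antimono[OF assms(1), of 0] trunc_gamma_pos[OF assms(1)]
    by (simp add: powr_mono2 less_imp_le)
qed

lemma borel_measurable_smoothed_power [measurable]:
  assumes "\<delta> > 0"
  shows "smoothed_power \<delta> p S \<in> borel_measurable (borel :: (real^'n) measure)"
proof -
  note [measurable] = borel_measurable_trunc_gamma[OF assms]
  show ?thesis unfolding smoothed_power_def
    by (rule lborel.borel_measurable_lebesgue_integral) measurable
qed

lemma smoothed_power_pos:
  fixes y :: "real^'n"
  assumes "\<delta> > 0" "p > 0"
  shows "smoothed_power \<delta> p S y > 0"
proof -
  let ?h = "\<lambda>z. gdens z 1 * trunc_gamma \<delta> ((norm (y + sqrt S *\<^sub>R z))\<^sup>2 / 2) powr p"
  have pos: "?h z > 0" for z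
    using trunc_gamma_pos[OF assms(1), of "(norm (y + sqrt S *\<^sub>R z))\<^sup>2 / 2"] by (intro mult_pos_pos) auto
  have int: "integrable lborel ?h" by (rule integrable_smoothed_power[OF assms])
  have "0 \<le> integral\<^sup>L lborel ?h" using pos by (intro integral_nonneg_AE) (auto intro: less_imp_le)
  moreover have "integral\<^sup>L lborel ?h \<noteq> 0"
  proof
    assume "integral\<^sup>L lborel ?h = 0"
    then have "AE z in lborel. ?h z = 0"
      by (subst (asm) integral_nonneg_eq_0_iff_AE[OF int]) (use pos in \<open>auto intro: less_imp_le\<close>)
    then have "AE z in lborel. z \<notin> (UNIV :: (real^'n) set)"
      by eventually_elim (use pos in \<open>auto simp: less_le\<close>)
    then have "(UNIV :: (real^'n) set) \<in> null_sets lborel"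
      by (subst (asm) AE_iff_null_sets[symmetric]) auto
    then show False by (auto simp: null_sets_def)
  qed
  ultimately show ?thesis unfolding smoothed_power_def by linarith
qed

text \<open>\<open>Q\<close> is the square root of the sup-convolution \<open>M\<close>. The tangent point \<open>t0\<close> is an exponential,
  so that the means are computed by a shift; the tilt \<open>l\<close> is chosen to shift \<open>w\<close> to
  \<open>(1 + \<sigma> x) w\<close>, where \<open>M\<close> is known explicitly, and \<open>A\<close> makes the bound sharp.\<close>
lemma Gaussian_mean_smoothed_power_ge:
  fixes w :: "real^'n"
  assumes \<delta>: "\<delta> > 0" "real CARD('n) = 2 * (\<delta> + 1)"
    and p: "p > 1" and S: "S > 0" "8 * ((p - 1/2) * S) * (\<delta> + 1) \<le> 3 * (\<delta> + 2)"
  shows "ennreal (trunc_gamma \<delta> ((norm w)\<^sup>2 / 2) powr (- (p - 1)))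
    \<le> (\<integral>\<^sup>+z. ennreal (gdens z 1 * smoothed_power \<delta> p S (w + sqrt S *\<^sub>R z) powr (- ((p - 1) / p))) \<partial>lborel)"
proof -
  define \<sigma> where "\<sigma> = (p - 1/2) * S"
  define k where "k = 2 * (p - 1)"
  define Q where "Q y = exp (1/2 * hl_log \<delta> \<sigma> ((norm y)\<^sup>2 / 2))" for y :: "real^'n"
  define \<rho> where "\<rho> = (norm w)\<^sup>2 / 2"
  define m where "m = trunc_gamma \<delta> \<rho>"
  define x where "x = tg_mean \<delta> \<rho>"
  define l where "l = - (sqrt S * x / 2) *\<^sub>R w"
  define A where "A = sqrt m * exp (k * (norm l)\<^sup>2 / 2)"
  let ?l = "(norm l)\<^sup>2"
  have \<sigma>: "\<sigma> > 0" using p S by (simp add: \<sigma>_def)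
  have \<sigma>S: "\<sigma> = (k + 1) * S / 2" by (simp add: \<sigma>_def k_def algebra_simps)
  have \<sigma>le: "8 * \<sigma> * (\<delta> + 1) \<le> 3 * (\<delta> + 2)" using S by (simp add: \<sigma>_def)
  have adm: "2 * \<sigma> * \<delta> \<le> \<delta> + 1"
    using hl_admissible[OF \<delta>(1) less_imp_le[OF \<sigma>] \<sigma>le] by simp
  have k: "k > 0" using p by (simp add: k_def)
  have m: "m > 0" unfolding m_def by (rule trunc_gamma_pos[OF \<delta>(1)])
  have A: "A > 0" using m by (simp add: A_def)
  have Q: "Q y > 0" for y by (simp add: Q_def)
  have cQ: "continuous_on UNIV Q"
  proof -
    have a: "continuous_on UNIV (\<lambda>y::real^'n. (\<sigma>, (norm y)\<^sup>2 / 2))" by (intro continuous_intros) auto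
    have b: "range (\<lambda>y::real^'n. (\<sigma>, (norm y)\<^sup>2 / 2)) \<subseteq> {\<sigma>. 0 \<le> \<sigma> \<and> 2 * \<sigma> * \<delta> \<le> \<delta> + 1} \<times> UNIV"
      using \<sigma> adm by auto
    show ?thesis unfolding Q_def
      using continuous_on_compose2[OF continuous_on_hl(1)[OF \<delta>(1)] a b] by (intro continuous_intros) simp
  qed
  have [measurable]: "Q \<in> borel_measurable borel" by (rule borel_measurable_continuous_onI[OF cQ])
  have QM: "Q y \<le> exp (1/2 * ln (trunc_gamma \<delta> 0))" for y
    unfolding Q_def using hl_bounds(1)[OF \<delta>(1) less_imp_le[OF \<sigma>] adm, of "(norm y)\<^sup>2 / 2"] by simp
  \<comment> \<open>The parameter runs from 0 to \<open>\<sigma>\<close> at speed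
    \<open>p - 1/2\<close> during time \<open>S\<close>; the negative outer exponent then reverses
    the inequality.\<close>
  have step1: "Q y powr (- k) \<le> smoothed_power \<delta> p S y powr (- ((p - 1) / p))" for y
  proof -
    have "smoothed_power \<delta> p S y = (\<integral>z. gdens z 1 * exp (p * hl_log \<delta> 0 ((norm (y + sqrt S *\<^sub>R z))\<^sup>2 / 2)) \<partial>lborel)"
      unfolding smoothed_power_def hl_log_0[OF \<delta>(1)] powr_def
      using trunc_gamma_pos[OF \<delta>(1)] by (simp add: less_imp_neq[symmetric])
    also have "\<dots> \<le> exp (p * hl_log \<delta> \<sigma> ((norm y)\<^sup>2 / 2))"
      by (rule Gaussian_mean_hl_le) (use \<delta> p S \<sigma>le in \<open>auto simp: \<sigma>_def\<close>)
    finally have le: "smoothed_power \<delta> p S y \<le> exp (p * hl_log \<delta> \<sigma> ((norm y)\<^sup>2 / 2))" .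
    have "Q y powr (- k) = exp (p * hl_log \<delta> \<sigma> ((norm y)\<^sup>2 / 2)) powr (- ((p - 1) / p))"
      using p by (simp add: Q_def powr_def k_def field_simps)
    also have "\<dots> \<le> smoothed_power \<delta> p S y powr (- ((p - 1) / p))"
      using le smoothed_power_pos[OF \<delta>(1), of p S y] p by (intro powr_mono2') auto
    finally show ?thesis .
  qed
  define t0 where "t0 z = A * exp (l \<bullet> z)" for z
  have t0: "t0 z > 0" for z using A by (simp add: t0_def)
  define a1 a2 where "a1 = (1 + k) * A powr (- k)" and "a2 = k * A powr (- k - 1)"
  define G where "G z = gdens z 1 * (a1 * exp (- ((k *\<^sub>R l) \<bullet> z)))
      - gdens z 1 * (exp (- (((k + 1) *\<^sub>R l) \<bullet> z)) * (a2 * Q (w + sqrt S *\<^sub>R z)))" for z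
  have Gle: "G z \<le> gdens z 1 * smoothed_power \<delta> p S (w + sqrt S *\<^sub>R z) powr (- ((p - 1) / p))" for z
  proof -
    let ?q = "Q (w + sqrt S *\<^sub>R z)"
    have "G z = gdens z 1 * (t0 z powr (- k) * (1 + k - k * (?q / t0 z)))"
    proof -
      have e1: "t0 z powr (- k) = A powr (- k) * exp (- ((k *\<^sub>R l) \<bullet> z))"
        using A by (simp add: t0_def powr_mult powr_def[of "exp _"])
      have e2: "t0 z powr (- k) / t0 z = A powr (- k - 1) * exp (- (((k + 1) *\<^sub>R l) \<bullet> z))"
      proof -
        have "t0 z powr (- k) / t0 z = t0 z powr (- k - 1)" using t0[of z] by (simp add: powr_diff)
        also have "\<dots> = A powr (- k - 1) * exp (- (((k + 1) *\<^sub>R l) \<bullet> z))"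
          using A by (simp add: t0_def powr_mult powr_def[of "exp _"] algebra_simps)
        finally show ?thesis .
      qed
      have "t0 z powr (- k) * (1 + k - k * (?q / t0 z)) = (1 + k) * t0 z powr (- k) - k * ?q * (t0 z powr (- k) / t0 z)"
        by (simp add: algebra_simps)
      then show ?thesis unfolding e2 unfolding e1 G_def a1_def a2_def by (simp add: algebra_simps)
    qed
    also have "\<dots> \<le> gdens z 1 * ?q powr (- k)"
      using k Q t0 by (intro mult_left_mono powr_minus_ge_tangent) auto
    also have "\<dots> \<le> gdens z 1 * smoothed_power \<delta> p S (w + sqrt S *\<^sub>R z) powr (- ((p - 1) / p))"
      by (intro mult_left_mono step1) auto
    finally show ?thesis .
  qed
  have i1: "integrable lborel (\<lambda>z::real^'n. gdens z 1 * (exp (- ((k *\<^sub>R l) \<bullet> z)) * a1))"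
    by (rule integrable_Gaussian_tilt[of _ "\<bar>a1\<bar>"]) auto
  have i2: "integrable lborel (\<lambda>z. gdens z 1 * (exp (- (((k + 1) *\<^sub>R l) \<bullet> z)) * (a2 * Q (w + sqrt S *\<^sub>R z))))"
    by (rule integrable_Gaussian_tilt[of _ "\<bar>a2\<bar> * exp (1/2 * ln (trunc_gamma \<delta> 0))"])
       (use QM Q in \<open>auto simp: abs_mult less_imp_le intro!: mult_left_mono\<close>)
  have iG: "integrable lborel G"
    unfolding G_def using i1 i2 by (simp add: mult.commute[of a1])
  have I1: "(\<integral>(z::real^'n). gdens z 1 * (exp (- ((k *\<^sub>R l) \<bullet> z)) * a1) \<partial>lborel) = exp (k\<^sup>2 * ?l / 2) * a1"
    using Gaussian_tilt[of "\<lambda>_. a1" "k *\<^sub>R l"] integral_gdens[of 1, where 'n='n] k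
    by (simp add: power_mult_distrib)
  have I2: "(\<integral>z. gdens z 1 * (exp (- (((k + 1) *\<^sub>R l) \<bullet> z)) * (a2 * Q (w + sqrt S *\<^sub>R z))) \<partial>lborel)
     \<le> exp (k * (k + 1) * ?l / 2) * a2 * sqrt m"
  proof -
    \<comment> \<open>The two tangent terms carry the tilts \<open>k\<close> and
      \<open>k + 1\<close>; only the second multiplies \<open>Q\<close>. Since
      \<open>\<sigma> = (k + 1) * S / 2\<close>, it carries \<open>w\<close> along its
      characteristic.\<close>
    have shift: "w + sqrt S *\<^sub>R (z - (k + 1) *\<^sub>R l) = (1 + \<sigma> * x) *\<^sub>R w + sqrt S *\<^sub>R z" for z
    proof -
      have "sqrt S *\<^sub>R ((k + 1) *\<^sub>R l) = - (\<sigma> * x) *\<^sub>R w"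
        using S by (simp add: l_def \<sigma>S)
      then show ?thesis by (simp add: scaleR_right_diff_distrib scaleR_left_distrib)
    qed
    have a2: "a2 \<ge> 0" using k by (simp add: a2_def)
    have "(\<integral>z. gdens z 1 * (exp (- (((k + 1) *\<^sub>R l) \<bullet> z)) * (a2 * Q (w + sqrt S *\<^sub>R z))) \<partial>lborel)
      = exp ((norm ((k + 1) *\<^sub>R l))\<^sup>2 / 2) * (\<integral>z. gdens z 1 * (a2 * Q (w + sqrt S *\<^sub>R (z - (k + 1) *\<^sub>R l))) \<partial>lborel)"
      by (rule Gaussian_tilt) measurable
    also have "\<dots> = exp ((k + 1)\<^sup>2 * ?l / 2) * a2 * (\<integral>z. gdens z 1 * Q ((1 + \<sigma> * x) *\<^sub>R w + sqrt S *\<^sub>R z) \<partial>lborel)"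
      unfolding shift by (simp add: power_mult_distrib mult.left_commute[of _ a2])
    \<comment> \<open>The mean value inequality for the superharmonic \<open>Q\<close>, the case
      \<open>\<eta> = 1/2\<close>.\<close>
    also have "\<dots> \<le> exp ((k + 1)\<^sup>2 * ?l / 2) * a2 * Q ((1 + \<sigma> * x) *\<^sub>R w)"
    proof (rule mult_left_mono)
      show "(\<integral>z. gdens z 1 * Q ((1 + \<sigma> * x) *\<^sub>R w + sqrt S *\<^sub>R z) \<partial>lborel) \<le> Q ((1 + \<sigma> * x) *\<^sub>R w)"
        unfolding Q_def by (rule Gaussian_mean_hl_le) (use \<delta> S \<sigma> \<sigma>le in auto)
    qed (use a2 in auto)
    also have "Q ((1 + \<sigma> * x) *\<^sub>R w) = sqrt m * exp (- ((k + 1) * ?l / 2))"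
    proof -
      have "(norm ((1 + \<sigma> * x) *\<^sub>R w))\<^sup>2 / 2 = hl_map \<delta> \<sigma> \<rho>"
        by (simp add: hl_map_def \<rho>_def x_def power_mult_distrib)
      then have "Q ((1 + \<sigma> * x) *\<^sub>R w) = exp (1/2 * (ln m - \<sigma> * (\<rho> * x\<^sup>2)))"
        by (simp add: Q_def hl_log_map[OF \<delta>(1) less_imp_le[OF \<sigma>] adm] m_def x_def)
      \<comment> \<open>The balance of loss and gain: the penalty of the sup-convolution equals a
        multiple of the squared tilt.\<close>
      also have "\<sigma> * (\<rho> * x\<^sup>2) = (k + 1) * ?l"
      proof -
        have "?l = S * x\<^sup>2 / 4 * (norm w)\<^sup>2"
          using S by (simp add: l_def power_mult_distrib power_divide)
        then show ?thesis by (simp add: \<sigma>S \<rho>_def)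
      qed
      also have "exp (1/2 * (ln m - (k + 1) * ?l)) = exp (1/2 * ln m) * exp (- ((k + 1) * ?l / 2))"
        by (simp add: exp_add[symmetric] algebra_simps)
      also have "exp (1/2 * ln m) = sqrt m" using m by (simp add: powr_half_sqrt[symmetric] powr_def)
      finally show ?thesis .
    qed
    also have "exp ((k + 1)\<^sup>2 * ?l / 2) * a2 * (sqrt m * exp (- ((k + 1) * ?l / 2)))
       = (exp ((k + 1)\<^sup>2 * ?l / 2) * exp (- ((k + 1) * ?l / 2))) * a2 * sqrt m"
      by (simp add: mult_ac)
    also have "exp ((k + 1)\<^sup>2 * ?l / 2) * exp (- ((k + 1) * ?l / 2)) = exp (k * (k + 1) * ?l / 2)"
      unfolding exp_add[symmetric] by (simp add: power2_eq_square field_simps)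
    finally show ?thesis .
  qed
  have "m powr (- (p - 1)) \<le> (\<integral>z. G z \<partial>lborel)"
  proof -
    \<comment> \<open>With the chosen \<open>A\<close>, both tangent terms become multiples of
      \<open>exp (k^2 * |l|^2 / 2) * A powr (- k)\<close>, with weights \<open>1 + k\<close> and
      \<open>k\<close>, so exactly one copy survives.\<close>
    have kk: "k * (k + 1) * ?l / 2 = k\<^sup>2 * ?l / 2 + k * ?l / 2"
      by (simp add: power2_eq_square algebra_simps add_divide_distrib)
    have "exp (k * (k + 1) * ?l / 2) * a2 * sqrt m
       = exp (k\<^sup>2 * ?l / 2) * k * (A powr (- k - 1) * A)"
      unfolding kk exp_add by (simp add: a2_def A_def mult_ac)
    also have "A powr (- k - 1) * A = A powr (- k)" using A by (simp add: powr_diff)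
    finally have I2': "exp (k * (k + 1) * ?l / 2) * a2 * sqrt m
      = exp (k\<^sup>2 * ?l / 2) * k * A powr (- k)" .
    have "A powr (- k) = sqrt m powr (- k) * exp (- (k\<^sup>2 * ?l / 2))"
      using m by (simp add: A_def powr_mult powr_def[of "exp _"] power2_eq_square)
    moreover have "sqrt m powr (- k) = m powr (- (p - 1))"
    proof -
      have "sqrt m powr (- k) = m powr (1/2 * - k)"
        using m by (simp only: powr_half_sqrt[symmetric] powr_powr less_imp_le)
      also have "1/2 * - k = - (p - 1)" by (simp add: k_def)
      finally show ?thesis .
    qed
    ultimately have "m powr (- (p - 1)) = exp (k\<^sup>2 * ?l / 2) * A powr (- k)"
      by (simp add: exp_minus field_simps)
    also have "\<dots> = exp (k\<^sup>2 * ?l / 2) * a1 - exp (k\<^sup>2 * ?l / 2) * k * A powr (- k)"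
      by (simp add: a1_def algebra_simps)
    also have "\<dots> \<le> (\<integral>z. G z \<partial>lborel)"
      using I1 I2 i1 i2 unfolding I2' G_def by (simp add: mult.commute[of a1])
    finally show ?thesis .
  qed
  then have "ennreal (m powr (- (p - 1))) \<le> ennreal (\<integral>z. G z \<partial>lborel)" by (rule ennreal_leI)
  also have "\<dots> \<le> (\<integral>\<^sup>+z. ennreal (gdens z 1 * smoothed_power \<delta> p S (w + sqrt S *\<^sub>R z) powr (- ((p - 1) / p))) \<partial>lborel)"
    by (rule ennreal_integral_le_nn_integral[OF iG Gle])
  finally show ?thesis by (simp add: m_def \<rho>_def)
qed

section \<open>The harmonic marginal\<close>

lemma ennreal_trunc_gamma:
  assumes "a > 0"
  shows "ennreal (trunc_gamma a \<rho>)
    = (\<integral>\<^sup>+t. ennreal (indicator {0<..<1} t * (t powr (a - 1) * exp (- \<rho> * t))) \<partial>lborel)"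
proof -
  have "ennreal (trunc_gamma a \<rho>) = (\<integral>\<^sup>+t. ennreal (indicator {0..1} t *\<^sub>R (t powr (a - 1) * exp (- \<rho> * t))) \<partial>lborel)"
    unfolding trunc_gamma_def set_lebesgue_integral_def
    using trunc_gamma_integrable[OF assms, of \<rho>]
    by (intro nn_integral_eq_integral[symmetric]) (auto simp: set_integrable_def)
  also have "\<dots> = (\<integral>\<^sup>+t. ennreal (indicator {0<..<1} t * (t powr (a - 1) * exp (- \<rho> * t))) \<partial>lborel)"
    by (intro nn_integral_cong_AE eventually_mono[OF AE_lborel_singleton[of 1]])
       (auto simp: indicator_def less_le)
  finally show ?thesis .
qed

text \<open>The Gamma integral under \<open>u = t * s / (1 - s)\<close>. With
  \<open>t = |\<mu>|^2 / (2 * v)\<close> the exponential is a Gaussian of precision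
  \<open>s / ((1 - s) * v)\<close> in \<open>\<mu>\<close>; together with the precision
  \<open>1 / v\<close> of the likelihood this is \<open>1 / ((1 - s) * v)\<close>, so mixing over
  the unit interval in \<open>s\<close> is the natural parametrisation.\<close>

lemma nn_integral_Gamma_substitution:
  assumes \<delta>: "\<delta> > 0" and t: "t > 0"
  shows "(\<integral>\<^sup>+s. ennreal (indicator {0<..<1} s *
      (s powr (\<delta> - 1) * (1 - s) powr (- \<delta> - 1) * exp (- (s / (1 - s)) * t))) \<partial>lborel)
    = ennreal (Gamma \<delta> * t powr (- \<delta>))"
proof -
  let ?f = "\<lambda>u::real. u powr (\<delta> - 1) / exp u"
  let ?g = "\<lambda>s::real. t * s / (1 - s)"
  let ?g' = "\<lambda>s::real. t / (1 - s)\<^sup>2"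
  let ?h = "\<lambda>s::real. s powr (\<delta> - 1) * (1 - s) powr (- \<delta> - 1) * exp (- (s / (1 - s)) * t)"
  have f0: "(?f has_integral Gamma \<delta>) {0..}" by (rule Gamma_integral_real[OF \<delta>])
  have f1: "(?f has_integral Gamma \<delta>) {0<..}"
  proof -
    have "(?f has_integral Gamma \<delta>) {0..} \<longleftrightarrow> (?f has_integral Gamma \<delta>) {0<..}"
    proof (rule has_integral_spike_set_eq)
      show "negligible {x \<in> {0..} - {0<..}. ?f x \<noteq> 0}"
        by (rule negligible_subset[of "{0}"]) auto
      show "negligible {x \<in> {0<..} - {0..}. ?f x \<noteq> 0}"
        by (rule negligible_subset[of "{}"]) auto
    qed
    then show ?thesis using f0 by simp
  qed
  have img: "?g ` {0<..<1} = {0<..}"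
  proof
    show "?g ` {0<..<1} \<subseteq> {0<..}" using t by auto
    show "{0<..} \<subseteq> ?g ` {0<..<1}"
    proof
      fix u :: real assume u: "u \<in> {0<..}"
      have e: "1 - u / (t + u) = t / (t + u)" "t + u > 0" using u t by (auto simp: field_simps)
      have "u = ?g (u / (t + u))" unfolding e(1) using e(2) t by simp
      moreover have "u / (t + u) \<in> {0<..<1}" using u t by (auto simp: field_simps)
      ultimately show "u \<in> ?g ` {0<..<1}" by blast
    qed
  qed
  have dg: "(?g has_field_derivative ?g' s) (at s within {0<..<1})" if "s \<in> {0<..<1}" for s
    using that by (auto intro!: derivative_eq_intros simp: field_simps power2_eq_square)
  have inj: "inj_on ?g {0<..<1}"
    using t by (auto simp: inj_on_def field_simps)
  have "?f absolutely_integrable_on ?g ` {0<..<1} \<and> integral (?g ` {0<..<1}) ?f = Gamma \<delta>"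
    unfolding img using f1
    by (auto simp: integral_unique integrable_on_def intro!: nonnegative_absolutely_integrable_1)
  then have "(\<lambda>s. \<bar>?g' s\<bar> * ?f (?g s)) absolutely_integrable_on {0<..<1} \<and>
      integral {0<..<1} (\<lambda>s. \<bar>?g' s\<bar> * ?f (?g s)) = Gamma \<delta>"
    using has_absolute_integral_change_of_variables_1'[OF _ dg inj, of ?f "Gamma \<delta>"] by simp
  then have "((\<lambda>s. \<bar>?g' s\<bar> * ?f (?g s)) has_integral Gamma \<delta>) {0<..<1}"
    unfolding has_integral_integrable_integral using set_lebesgue_integral_eq_integral(1) by blast
  then have "((\<lambda>s. t powr (- \<delta>) * (\<bar>?g' s\<bar> * ?f (?g s))) has_integral t powr (- \<delta>) * Gamma \<delta>) {0<..<1}"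
    by (rule has_integral_mult_right)
  also have "?this \<longleftrightarrow> (?h has_integral t powr (- \<delta>) * Gamma \<delta>) {0<..<1}"
  proof (rule has_integral_cong)
    fix s :: real assume s: "s \<in> {0<..<1}"
    define r where "r = 1 - s"
    have r: "r > 0" using s by (simp add: r_def)
    have "(t * s / r) powr (\<delta> - 1) = t powr (\<delta> - 1) * s powr (\<delta> - 1) * r powr (- (\<delta> - 1))"
    proof -
      have "(t * s / r) powr (\<delta> - 1) = (t * s) powr (\<delta> - 1) / r powr (\<delta> - 1)"
        using s t r by (simp add: powr_divide)
      also have "(t * s) powr (\<delta> - 1) = t powr (\<delta> - 1) * s powr (\<delta> - 1)"
        using s t by (simp add: powr_mult)
      finally show ?thesis unfolding powr_minus divide_inverse .
    qed
    moreover have "\<bar>t / r\<^sup>2\<bar> = t powr 1 * r powr (-2)"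
      using t r by (simp add: powr_minus divide_inverse powr_numeral)
    moreover have "exp (t * s / r) = 1 / exp (- (s / r) * t)"
      by (simp add: exp_minus field_simps)
    ultimately have "t powr (- \<delta>) * (\<bar>t / r\<^sup>2\<bar> * ((t * s / r) powr (\<delta> - 1) / exp (t * s / r)))
      = (t powr (- \<delta>) * t powr 1 * t powr (\<delta> - 1)) * s powr (\<delta> - 1) * (r powr (-2) * r powr (- (\<delta> - 1))) * exp (- (s / r) * t)"
      by simp
    also have "t powr (- \<delta>) * t powr 1 * t powr (\<delta> - 1) = 1"
      using t by (simp only: powr_add[symmetric]) simp
    also have "r powr (-2) * r powr (- (\<delta> - 1)) = r powr (- \<delta> - 1)"
      unfolding powr_add[symmetric] by (rule arg_cong[where f = "\<lambda>a. r powr a"]) simp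
    finally show "t powr (- \<delta>) * (\<bar>t / (1 - s)\<^sup>2\<bar> * ((t * s / (1 - s)) powr (\<delta> - 1) / exp (t * s / (1 - s)))) = ?h s"
      by (simp add: r_def)
  qed
  finally have "(?h has_integral t powr (- \<delta>) * Gamma \<delta>) {0<..<1}" .
  from nn_integral_has_integral_lebesgue[OF _ this] show ?thesis
    by (simp add: mult.commute)
qed

text \<open>Completing the square: as a function of \<open>\<mu>\<close> the product is proportional
  to a normal density with mean \<open>(1 - s) *\<^sub>R w\<close> and variance
  \<open>v * (1 - s)\<close>.\<close>

lemma nn_integral_Gaussian_product:
  fixes w :: "real^'n"
  assumes v: "v > 0" and s: "s \<in> {0<..<1}"
  shows "(\<integral>\<^sup>+\<mu>. ennreal (gdens (w - \<mu>) v * exp (- (s / (1 - s)) * ((norm \<mu>)\<^sup>2 / (2 * v)))) \<partial>lborel)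
    = ennreal ((1 - s) powr (real CARD('n) / 2) * exp (- ((norm w)\<^sup>2 / (2 * v)) * s))"
proof -
  define r where "r = 1 - s"
  have r: "r > 0" using s by (simp add: r_def)
  have rs: "s = 1 - r" by (simp add: r_def)
  define E where "E = exp (- ((norm w)\<^sup>2 / (2 * v)) * s)"
  have eq: "gdens (w - \<mu>) v * exp (- (s / (1 - s)) * ((norm \<mu>)\<^sup>2 / (2 * v)))
     = (r powr (real CARD('n) / 2) * E) * gdens (- (r *\<^sub>R w) + \<mu>) (v * r)" for \<mu>
  proof -
    have e: "- (norm (w - \<mu>))\<^sup>2 / (2 * v) + - (s / r) * ((norm \<mu>)\<^sup>2 / (2 * v))
        = - ((norm w)\<^sup>2 / (2 * v)) * s + - (norm (- (r *\<^sub>R w) + \<mu>))\<^sup>2 / (2 * (v * r))"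
      unfolding power2_norm_eq_inner rs using r v
      by (simp add: inner_diff_left inner_diff_right inner_add_left inner_add_right inner_commute field_simps power2_eq_square)
    have c: "(2 * pi * v) powr (- real CARD('n) / 2) = r powr (real CARD('n) / 2) * (2 * pi * (v * r)) powr (- real CARD('n) / 2)"
    proof -
      have "r powr (real CARD('n) / 2) * (2 * pi * (v * r)) powr (- real CARD('n) / 2)
        = (r powr (real CARD('n) / 2) * r powr (- real CARD('n) / 2)) * (2 * pi * v) powr (- real CARD('n) / 2)"
        using r v by (simp add: powr_mult mult_ac)
      also have "r powr (real CARD('n) / 2) * r powr (- real CARD('n) / 2) = 1"
        using r by (simp add: powr_add[symmetric])
      finally show ?thesis by simp
    qed
    have "exp (- (norm (w - \<mu>))\<^sup>2 / (2 * v)) * exp (- (s / r) * ((norm \<mu>)\<^sup>2 / (2 * v)))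
       = E * exp (- (norm (- (r *\<^sub>R w) + \<mu>))\<^sup>2 / (2 * (v * r)))"
      unfolding E_def exp_add[symmetric] e ..
    then show ?thesis unfolding gdens_def c r_def[symmetric] by (simp only: mult_ac) simp
  qed
  have one: "(\<integral>\<^sup>+\<mu>. ennreal (gdens (- (r *\<^sub>R w) + \<mu>) (v * r)) \<partial>lborel) = 1"
    using lborel_nn_integral_translate[of "\<lambda>\<mu>. ennreal (gdens \<mu> (v * r))" "- (r *\<^sub>R w)"] v r
    by (simp add: nn_integral_gdens)
  have "(\<integral>\<^sup>+\<mu>. ennreal ((r powr (real CARD('n) / 2) * E) * gdens (- (r *\<^sub>R w) + \<mu>) (v * r)) \<partial>lborel)
     = (\<integral>\<^sup>+\<mu>. ennreal (r powr (real CARD('n) / 2) * E) * ennreal (gdens (- (r *\<^sub>R w) + \<mu>) (v * r)) \<partial>lborel)"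
    by (intro nn_integral_cong ennreal_mult') (auto simp: E_def)
  also have "\<dots> = ennreal (r powr (real CARD('n) / 2) * E) * (\<integral>\<^sup>+\<mu>. ennreal (gdens (- (r *\<^sub>R w) + \<mu>) (v * r)) \<partial>lborel)"
    by (rule nn_integral_cmult) measurable
  finally show ?thesis unfolding eq one by (simp add: r_def E_def)
qed

text \<open>The harmonic prior is a mixture of Gaussians. Integrating out \<open>\<mu>\<close> gives
  the power \<open>\<delta> + 1\<close> of \<open>1 - s\<close>, half the dimension, which cancels
  the weight \<open>(1 - s) powr (- \<delta> - 1)\<close> and leaves a truncated gamma
  integral.\<close>

lemma mH_eq_trunc_gamma:
  fixes w :: "real^'n"
  assumes \<delta>: "\<delta> > 0" "real CARD('n) = 2 * (\<delta> + 1)" and v: "v > 0"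
  shows "mH w v = (2 * v) powr (- \<delta>) / Gamma \<delta> * trunc_gamma \<delta> ((norm w)\<^sup>2 / (2 * v))"
proof -
  define K where "K = (2 * v) powr (- \<delta>) / Gamma \<delta>"
  have G: "Gamma \<delta> > 0" using \<delta> by (simp add: Gamma_real_pos)
  have K: "K > 0" using G v by (simp add: K_def)
  let ?k = "\<lambda>s. s powr (\<delta> - 1) * (1 - s) powr (- \<delta> - 1)"
  let ?e = "\<lambda>s (\<mu>::real^'n). exp (- (s / (1 - s)) * ((norm \<mu>)\<^sup>2 / (2 * v)))"
  let ?F = "\<lambda>s \<mu>. ennreal (gdens (w - \<mu>) v) * ennreal (indicator {0<..<1} s * (?k s * ?e s \<mu>))"
  have prior: "ennreal (norm \<mu> powr (- (real CARD('n) - 2)))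
      = ennreal K * (\<integral>\<^sup>+s. ennreal (indicator {0<..<1} s * (?k s * ?e s \<mu>)) \<partial>lborel)" if "\<mu> \<noteq> 0" for \<mu> :: "real^'n"
  proof -
    define t where "t = (norm \<mu>)\<^sup>2 / (2 * v)"
    have t: "t > 0" using that v by (simp add: t_def)
    have sq: "(norm \<mu>)\<^sup>2 = norm \<mu> powr 2" using that by (simp add: powr_numeral)
    have "norm \<mu> powr (- (real CARD('n) - 2)) = ((norm \<mu>)\<^sup>2) powr (- \<delta>)"
      unfolding sq powr_powr by (simp add: \<delta>(2))
    also have "(norm \<mu>)\<^sup>2 = (2 * v) * t" using v by (simp add: t_def)
    also have "((2 * v) * t) powr (- \<delta>) = K * (Gamma \<delta> * t powr (- \<delta>))"
      using v t G by (simp add: powr_mult K_def)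
    finally have "ennreal (norm \<mu> powr (- (real CARD('n) - 2))) = ennreal K * ennreal (Gamma \<delta> * t powr (- \<delta>))"
      using K by (simp add: ennreal_mult')
    then show ?thesis
      unfolding t_def[symmetric] nn_integral_Gamma_substitution[OF \<delta>(1) t] .
  qed
  have inner: "(\<integral>\<^sup>+\<mu>. ?F s \<mu> \<partial>lborel)
      = ennreal (indicator {0<..<1} s * (s powr (\<delta> - 1) * exp (- ((norm w)\<^sup>2 / (2 * v)) * s)))" for s
  proof (cases "s \<in> {0<..<1}")
    case True
    have "(\<integral>\<^sup>+\<mu>. ?F s \<mu> \<partial>lborel) = ennreal (?k s) * (\<integral>\<^sup>+\<mu>. ennreal (gdens (w - \<mu>) v * ?e s \<mu>) \<partial>lborel)"
    proof -
      have "?F s \<mu> = ennreal (?k s) * ennreal (gdens (w - \<mu>) v * ?e s \<mu>)" for \<mu>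
      proof -
        have "?F s \<mu> = ennreal (gdens (w - \<mu>) v * (?k s * ?e s \<mu>))"
          using True by (simp add: ennreal_mult')
        also have "gdens (w - \<mu>) v * (?k s * ?e s \<mu>) = ?k s * (gdens (w - \<mu>) v * ?e s \<mu>)" by simp
        also have "ennreal \<dots> = ennreal (?k s) * ennreal (gdens (w - \<mu>) v * ?e s \<mu>)"
          by (rule ennreal_mult') simp
        finally show ?thesis .
      qed
      then show ?thesis by (simp only:) (rule nn_integral_cmult, measurable)
    qed
    also have "\<dots> = ennreal (?k s * ((1 - s) powr (\<delta> + 1) * exp (- ((norm w)\<^sup>2 / (2 * v)) * s)))"
    proof -
      have half: "real CARD('n) / 2 = \<delta> + 1" by (simp add: \<delta>(2))
      show ?thesis unfolding nn_integral_Gaussian_product[OF v True] half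
        by (rule ennreal_mult'[symmetric]) simp
    qed
    also have "?k s * ((1 - s) powr (\<delta> + 1) * exp (- ((norm w)\<^sup>2 / (2 * v)) * s))
       = s powr (\<delta> - 1) * ((1 - s) powr (- \<delta> - 1) * (1 - s) powr (\<delta> + 1)) * exp (- ((norm w)\<^sup>2 / (2 * v)) * s)"
      by simp
    also have "(1 - s) powr (- \<delta> - 1) * (1 - s) powr (\<delta> + 1) = 1"
      using True by (simp add: powr_add[symmetric])
    finally show ?thesis using True by simp
  qed simp
  have "(\<integral>\<^sup>+\<mu>. ennreal (gdens (w - \<mu>) v * norm \<mu> powr (- (real CARD('n) - 2))) \<partial>lborel)
      = (\<integral>\<^sup>+\<mu>. ennreal K * (\<integral>\<^sup>+s. ?F s \<mu> \<partial>lborel) \<partial>lborel)"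
  \<comment> \<open>The origin has to be left out: there \<open>0 powr _\<close> is 0, whereas the
    mixture diverges.\<close>
  proof (intro nn_integral_cong_AE eventually_mono[OF AE_lborel_singleton[of 0]])
    fix \<mu> :: "real^'n" assume \<mu>: "\<mu> \<noteq> 0"
    have "ennreal (gdens (w - \<mu>) v * norm \<mu> powr (- (real CARD('n) - 2)))
       = ennreal (gdens (w - \<mu>) v) * (ennreal K * (\<integral>\<^sup>+s. ennreal (indicator {0<..<1} s * (?k s * ?e s \<mu>)) \<partial>lborel))"
      unfolding prior[OF \<mu>, symmetric] by (rule ennreal_mult') simp
    also have "\<dots> = ennreal K * (\<integral>\<^sup>+s. ?F s \<mu> \<partial>lborel)"
    proof -
      have "(\<integral>\<^sup>+s. ?F s \<mu> \<partial>lborel) = ennreal (gdens (w - \<mu>) v) * (\<integral>\<^sup>+s. ennreal (indicator {0<..<1} s * (?k s * ?e s \<mu>)) \<partial>lborel)"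
        by (rule nn_integral_cmult) measurable
      then show ?thesis by (simp only: mult.left_commute)
    qed
    finally show "ennreal (gdens (w - \<mu>) v * norm \<mu> powr (- (real CARD('n) - 2))) = ennreal K * (\<integral>\<^sup>+s. ?F s \<mu> \<partial>lborel)" .
  qed
  also have "\<dots> = ennreal K * (\<integral>\<^sup>+\<mu>. (\<integral>\<^sup>+s. ?F s \<mu> \<partial>lborel) \<partial>lborel)"
    by (rule nn_integral_cmult) measurable
  also have "(\<integral>\<^sup>+\<mu>. (\<integral>\<^sup>+s. ?F s \<mu> \<partial>lborel) \<partial>lborel) = (\<integral>\<^sup>+s. (\<integral>\<^sup>+\<mu>. ?F s \<mu> \<partial>lborel) \<partial>lborel)"
    by (rule lborel_pair.Fubini') measurable
  also have "\<dots> = ennreal (trunc_gamma \<delta> ((norm w)\<^sup>2 / (2 * v)))"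
    unfolding inner ennreal_trunc_gamma[OF \<delta>(1)] ..
  also have "ennreal K * \<dots> = ennreal (K * trunc_gamma \<delta> ((norm w)\<^sup>2 / (2 * v)))"
    using K trunc_gamma_pos[OF \<delta>(1)] by (simp add: ennreal_mult' less_imp_le)
  finally have "(\<integral>\<^sup>+\<mu>. ennreal (gdens (w - \<mu>) v * norm \<mu> powr (- (real CARD('n) - 2))) \<partial>lborel)
     = ennreal (K * trunc_gamma \<delta> ((norm w)\<^sup>2 / (2 * v)))" .
  moreover have "0 \<le> K * trunc_gamma \<delta> ((norm w)\<^sup>2 / (2 * v))"
    using K trunc_gamma_pos[OF \<delta>(1), of "(norm w)\<^sup>2 / (2 * v)"] by simp
  ultimately show ?thesis
    unfolding mH_def K_def[symmetric] by (subst integral_eq_nn_integral) (auto simp del: minus_diff_eq)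
qed

section \<open>Comparison of the risks\<close>

lemma gdens_scale:
  fixes z :: "real^'n"
  assumes "c \<noteq> 0"
  shows "\<bar>c\<bar> ^ CARD('n) * gdens (c *\<^sub>R z) (c\<^sup>2) = gdens z 1"
proof -
  have "(2 * pi * c\<^sup>2) powr (- real CARD('n) / 2) = (2 * pi) powr (- real CARD('n) / 2) * (\<bar>c\<bar> powr 2) powr (- real CARD('n) / 2)"
    using assms by (simp add: powr_mult powr_numeral)
  also have "(\<bar>c\<bar> powr 2) powr (- real CARD('n) / 2) = \<bar>c\<bar> powr (- real CARD('n))"
    unfolding powr_powr by simp
  finally have "(2 * pi * c\<^sup>2) powr (- real CARD('n) / 2) = (2 * pi) powr (- real CARD('n) / 2) * \<bar>c\<bar> powr (- real CARD('n))" .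
  moreover have "\<bar>c\<bar> ^ CARD('n) * \<bar>c\<bar> powr (- real CARD('n)) = 1"
    using assms by (simp add: powr_minus powr_realpow)
  ultimately have "\<bar>c\<bar> ^ CARD('n) * (2 * pi * c\<^sup>2) powr (- real CARD('n) / 2) = (2 * pi) powr (- real CARD('n) / 2)"
    by (simp add: mult.left_commute)
  moreover have "- (norm (c *\<^sub>R z))\<^sup>2 / (2 * c\<^sup>2) = - (norm z)\<^sup>2 / (2 * 1)"
    using assms by (simp add: power_mult_distrib)
  ultimately show ?thesis unfolding gdens_def by (simp only: mult.assoc[symmetric]) simp
qed

lemma nn_integral_gdens_affine:
  fixes h :: "real^'n \<Rightarrow> ennreal"
  assumes [measurable]: "h \<in> borel_measurable borel" and c: "c \<noteq> 0"
  shows "(\<integral>\<^sup>+y. h y * ennreal (gdens (y - x) (c\<^sup>2)) \<partial>lborel)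
    = (\<integral>\<^sup>+z. h (x + c *\<^sub>R z) * ennreal (gdens z 1) \<partial>lborel)"
proof -
  have "(\<integral>\<^sup>+y. h y * ennreal (gdens (y - x) (c\<^sup>2)) \<partial>lborel)
    = (\<integral>\<^sup>+y. h y * ennreal (gdens (y - x) (c\<^sup>2))
        \<partial>density (distr lborel borel (\<lambda>z. x + c *\<^sub>R z)) (\<lambda>_. ennreal (\<bar>c\<bar> ^ DIM(real^'n))))"
    by (subst lborel_affine[OF c, of x]) simp
  also have "\<dots> = (\<integral>\<^sup>+z. ennreal (\<bar>c\<bar> ^ CARD('n)) * (h (x + c *\<^sub>R z) * ennreal (gdens (c *\<^sub>R z) (c\<^sup>2))) \<partial>lborel)"
    by (subst nn_integral_density) (auto simp: nn_integral_distr)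
  also have "\<dots> = (\<integral>\<^sup>+z. h (x + c *\<^sub>R z) * ennreal (gdens z 1) \<partial>lborel)"
  proof (rule nn_integral_cong)
    fix z :: "real^'n"
    have "ennreal (\<bar>c\<bar> ^ CARD('n)) * ennreal (gdens (c *\<^sub>R z) (c\<^sup>2)) = ennreal (gdens z 1)"
      unfolding gdens_scale[OF c, symmetric] by (rule ennreal_mult'[symmetric]) simp
    then show "ennreal (\<bar>c\<bar> ^ CARD('n)) * (h (x + c *\<^sub>R z) * ennreal (gdens (c *\<^sub>R z) (c\<^sup>2)))
      = h (x + c *\<^sub>R z) * ennreal (gdens z 1)"
      by (metis mult.left_commute)
  qed
  finally show ?thesis .
qed

text \<open>Since \<open>(q / \<phi>)^(1 - b) * \<phi> = q^(1 - b) * \<phi>^b\<close>, the risk is a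
  decreasing affine function of the affinity \<open>N\<close>. Young's inequality bounds
  \<open>N\<close> by 1, so every Bochner integral involved converges and none falls back on the
  default value 0.\<close>

lemma risk_eq:
  fixes q :: "real^'n \<Rightarrow> real^'n \<Rightarrow> real" and \<mu> :: "real^'n"
  assumes \<alpha>: "-1 < \<alpha>" "\<alpha> < 1" and v: "vx > 0" "vy > 0"
    and meas: "(\<lambda>(x, y). q x y) \<in> borel_measurable (borel \<Otimes>\<^sub>M borel)"
    and pos: "\<And>x y. q x y > 0" and mass: "\<And>x. (\<integral>\<^sup>+y. ennreal (q x y) \<partial>lborel) \<le> 1"
  defines "b \<equiv> beta_of \<alpha>"
  defines "N \<equiv> (\<integral>\<^sup>+x. (\<integral>\<^sup>+y. ennreal (q x y powr (1 - b) * gdens (y - \<mu>) vy powr b * gdens (x - \<mu>) vx) \<partial>lborel) \<partial>lborel)"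
  shows "N \<le> 1" and "risk \<alpha> vx vy \<mu> q = 4 / (1 - \<alpha>\<^sup>2) * (1 - enn2real N)"
proof -
  let ?g = "\<lambda>y. gdens (y - \<mu>) vy" and ?k = "\<lambda>x. gdens (x - \<mu>) vx"
  have b: "0 < b" "b < 1" "(1 + \<alpha>) / 2 = 1 - b"
    using \<alpha> by (auto simp: b_def beta_of_def field_simps)
  have qx [measurable]: "q x \<in> borel_measurable borel" for x
    using measurable_compose[OF measurable_Pair1'[of x borel borel] meas] by simp
  have [measurable]: "(\<lambda>p. q (fst p) (snd p)) \<in> borel_measurable (borel \<Otimes>\<^sub>M borel)"
    using meas by (simp add: case_prod_beta')
  define J where "J x y = q x y powr (1 - b) * ?g y powr b" for x y
  have J0: "J x y \<ge> 0" for x y by (simp add: J_def)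
  have J [measurable]: "J x \<in> borel_measurable borel" for x unfolding J_def by measurable
  have gy: "(\<integral>\<^sup>+y. ennreal (?g y) \<partial>lborel) = 1"
    using lborel_nn_integral_translate[of "\<lambda>y. ennreal (gdens y vy)" "- \<mu>"] nn_integral_gdens[OF v(2), where 'n='n] by simp
  have gx: "(\<integral>\<^sup>+x. ennreal (?k x) \<partial>lborel) = 1"
    using lborel_nn_integral_translate[of "\<lambda>y. ennreal (gdens y vx)" "- \<mu>"] nn_integral_gdens[OF v(1), where 'n='n] by simp
  have iy: "integrable lborel (\<lambda>y. ?g y)" and ix: "integrable lborel (\<lambda>x. ?k x)"
    using gy gx by (auto intro!: integrableI_nonneg)
  have Iy: "(\<integral>y. ?g y \<partial>lborel) = 1" and Ix: "(\<integral>x. ?k x \<partial>lborel) = 1"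
    using gy gx by (auto simp: integral_eq_nn_integral)
  have Jle: "(\<integral>\<^sup>+y. ennreal (J x y) \<partial>lborel) \<le> 1" for x
  proof -
    have "(\<integral>\<^sup>+y. ennreal (J x y) \<partial>lborel) \<le> (\<integral>\<^sup>+y. ennreal (1 - b) * ennreal (q x y) + ennreal b * ennreal (?g y) \<partial>lborel)"
    proof (rule nn_integral_mono)
      fix y
      have "J x y \<le> (1 - b) * q x y + b * ?g y"
        unfolding J_def using b pos[of x y] v by (intro Youngs_inequality_0) auto
      then have "ennreal (J x y) \<le> ennreal ((1 - b) * q x y + b * ?g y)" by (rule ennreal_leI)
      also have "\<dots> = ennreal (1 - b) * ennreal (q x y) + ennreal b * ennreal (?g y)"
        using b pos[of x y] by (simp add: ennreal_plus ennreal_mult')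
      finally show "ennreal (J x y) \<le> ennreal (1 - b) * ennreal (q x y) + ennreal b * ennreal (?g y)" .
    qed
    also have "\<dots> = ennreal (1 - b) * (\<integral>\<^sup>+y. ennreal (q x y) \<partial>lborel) + ennreal b * (\<integral>\<^sup>+y. ennreal (?g y) \<partial>lborel)"
      by (simp add: nn_integral_add nn_integral_cmult)
    also have "\<dots> \<le> ennreal (1 - b) * 1 + ennreal b * 1"
      using mass[of x] gy by (intro add_mono mult_left_mono) auto
    also have "\<dots> = ennreal ((1 - b) + b)" using b by (subst ennreal_plus) auto
    also have "\<dots> = 1" by simp
    finally show ?thesis .
  qed
  have iJ: "integrable lborel (J x)" for x
    using Jle[of x] J0 by (intro integrableI_nonneg) (auto simp: le_less_trans)
  define I where "I x = (\<integral>y. J x y \<partial>lborel)" for x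
  have eI: "ennreal (I x) = (\<integral>\<^sup>+y. ennreal (J x y) \<partial>lborel)" for x
    unfolding I_def using iJ J0 by (intro nn_integral_eq_integral[symmetric]) auto
  have I01: "0 \<le> I x" "I x \<le> 1" for x
  proof -
    show "0 \<le> I x" unfolding I_def using J0 by (intro integral_nonneg_AE) auto
    then show "I x \<le> 1" using Jle[of x] unfolding eI[symmetric] by simp
  qed
  have Imeas [measurable]: "I \<in> borel_measurable borel"
    unfolding I_def J_def by (rule lborel.borel_measurable_lebesgue_integral) measurable
  have D: "D_alpha \<alpha> vy \<mu> (q x) = 4 / (1 - \<alpha>\<^sup>2) * (1 - I x)" for x
  proof -
    have "f_alpha \<alpha> (q x y / ?g y) * ?g y
       = 4 / (1 - \<alpha>\<^sup>2) * (?g y - J x y)" for y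
    proof -
      have g: "?g y > 0" using v by simp
      have "(q x y / ?g y) powr (1 - b) * ?g y = J x y"
      proof -
        have "?g y = ?g y powr (1 - b) * ?g y powr b" using g by (simp add: powr_add[symmetric])
        then have "(q x y / ?g y) powr (1 - b) * ?g y = (q x y / ?g y) powr (1 - b) * (?g y powr (1 - b) * ?g y powr b)" by simp
        also have "\<dots> = J x y" using g pos[of x y] by (simp add: J_def powr_divide)
        finally show ?thesis .
      qed
      then show ?thesis unfolding f_alpha_def b(3) by (simp add: algebra_simps diff_divide_distrib)
    qed
    then have "D_alpha \<alpha> vy \<mu> (q x) = (\<integral>y. 4 / (1 - \<alpha>\<^sup>2) * (?g y - J x y) \<partial>lborel)"
      by (simp add: D_alpha_def)
    also have "\<dots> = 4 / (1 - \<alpha>\<^sup>2) * (\<integral>y. ?g y - J x y \<partial>lborel)"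
      by (rule integral_mult_right_zero)
    also have "(\<integral>y. ?g y - J x y \<partial>lborel) = 1 - I x"
      using iy iJ[of x] Iy by (simp add: I_def)
    finally show ?thesis .
  qed
  have iI: "integrable lborel (\<lambda>x. I x * ?k x)"
    by (rule Bochner_Integration.integrable_bound[OF ix])
       (use I01 in \<open>auto simp: abs_mult mult_left_le_one_le\<close>)
  have N: "N = (\<integral>\<^sup>+x. ennreal (I x * ?k x) \<partial>lborel)"
    unfolding N_def
  proof (rule nn_integral_cong)
    fix x
    have "(\<integral>\<^sup>+y. ennreal (q x y powr (1 - b) * ?g y powr b * ?k x) \<partial>lborel)
      = (\<integral>\<^sup>+y. ennreal (J x y) * ennreal (?k x) \<partial>lborel)"
      by (simp add: J_def ennreal_mult')
    also have "\<dots> = (\<integral>\<^sup>+y. ennreal (J x y) \<partial>lborel) * ennreal (?k x)"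
      by (rule nn_integral_multc) measurable
    also have "\<dots> = ennreal (I x * ?k x)"
      unfolding eI[symmetric] using I01 by (simp add: ennreal_mult')
    finally show "(\<integral>\<^sup>+y. ennreal (q x y powr (1 - b) * ?g y powr b * ?k x) \<partial>lborel)
      = ennreal (I x * ?k x)" .
  qed
  have "N \<le> (\<integral>\<^sup>+x. ennreal (?k x) \<partial>lborel)"
    unfolding N using I01 by (intro nn_integral_mono ennreal_leI) (auto simp: mult_left_le_one_le)
  then show "N \<le> 1" using gx by simp
  have "(\<integral>x. I x * ?k x \<partial>lborel) = enn2real N"
    unfolding N using I01 by (intro integral_eq_nn_integral) auto
  moreover have "risk \<alpha> vx vy \<mu> q = (\<integral>x. 4 / (1 - \<alpha>\<^sup>2) * (?k x - I x * ?k x) \<partial>lborel)"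
    unfolding risk_def D by (rule Bochner_Integration.integral_cong[OF refl]) (simp add: algebra_simps diff_divide_distrib)
  moreover have "\<dots> = 4 / (1 - \<alpha>\<^sup>2) * (\<integral>x. ?k x - I x * ?k x \<partial>lborel)"
    by (rule integral_mult_right_zero)
  moreover have "(\<integral>x. ?k x - I x * ?k x \<partial>lborel) = 1 - (\<integral>x. I x * ?k x \<partial>lborel)"
    using ix iI Ix by simp
  ultimately show "risk \<alpha> vx vy \<mu> q = 4 / (1 - \<alpha>\<^sup>2) * (1 - enn2real N)" by simp
qed

text \<open>The hypothesis on \<open>b\<close> is the equation defining \<open>\<gamma>\<close>. It
  makes the quadratic form split into the weighted point
  \<open>g *\<^sub>R x + (1 - g) *\<^sub>R y\<close> and the difference \<open>y - x\<close>. The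
  constant in front is shared by both risks.\<close>

lemma gdens_product_factorization:
  fixes x y \<mu> :: "real^'n"
  assumes v: "vx > 0" "vy > 0" and g: "0 < g" "g < 1" and b: "b * (g * vx) = (1 - g) * vy"
  shows "gdens (y - x) (vy / g) powr (1 - b) * gdens (y - \<mu>) vy powr b * gdens (x - \<mu>) vx
    = ((2 * pi * (vy / g)) powr (- real CARD('n) / 2)) powr (1 - b)
      * ((2 * pi * vy) powr (- real CARD('n) / 2)) powr b * (2 * pi * vx) powr (- real CARD('n) / 2)
      / ((2 * pi * (vx * g)) powr (- real CARD('n) / 2) * (2 * pi * (vy / g)) powr (- real CARD('n) / 2))
      * (gdens ((g *\<^sub>R x + (1 - g) *\<^sub>R y) - \<mu>) (vx * g) * gdens (y - x) (vy / g))"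
proof -
  define X Y where "X = x - \<mu>" and "Y = y - \<mu>"
  have yx: "y - x = Y - X" by (simp add: X_def Y_def)
  have w: "(g *\<^sub>R x + (1 - g) *\<^sub>R y) - \<mu> = g *\<^sub>R X + (1 - g) *\<^sub>R Y"
    by (simp add: X_def Y_def algebra_simps)
  define E where "E = (norm (Y - X))\<^sup>2"
  have sq: "(norm (g *\<^sub>R X + (1 - g) *\<^sub>R Y))\<^sup>2 = g * (norm X)\<^sup>2 + (1 - g) * (norm Y)\<^sup>2 - g * (1 - g) * E"
    unfolding E_def power2_norm_eq_inner
    by (simp add: inner_diff_left inner_diff_right inner_add_left inner_add_right inner_commute algebra_simps)
  have expo: "- E / (2 * (vy / g)) * (1 - b) + - (norm Y)\<^sup>2 / (2 * vy) * b + - (norm X)\<^sup>2 / (2 * vx)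
     = - (norm (g *\<^sub>R X + (1 - g) *\<^sub>R Y))\<^sup>2 / (2 * (vx * g)) + - E / (2 * (vy / g))"
  proof -
    have bv: "b / vy = (1 - g) / (g * vx)" using b v g by (simp add: field_simps)
    have "- E / (2 * (vy / g)) * (1 - b) + - (norm Y)\<^sup>2 / (2 * vy) * b + - (norm X)\<^sup>2 / (2 * vx)
      = - E / (2 * (vy / g)) + (g * E / 2) * (b / vy) - (norm Y)\<^sup>2 / 2 * (b / vy) - (norm X)\<^sup>2 / (2 * vx)"
      using v g by (simp add: field_simps)
    also have "\<dots> = - E / (2 * (vy / g)) - (norm (g *\<^sub>R X + (1 - g) *\<^sub>R Y))\<^sup>2 / (2 * (vx * g))"
      unfolding bv sq using v g by (simp add: field_simps)
    finally show ?thesis by simp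
  qed
  have pe: "exp a powr c = exp (a * c)" for a c :: real by (simp add: powr_def mult.commute)
  have "exp (- E / (2 * (vy / g))) powr (1 - b) * exp (- (norm Y)\<^sup>2 / (2 * vy)) powr b * exp (- (norm X)\<^sup>2 / (2 * vx))
    = exp (- (norm (g *\<^sub>R X + (1 - g) *\<^sub>R Y))\<^sup>2 / (2 * (vx * g))) * exp (- E / (2 * (vy / g)))"
    unfolding pe exp_add[symmetric] expo ..
  note main = this
  have c: "(2 * pi * (vx * g)) powr (- real CARD('n) / 2) > 0" "(2 * pi * (vy / g)) powr (- real CARD('n) / 2) > 0"
    using v g by auto
  \<comment> \<open>Separates the normalising constants \<open>a1\<close> to \<open>a5\<close> from
    the exponentials \<open>e1\<close> to \<open>e5\<close>, to which only \<open>main\<close>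
    applies.\<close>
  have gen: "(a1 * e1) powr (1 - b) * (a2 * e2) powr b * (a3 * e3)
     = a1 powr (1 - b) * a2 powr b * a3 / (a4 * a5) * ((a4 * e4) * (a5 * e5))"
    if "e1 powr (1 - b) * e2 powr b * e3 = e4 * e5" "a4 > 0" "a5 > 0" "a1 > 0" "a2 > 0" "e1 > 0" "e2 > 0"
    for a1 a2 a3 a4 a5 e1 e2 e3 e4 e5 :: real
  proof -
    have "(a1 * e1) powr (1 - b) * (a2 * e2) powr b * (a3 * e3)
      = a1 powr (1 - b) * a2 powr b * a3 * (e1 powr (1 - b) * e2 powr b * e3)"
      using that by (simp add: powr_mult)
    also have "\<dots> = a1 powr (1 - b) * a2 powr b * a3 / (a4 * a5) * ((a4 * e4) * (a5 * e5))"
      unfolding that(1) using that by simp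
    finally show ?thesis .
  qed
  show ?thesis
    unfolding yx w X_def[symmetric] Y_def[symmetric] gdens_def E_def[symmetric]
    by (rule gen[OF main]) (use c v g in auto)
qed

text \<open>With \<open>y = x - c *\<^sub>R z\<close> the weighted point is
  \<open>x - \<xi> *\<^sub>R z\<close>. Translating \<open>x\<close> by
  \<open>\<xi> *\<^sub>R z\<close> makes the weighted point the outer variable, and the observation
  becomes that point plus \<open>\<xi> *\<^sub>R z\<close>. The risks can then be compared for each
  weighted point separately.\<close>

lemma nn_integral_disintegrate:
  fixes r :: "real^'n \<Rightarrow> real^'n \<Rightarrow> ennreal" and \<mu> :: "real^'n"
  assumes [measurable]: "(\<lambda>(x, w). r x w) \<in> borel_measurable (borel \<Otimes>\<^sub>M borel)" and c: "c \<noteq> 0"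
  shows "(\<integral>\<^sup>+x. (\<integral>\<^sup>+y. r x (g *\<^sub>R x + (1 - g) *\<^sub>R y) * ennreal (gdens (g *\<^sub>R x + (1 - g) *\<^sub>R y - \<mu>) v)
        * ennreal (gdens (y - x) (c\<^sup>2)) \<partial>lborel) \<partial>lborel)
    = (\<integral>\<^sup>+x. ennreal (gdens (x - \<mu>) v) * (\<integral>\<^sup>+z. r (x + ((1 - g) * c) *\<^sub>R z) x * ennreal (gdens z 1) \<partial>lborel) \<partial>lborel)"
proof -
  define \<xi> where "\<xi> = (1 - g) * c"
  have [measurable]: "(\<lambda>w. r x w) \<in> borel_measurable borel" for x
    using measurable_compose[OF measurable_Pair1'[of x borel borel] assms(1)] by simp
  have m2 [measurable]: "(\<lambda>p. r (fst p) (snd p)) \<in> borel_measurable (borel \<Otimes>\<^sub>M borel)"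
    using assms(1) by (simp add: case_prod_beta')
  have "(\<integral>\<^sup>+y. r x (g *\<^sub>R x + (1 - g) *\<^sub>R y) * ennreal (gdens (g *\<^sub>R x + (1 - g) *\<^sub>R y - \<mu>) v)
        * ennreal (gdens (y - x) (c\<^sup>2)) \<partial>lborel)
     = (\<integral>\<^sup>+z. r x (x - \<xi> *\<^sub>R z) * ennreal (gdens (x - \<xi> *\<^sub>R z - \<mu>) v) * ennreal (gdens z 1) \<partial>lborel)" for x
  proof -
    have e: "g *\<^sub>R x + (1 - g) *\<^sub>R (x + (- c) *\<^sub>R z) = x - \<xi> *\<^sub>R z" for z
      by (simp add: \<xi>_def algebra_simps)
    show ?thesis
      using nn_integral_gdens_affine[of "\<lambda>y. r x (g *\<^sub>R x + (1 - g) *\<^sub>R y) * ennreal (gdens (g *\<^sub>R x + (1 - g) *\<^sub>R y - \<mu>) v)" "- c" x] c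
      unfolding e by simp
  qed
  then have "(\<integral>\<^sup>+x. (\<integral>\<^sup>+y. r x (g *\<^sub>R x + (1 - g) *\<^sub>R y) * ennreal (gdens (g *\<^sub>R x + (1 - g) *\<^sub>R y - \<mu>) v)
        * ennreal (gdens (y - x) (c\<^sup>2)) \<partial>lborel) \<partial>lborel)
     = (\<integral>\<^sup>+x. (\<integral>\<^sup>+z. r x (x - \<xi> *\<^sub>R z) * ennreal (gdens (x - \<xi> *\<^sub>R z - \<mu>) v) * ennreal (gdens z 1) \<partial>lborel) \<partial>lborel)"
    by simp
  also have "\<dots> = (\<integral>\<^sup>+z. (\<integral>\<^sup>+x. r x (x - \<xi> *\<^sub>R z) * ennreal (gdens (x - \<xi> *\<^sub>R z - \<mu>) v) * ennreal (gdens z 1) \<partial>lborel) \<partial>lborel)"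
    by (rule lborel_pair.Fubini'[symmetric]) measurable
  also have "\<dots> = (\<integral>\<^sup>+z. (\<integral>\<^sup>+x. r (\<xi> *\<^sub>R z + x) x * ennreal (gdens (x - \<mu>) v) * ennreal (gdens z 1) \<partial>lborel) \<partial>lborel)"
  proof (rule nn_integral_cong)
    fix z :: "real^'n"
    show "(\<integral>\<^sup>+x. r x (x - \<xi> *\<^sub>R z) * ennreal (gdens (x - \<xi> *\<^sub>R z - \<mu>) v) * ennreal (gdens z 1) \<partial>lborel)
      = (\<integral>\<^sup>+x. r (\<xi> *\<^sub>R z + x) x * ennreal (gdens (x - \<mu>) v) * ennreal (gdens z 1) \<partial>lborel)"
    proof -
      have [measurable]: "(\<lambda>x. r x (x - \<xi> *\<^sub>R z)) \<in> borel_measurable borel"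
        using measurable_compose[OF _ m2, of "\<lambda>x. (x, x - \<xi> *\<^sub>R z)" borel] by simp
      have "(\<lambda>x. r x (x - \<xi> *\<^sub>R z) * ennreal (gdens (x - \<xi> *\<^sub>R z - \<mu>) v) * ennreal (gdens z 1)) \<in> borel_measurable borel"
        by measurable
      from lborel_nn_integral_translate[OF this, of "\<xi> *\<^sub>R z"] show ?thesis by simp
    qed
  qed
  also have "\<dots> = (\<integral>\<^sup>+x. (\<integral>\<^sup>+z. r (\<xi> *\<^sub>R z + x) x * ennreal (gdens (x - \<mu>) v) * ennreal (gdens z 1) \<partial>lborel) \<partial>lborel)"
    by (rule lborel_pair.Fubini') measurable
  also have "\<dots> = (\<integral>\<^sup>+x. ennreal (gdens (x - \<mu>) v) * (\<integral>\<^sup>+z. r (x + \<xi> *\<^sub>R z) x * ennreal (gdens z 1) \<partial>lborel) \<partial>lborel)"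
  proof (rule nn_integral_cong)
    fix x :: "real^'n"
    have [measurable]: "(\<lambda>z. r (x + \<xi> *\<^sub>R z) x) \<in> borel_measurable borel"
      using measurable_compose[OF _ m2, of "\<lambda>z. (x + \<xi> *\<^sub>R z, x)" borel] by simp
    have "(\<lambda>z. r (x + \<xi> *\<^sub>R z) x * ennreal (gdens z 1)) \<in> borel_measurable lborel" by measurable
    from nn_integral_cmult[OF this, of "ennreal (gdens (x - \<mu>) v)"]
    show "(\<integral>\<^sup>+z. r (\<xi> *\<^sub>R z + x) x * ennreal (gdens (x - \<mu>) v) * ennreal (gdens z 1) \<partial>lborel)
      = ennreal (gdens (x - \<mu>) v) * (\<integral>\<^sup>+z. r (x + \<xi> *\<^sub>R z) x * ennreal (gdens z 1) \<partial>lborel)"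
      by (simp only: add.commute[of x] mult_ac)
  qed
  finally show ?thesis by (simp add: \<xi>_def)
qed

text \<open>The last identity computes the \<open>S\<close> of the overview as
  \<open>b^2 * (vx / vy)\<close>. It accounts for the factor
  \<open>(2 / (1 - \<alpha>))^2 = 1 / b^2\<close> in the bound on \<open>vx / vy\<close>.\<close>

lemma predictive_parameters:
  assumes "vx > 0" "vy > 0" "-1 < \<alpha>" "\<alpha> < 1"
  defines "b \<equiv> beta_of \<alpha>" and "g \<equiv> gamma_of \<alpha> vx vy" and "\<xi> \<equiv> xi_of \<alpha> vx vy"
  shows "0 < b" "b < 1" "1 / b = 2 / (1 - \<alpha>)" "0 < g" "g < 1" "b * (g * vx) = (1 - g) * vy"
    "0 < \<xi>" "\<xi>\<^sup>2 / (vx * g) = b\<^sup>2 * (vx / vy)"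
proof -
  show b: "0 < b" "b < 1" "1 / b = 2 / (1 - \<alpha>)" using assms by (auto simp: b_def beta_of_def)
  define u where "u = b * vx / vy"
  have u: "u > 0" using b(1) assms(1,2) by (simp add: u_def)
  have gu: "g = 1 / (1 + u)" by (simp add: g_def gamma_of_def u_def b_def)
  show g: "0 < g" "g < 1" using u by (auto simp: gu)
  have g1: "1 - g = u * g" using u by (simp add: gu field_simps)
  show "b * (g * vx) = (1 - g) * vy" unfolding g1 using assms(1,2) by (simp add: u_def)
  have \<xi>: "\<xi> = (1 - g) * sqrt (vy / g)" by (simp add: \<xi>_def xi_of_def g_def)
  show "0 < \<xi>" unfolding \<xi> using g assms(1,2) by simp
  have "\<xi>\<^sup>2 = (u * g)\<^sup>2 * (vy / g)" unfolding \<xi> g1 using g assms(1,2) by (simp add: power_mult_distrib)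
  then show "\<xi>\<^sup>2 / (vx * g) = b\<^sup>2 * (vx / vy)"
    using g assms(1,2) by (simp add: u_def power2_eq_square field_simps)
qed

lemma variance_ratio_bound:
  fixes p S \<delta> :: real
  assumes "p > 1" "\<delta> > 0" and d: "d = 2 * (\<delta> + 1)"
    and S: "S \<le> (d + 2) / d * (1 - frac (real_of_int (\<lfloor>p\<rfloor> + 1) - p))
      / (2 * real_of_int (\<lfloor>p\<rfloor> + 1) * (real_of_int (\<lfloor>p\<rfloor> + 1) - 1))"
  shows "8 * ((p - 1/2) * S) * (\<delta> + 1) \<le> 3 * (\<delta> + 2)"
proof -
  define k where "k = real_of_int (\<lfloor>p\<rfloor> + 1)"
  have k: "k \<ge> 2" "p \<le> k"
    using assms(1) by (auto simp: k_def le_floor_iff)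
  \<comment> \<open>The factor with the fractional part is at most 1.\<close>
  have "S \<le> (d + 2) / d * 1 / (2 * k * (k - 1))"
    using S[folded k_def] k assms(2) d frac_ge_0[of "k - p"]
    by (elim order_trans, intro divide_right_mono mult_left_mono) auto
  also have "(d + 2) / d = (\<delta> + 2) / (\<delta> + 1)" using assms(2) by (simp add: d field_simps)
  finally have "S \<le> (\<delta> + 2) / (\<delta> + 1) / (2 * k * (k - 1))" by simp
  then have "8 * ((p - 1/2) * S) * (\<delta> + 1) \<le> 8 * ((p - 1/2) * ((\<delta> + 2) / (\<delta> + 1) / (2 * k * (k - 1)))) * (\<delta> + 1)"
    using assms(1,2) by (intro mult_right_mono mult_left_mono) auto
  also have "\<dots> \<le> 8 * ((k - 1/2) * ((\<delta> + 2) / (\<delta> + 1) / (2 * k * (k - 1)))) * (\<delta> + 1)"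
    using assms(2) k by (intro mult_right_mono mult_left_mono) auto
  also have "\<dots> = (\<delta> + 2) * ((4 * k - 2) / (k * (k - 1)))"
  proof -
    define e where "e = k * (k - 1)"
    have e: "e > 0" "2 * k * (k - 1) = 2 * e" using k by (auto simp: e_def)
    have "8 * ((k - 1/2) * (A / (2 * e))) * B = 8 * (k - 1/2) * (A * B) / (2 * e)" for A B :: real
      using e(1) by (simp add: field_simps)
    from this[of "(\<delta> + 2) / (\<delta> + 1)" "\<delta> + 1"]
    have "8 * ((k - 1/2) * ((\<delta> + 2) / (\<delta> + 1) / (2 * e))) * (\<delta> + 1)
      = 8 * (k - 1/2) * ((\<delta> + 2) / (\<delta> + 1) * (\<delta> + 1)) / (2 * e)" .
    also have "(\<delta> + 2) / (\<delta> + 1) * (\<delta> + 1) = \<delta> + 2" using assms(2) by simp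
    finally have f: "8 * ((k - 1/2) * ((\<delta> + 2) / (\<delta> + 1) / (2 * e))) * (\<delta> + 1)
      = 8 * (k - 1/2) * (\<delta> + 2) / (2 * e)" .
    show ?thesis unfolding e(2) e_def[symmetric] f using e(1) by (simp add: field_simps)
  qed
  also have "\<dots> \<le> (\<delta> + 2) * 3"
  proof (intro mult_left_mono)
    \<comment> \<open>The root \<open>k = 2\<close> shows where the constant 3 is attained.\<close>
    have "3 * (k * (k - 1)) - (4 * k - 2) = (3 * k - 1) * (k - 2)" by (simp add: algebra_simps)
    moreover have "(3 * k - 1) * (k - 2) \<ge> 0" using k by simp
    ultimately have "4 * k - 2 \<le> 3 * (k * (k - 1))" by linarith
    then show "(4 * k - 2) / (k * (k - 1)) \<le> 3" using k by (simp add: field_simps)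
  qed (use assms in auto)
  finally show ?thesis by simp
qed

lemma risk_pH_le_risk_pU:
  fixes \<mu> :: "real^'n"
  assumes \<delta>: "\<delta> > 0" "real CARD('n) = 2 * (\<delta> + 1)"
    and v: "vx > 0" "vy > 0" and \<alpha>: "-1 < \<alpha>" "\<alpha> < 1"
    and ratio: "8 * ((1 / beta_of \<alpha> - 1/2) * ((beta_of \<alpha>)\<^sup>2 * (vx / vy))) * (\<delta> + 1) \<le> 3 * (\<delta> + 2)"
  shows "risk \<alpha> vx vy \<mu> (pH \<alpha> vx vy) \<le> risk \<alpha> vx vy \<mu> (pU \<alpha> vx vy)"
proof -
  let ?H = "pH \<alpha> vx vy :: real^'n \<Rightarrow> real^'n \<Rightarrow> real"
  let ?U = "pU \<alpha> vx vy :: real^'n \<Rightarrow> real^'n \<Rightarrow> real"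
  define b g \<xi> where "b = beta_of \<alpha>" and "g = gamma_of \<alpha> vx vy" and "\<xi> = xi_of \<alpha> vx vy"
  note par = predictive_parameters[OF v \<alpha>, folded b_def g_def \<xi>_def]
  define p V s S where "p = 1 / b" and "V = vx * g" and "s = vy / g" and "S = \<xi>\<^sup>2 / V"
  define c where "c = sqrt s"
  have p: "p > 1" unfolding p_def using par(1,2) by simp
  have V: "V > 0" and s: "s > 0" using par v by (auto simp: V_def s_def)
  have c: "c \<noteq> 0" "c\<^sup>2 = s" using s by (auto simp: c_def)
  have \<xi>c: "\<xi> = (1 - g) * c" by (simp add: \<xi>_def c_def s_def xi_of_def g_def)
  have S: "S > 0" "8 * ((p - 1/2) * S) * (\<delta> + 1) \<le> 3 * (\<delta> + 2)"
  proof -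
    show "S > 0" using par(7) V by (simp add: S_def)
    have Sb: "S = b\<^sup>2 * (vx / vy)" unfolding S_def V_def by (rule par(8))
    show "8 * ((p - 1/2) * S) * (\<delta> + 1) \<le> 3 * (\<delta> + 2)"
      using ratio unfolding Sb p_def b_def .
  qed
  have sqS: "sqrt S = \<xi> / sqrt V" using par V by (simp add: S_def real_sqrt_divide)
  define K where "K = (2 * V) powr (- \<delta>) / Gamma \<delta>"
  have K: "K > 0" using V \<delta> by (simp add: K_def Gamma_real_pos)
  define m where "m w = trunc_gamma \<delta> ((norm w)\<^sup>2 / (2 * V))" for w :: "real^'n"
  define D where "D x = smoothed_power \<delta> p S ((1 / sqrt V) *\<^sub>R x)" for x :: "real^'n"
  have m: "m w > 0" for w unfolding m_def by (rule trunc_gamma_pos[OF \<delta>(1)])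
  have D: "D x > 0" for x unfolding D_def by (rule smoothed_power_pos) (use \<delta> p in auto)
  note [measurable] = borel_measurable_trunc_gamma[OF \<delta>(1)] borel_measurable_smoothed_power[OF \<delta>(1)]
  have [measurable]: "m \<in> borel_measurable borel" unfolding m_def by measurable
  have [measurable]: "D \<in> borel_measurable borel" unfolding D_def by measurable
  have m_shift: "m (x + \<xi> *\<^sub>R z) = trunc_gamma \<delta> ((norm ((1 / sqrt V) *\<^sub>R x + sqrt S *\<^sub>R z))\<^sup>2 / 2)" for x z
  proof -
    have "(1 / sqrt V) *\<^sub>R x + sqrt S *\<^sub>R z = (1 / sqrt V) *\<^sub>R (x + \<xi> *\<^sub>R z)"
      by (simp add: sqS scaleR_right_distrib)
    then show ?thesis using V by (simp add: m_def power_mult_distrib power_divide mult.commute[of V])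
  qed
  have mH: "mH w V = K * m w" for w :: "real^'n"
    unfolding K_def m_def by (rule mH_eq_trunc_gamma[OF \<delta> V])
  have int_D: "(\<integral>z. m (x + \<xi> *\<^sub>R z) powr p * gdens z 1 \<partial>lborel) = D x" for x
    unfolding D_def smoothed_power_def m_shift by (simp add: mult.commute)
  have nn_D: "(\<integral>\<^sup>+z. ennreal (m (x + \<xi> *\<^sub>R z) powr p) * ennreal (gdens z 1) \<partial>lborel) = ennreal (D x)" for x
  proof -
    have "(\<integral>\<^sup>+z. ennreal (m (x + \<xi> *\<^sub>R z) powr p * gdens z 1) \<partial>lborel) = ennreal (D x)"
      unfolding int_D[symmetric] m_shift
      using integrable_smoothed_power[OF \<delta>(1), of p "(1 / sqrt V) *\<^sub>R x" S] p
      by (intro nn_integral_eq_integral) (auto simp: mult.commute)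
    then show ?thesis by (simp add: ennreal_mult')
  qed
  define w where "w x y = g *\<^sub>R x + (1 - g) *\<^sub>R y" for x y :: "real^'n"
  have pH: "?H x y = m (w x y) powr p / D x * gdens (y - x) s" for x y
  proof -
    have "?H x y = mH (w x y) V powr p / (\<integral>z. mH (x + \<xi> *\<^sub>R z) V powr p * gdens z 1 \<partial>lborel) * gdens (y - x) s"
      by (simp add: pH_def Let_def w_def p_def V_def s_def b_def g_def \<xi>_def)
    \<comment> \<open>The constant \<open>K powr p\<close> occurs in the numerator too and
      cancels.\<close>
    also have "(\<integral>z. mH (x + \<xi> *\<^sub>R z) V powr p * gdens z 1 \<partial>lborel) = K powr p * D x"
    proof -
      have eq: "mH (x + \<xi> *\<^sub>R z) V powr p * gdens z 1 = K powr p * (m (x + \<xi> *\<^sub>R z) powr p * gdens z 1)" for z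
        unfolding mH using K m[of "x + \<xi> *\<^sub>R z"] by (simp add: powr_mult)
      show ?thesis unfolding eq by (simp add: int_D)
    qed
    finally show ?thesis unfolding mH using K m[of "w x y"] by (simp add: powr_mult)
  qed
  have pU: "?U x y = gdens (y - x) s" for x y :: "real^'n"
    by (simp add: pU_def s_def g_def)
  define N where "N q = (\<integral>\<^sup>+x. (\<integral>\<^sup>+y. ennreal (q x y powr (1 - b) * gdens (y - \<mu>) vy powr b * gdens (x - \<mu>) vx) \<partial>lborel) \<partial>lborel)"
    for q :: "real^'n \<Rightarrow> real^'n \<Rightarrow> real"
  have riskH: "N (?H) \<le> 1" "risk \<alpha> vx vy \<mu> (?H) = 4 / (1 - \<alpha>\<^sup>2) * (1 - enn2real (N (?H)))"
  proof -
    have 1: "(\<lambda>(x :: real^'n, y). ?H x y) \<in> borel_measurable (borel \<Otimes>\<^sub>M borel)"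
    proof -
      have a: "(\<lambda>(x, y). m (w x y) powr p / D x * gdens (y - x) s) \<in> borel_measurable (borel \<Otimes>\<^sub>M borel)"
        unfolding w_def by measurable
      have e: "(\<lambda>(x :: real^'n, y). ?H x y) = (\<lambda>(x, y). m (w x y) powr p / D x * gdens (y - x) s)"
        by (simp add: fun_eq_iff pH)
      show ?thesis unfolding e by (rule a)
    qed
    have 2: "?H x y > 0" for x y :: "real^'n"
      unfolding pH using m[of "w x y"] D[of x] s by simp
    have 3: "(\<integral>\<^sup>+y. ennreal (?H x y) \<partial>lborel) \<le> 1" for x :: "real^'n"
    proof -
      have "(\<integral>\<^sup>+y. ennreal (?H x y) \<partial>lborel)
         = (\<integral>\<^sup>+y. ennreal (1 / D x) * (ennreal (m (w x y) powr p) * ennreal (gdens (y - x) (c\<^sup>2))) \<partial>lborel)"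
        unfolding pH c(2) using D[of x] by (intro nn_integral_cong) (simp add: ennreal_mult'[symmetric])
      also have "\<dots> = ennreal (1 / D x) * (\<integral>\<^sup>+y. ennreal (m (w x y) powr p) * ennreal (gdens (y - x) (c\<^sup>2)) \<partial>lborel)"
        unfolding w_def by (rule nn_integral_cmult) measurable
      also have "(\<integral>\<^sup>+y. ennreal (m (w x y) powr p) * ennreal (gdens (y - x) (c\<^sup>2)) \<partial>lborel)
         = (\<integral>\<^sup>+z. ennreal (m (w x (x + c *\<^sub>R z)) powr p) * ennreal (gdens z 1) \<partial>lborel)"
        unfolding w_def by (rule nn_integral_gdens_affine[OF _ c(1)]) measurable
      also have "(\<lambda>z. w x (x + c *\<^sub>R z)) = (\<lambda>z. x + \<xi> *\<^sub>R z)"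
        by (auto simp: w_def \<xi>c algebra_simps)
      then have "(\<integral>\<^sup>+z. ennreal (m (w x (x + c *\<^sub>R z)) powr p) * ennreal (gdens z 1) \<partial>lborel) = ennreal (D x)"
        unfolding nn_D[symmetric] by (simp add: fun_eq_iff)
      also have "ennreal (1 / D x) * ennreal (D x) = 1"
        using D[of x] by (simp add: ennreal_mult'[symmetric] less_imp_le)
      finally show ?thesis by simp
    qed
    show "N (?H) \<le> 1" "risk \<alpha> vx vy \<mu> (?H) = 4 / (1 - \<alpha>\<^sup>2) * (1 - enn2real (N (?H)))"
      unfolding N_def b_def by (rule risk_eq[OF \<alpha> v 1 2 3])+
  qed
  have riskU: "risk \<alpha> vx vy \<mu> (?U) = 4 / (1 - \<alpha>\<^sup>2) * (1 - enn2real (N (?U)))"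
  proof -
    have 1: "(\<lambda>(x, y). ?U x y :: real) \<in> borel_measurable ((borel :: (real^'n) measure) \<Otimes>\<^sub>M borel)"
    proof -
      have a: "(\<lambda>(x, y). gdens (y - x) s) \<in> borel_measurable ((borel :: (real^'n) measure) \<Otimes>\<^sub>M borel)"
        by measurable
      have e: "(\<lambda>(x, y). ?U x y) = (\<lambda>(x :: real^'n, y). gdens (y - x) s)"
        by (simp add: fun_eq_iff pU)
      show ?thesis unfolding e by (rule a)
    qed
    have 2: "?U x y > 0" for x y :: "real^'n"
      unfolding pU using s by simp
    have 3: "(\<integral>\<^sup>+y. ennreal (?U x y) \<partial>lborel) \<le> 1" for x :: "real^'n"
      unfolding pU using lborel_nn_integral_translate[of "\<lambda>y. ennreal (gdens y s)" "- x"] nn_integral_gdens[OF s, where 'n='n] by simp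
    show ?thesis unfolding N_def b_def by (rule risk_eq(2)[OF \<alpha> v 1 2 3])
  qed
  define C where "C = ((2 * pi * (vy / g)) powr (- real CARD('n) / 2)) powr (1 - b)
      * ((2 * pi * vy) powr (- real CARD('n) / 2)) powr b * (2 * pi * vx) powr (- real CARD('n) / 2)
      / ((2 * pi * (vx * g)) powr (- real CARD('n) / 2) * (2 * pi * (vy / g)) powr (- real CARD('n) / 2))"
  have C: "C \<ge> 0" by (simp add: C_def)
  have fact: "gdens (y - x) s powr (1 - b) * gdens (y - \<mu>) vy powr b * gdens (x - \<mu>) vx
      = C * (gdens (w x y - \<mu>) V * gdens (y - x) s)" for x y
    unfolding C_def w_def V_def s_def by (rule gdens_product_factorization[OF v par(4,5,6)])
  \<comment> \<open>The ratio of the two predictive densities, raised to the power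
    \<open>1 - b\<close>, at the observation \<open>x\<close> and the weighted point
    \<open>u\<close>.\<close>
  define r where "r x u = m u powr (p - 1) * D x powr (- ((p - 1) / p))" for x u
  have NU: "N (?U) = (\<integral>\<^sup>+x. ennreal (gdens (x - \<mu>) V) * (\<integral>\<^sup>+z. ennreal C * ennreal (gdens (z :: real^'n) 1) \<partial>lborel) \<partial>lborel)"
  proof -
    have "N (?U) = (\<integral>\<^sup>+x. (\<integral>\<^sup>+y. ennreal C * ennreal (gdens (w x y - \<mu>) V) * ennreal (gdens (y - x) (c\<^sup>2)) \<partial>lborel) \<partial>lborel)"
      unfolding N_def pU fact c(2) using C by (simp add: ennreal_mult' mult.assoc)
    also have "\<dots> = (\<integral>\<^sup>+x. ennreal (gdens (x - \<mu>) V) * (\<integral>\<^sup>+z. ennreal C * ennreal (gdens (z :: real^'n) 1) \<partial>lborel) \<partial>lborel)"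
      unfolding w_def by (rule nn_integral_disintegrate[OF _ c(1)]) measurable
    finally show ?thesis .
  qed
  have NH: "N (?H) = (\<integral>\<^sup>+x. ennreal (gdens (x - \<mu>) V) * (\<integral>\<^sup>+z. ennreal (C * r (x + \<xi> *\<^sub>R z) x) * ennreal (gdens z 1) \<partial>lborel) \<partial>lborel)"
  proof -
    have "N (?H) = (\<integral>\<^sup>+x. (\<integral>\<^sup>+y. ennreal (C * r x (w x y)) * ennreal (gdens (w x y - \<mu>) V) * ennreal (gdens (y - x) (c\<^sup>2)) \<partial>lborel) \<partial>lborel)"
      unfolding N_def
    proof (intro nn_integral_cong)
      fix x y
      have "(m (w x y) powr p / D x) powr (1 - b) = r x (w x y)"
      proof -
        have e: "p * (1 - b) = p - 1" "1 - b = (p - 1) / p" using par by (auto simp: p_def field_simps)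
        have "(m (w x y) powr p / D x) powr (1 - b) = (m (w x y) powr p) powr (1 - b) / D x powr (1 - b)"
          using m[of "w x y"] D[of x] by (simp add: powr_divide)
        also have "(m (w x y) powr p) powr (1 - b) = m (w x y) powr (p - 1)"
          unfolding powr_powr e(1) ..
        finally show ?thesis unfolding r_def powr_minus divide_inverse[symmetric] e(2) .
      qed
      moreover have "(u * gdens (y - x) s) powr (1 - b) = u powr (1 - b) * gdens (y - x) s powr (1 - b)"
        if "u > 0" for u using that s by (simp add: powr_mult)
      ultimately have "?H x y powr (1 - b) = r x (w x y) * gdens (y - x) s powr (1 - b)"
        unfolding pH using m[of "w x y"] D[of x] by (simp del: times_divide_eq_left)
      then have "?H x y powr (1 - b) * gdens (y - \<mu>) vy powr b * gdens (x - \<mu>) vx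
        = r x (w x y) * (gdens (y - x) s powr (1 - b) * gdens (y - \<mu>) vy powr b * gdens (x - \<mu>) vx)" by simp
      also have "\<dots> = (C * r x (w x y)) * (gdens (w x y - \<mu>) V * gdens (y - x) s)"
        unfolding fact by simp
      finally show "ennreal (?H x y powr (1 - b) * gdens (y - \<mu>) vy powr b * gdens (x - \<mu>) vx)
        = ennreal (C * r x (w x y)) * ennreal (gdens (w x y - \<mu>) V) * ennreal (gdens (y - x) (c\<^sup>2))"
        using C by (simp add: ennreal_mult' c(2) mult.assoc r_def)
    qed
    also have "\<dots> = (\<integral>\<^sup>+x. ennreal (gdens (x - \<mu>) V) * (\<integral>\<^sup>+z. ennreal (C * r (x + ((1 - g) * c) *\<^sub>R z) x) * ennreal (gdens z 1) \<partial>lborel) \<partial>lborel)"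
      unfolding w_def r_def by (rule nn_integral_disintegrate[OF _ c(1)]) measurable
    finally show ?thesis unfolding \<xi>c .
  qed
  \<comment> \<open>From here on \<open>x\<close> is the weighted point, and the integrands are
    compared at each \<open>x\<close> after rescaling by \<open>sqrt V\<close>.\<close>
  have "N (?U) \<le> N (?H)"
    unfolding NU NH
  proof (rule nn_integral_mono, rule mult_left_mono)
    fix x :: "real^'n"
    define x' where "x' = (1 / sqrt V) *\<^sub>R x"
    have mx: "m x = trunc_gamma \<delta> ((norm x')\<^sup>2 / 2)"
      using m_shift[of x 0] by (simp add: x'_def)
    have Dx: "D (x + \<xi> *\<^sub>R z) = smoothed_power \<delta> p S (x' + sqrt S *\<^sub>R z)" for z
      by (simp add: D_def x'_def sqS scaleR_right_distrib)
    have "(\<integral>\<^sup>+z. ennreal C * ennreal (gdens (z :: real^'n) 1) \<partial>lborel) = ennreal C"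
      using nn_integral_gdens[of 1, where 'n='n] by (simp add: nn_integral_cmult)
    also have "\<dots> = ennreal (C * m x powr (p - 1)) * ennreal (m x powr (- (p - 1)))"
      using C m[of x] by (simp add: ennreal_mult'[symmetric] powr_add[symmetric])
    also have "\<dots> \<le> ennreal (C * m x powr (p - 1))
       * (\<integral>\<^sup>+z. ennreal (gdens z 1 * D (x + \<xi> *\<^sub>R z) powr (- ((p - 1) / p))) \<partial>lborel)"
      unfolding Dx mx by (intro mult_left_mono Gaussian_mean_smoothed_power_ge \<delta> p S) simp
    also have "\<dots> = (\<integral>\<^sup>+z. ennreal (C * m x powr (p - 1)) * ennreal (gdens z 1 * D (x + \<xi> *\<^sub>R z) powr (- ((p - 1) / p))) \<partial>lborel)"
      by (rule nn_integral_cmult[symmetric]) measurable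
    also have "\<dots> = (\<integral>\<^sup>+z. ennreal (C * r (x + \<xi> *\<^sub>R z) x) * ennreal (gdens z 1) \<partial>lborel)"
    proof (rule nn_integral_cong)
      fix z :: "real^'n"
      have "(C * m x powr (p - 1)) * (gdens z 1 * D (x + \<xi> *\<^sub>R z) powr (- ((p - 1) / p))) = C * r (x + \<xi> *\<^sub>R z) x * gdens z 1"
        by (simp add: r_def)
      moreover have "0 \<le> C * m x powr (p - 1)" "0 \<le> C * r (x + \<xi> *\<^sub>R z) x" using C by (auto simp: r_def)
      ultimately show "ennreal (C * m x powr (p - 1)) * ennreal (gdens z 1 * D (x + \<xi> *\<^sub>R z) powr (- ((p - 1) / p)))
        = ennreal (C * r (x + \<xi> *\<^sub>R z) x) * ennreal (gdens z 1)"
        by (simp only: ennreal_mult'[symmetric])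
    qed
    finally show "(\<integral>\<^sup>+z. ennreal C * ennreal (gdens (z :: real^'n) 1) \<partial>lborel)
       \<le> (\<integral>\<^sup>+z. ennreal (C * r (x + \<xi> *\<^sub>R z) x) * ennreal (gdens z 1) \<partial>lborel)" .
  qed simp
  \<comment> \<open>The finiteness in \<open>riskH(1)\<close> matters: \<open>enn2real\<close> sends
    infinity to 0 and would otherwise not be monotone.\<close>
  then have "enn2real (N (?U)) \<le> enn2real (N (?H))"
    using riskH(1) by (intro enn2real_mono) (auto simp: le_less_trans)
  moreover have "4 / (1 - \<alpha>\<^sup>2) \<ge> 0"
    using \<alpha> by (simp add: abs_square_le_1 abs_le_iff)
  ultimately show ?thesis
    unfolding riskH(2) riskU by (intro mult_left_mono) auto
qed

theorem theorem6:
  fixes vx vy \<alpha> :: real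
    and \<mu> :: "real ^ 'n"
  assumes "CARD('n) \<ge> 3"
    and "vx > 0" and "vy > 0"
    and "-1 < \<alpha>" and "\<alpha> < 1"
    and "2 / (1 - \<alpha>) \<notin> \<int>"
    and "vx / vy \<le> (2 / (1 - \<alpha>))\<^sup>2 * ((real CARD('n) + 2) / real CARD('n))
            * (1 - frac (real_of_int (\<lfloor>2 / (1 - \<alpha>)\<rfloor> + 1) - 2 / (1 - \<alpha>)))
            / (2 * real_of_int (\<lfloor>2 / (1 - \<alpha>)\<rfloor> + 1) * (real_of_int (\<lfloor>2 / (1 - \<alpha>)\<rfloor> + 1) - 1))"
  shows "risk \<alpha> vx vy \<mu> (pH \<alpha> vx vy) \<le> risk \<alpha> vx vy \<mu> (pU \<alpha> vx vy)"
proof -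
  define \<delta> where "\<delta> = real CARD('n) / 2 - 1"
  have \<delta>: "\<delta> > 0" "real CARD('n) = 2 * (\<delta> + 1)" using assms(1) by (auto simp: \<delta>_def)
  define p where "p = 2 / (1 - \<alpha>)"
  have b: "beta_of \<alpha> = 1 / p" by (simp add: beta_of_def p_def)
  have p: "p > 1" using assms(4,5) by (simp add: p_def field_simps)
  \<comment> \<open>The factor \<open>(1 / p)^2\<close> turns the bound on \<open>vx / vy\<close>
    into one on \<open>S\<close>.\<close>
  have "(1 / p)\<^sup>2 * (vx / vy) \<le> (1 / p)\<^sup>2 * (p\<^sup>2 * ((real CARD('n) + 2) / real CARD('n))
       * (1 - frac (real_of_int (\<lfloor>p\<rfloor> + 1) - p)) / (2 * real_of_int (\<lfloor>p\<rfloor> + 1) * (real_of_int (\<lfloor>p\<rfloor> + 1) - 1)))"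
    using assms(7) unfolding p_def[symmetric] by (intro mult_left_mono) auto
  also have "\<dots> = (real CARD('n) + 2) / real CARD('n) * (1 - frac (real_of_int (\<lfloor>p\<rfloor> + 1) - p))
       / (2 * real_of_int (\<lfloor>p\<rfloor> + 1) * (real_of_int (\<lfloor>p\<rfloor> + 1) - 1))"
    using p by (simp add: power_divide)
  finally have "8 * ((p - 1/2) * ((1 / p)\<^sup>2 * (vx / vy))) * (\<delta> + 1) \<le> 3 * (\<delta> + 2)"
    using p \<delta> by (intro variance_ratio_bound[of p \<delta> "real CARD('n)"]) auto
  then show ?thesis
    using assms \<delta> p by (intro risk_pH_le_risk_pU[of \<delta>]) (auto simp: b)
qed

end
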